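(* Let the operator $A=(\operatorname{sgn} x)\left(-\frac{d^2}{dx^2}+q(x)\right)$ be similar to a selfadjoint operator. Then $$\frac{\operatorname{Im}M_+(t)}{M_+(t)-M_-(t)}\in L^\infty(\mathbb R)\qquad\text{and}\qquad\frac{\operatorname{Im}M_-(t)}{M_+(t)-M_-(t)}\in L^\infty(\mathbb R).$$
   Context: Setting. $q:\mathbb R\to\mathbb R$ is continuous, and the minimal operators $L^\pm_{\min}$ generated by $-\frac{d^2}{dx^2}+q(x)$ in $L^2(\mathbb R_\pm)$ have deficiency indices $(1,1)$ (limit point case at $\pm\infty$). $L=-\frac{d^2}{dx^2}+q(x)$ denotes the corresponding selfadjoint operator in $L^2(\mathbb R)$, $J$ is multiplication by $\operatorname{sgn}x$, and $A=JL$ with $\operatorname{dom}A=\operatorname{dom}L$. Weyl functions. Let $s(x,\lambda),c(x,\lambda)$ solve $-y''+qy=\lambda y$ with $s(0,\lambda)=c'(0,\lambda)=0$, $s'(0,\lambda)=c(0,\lambda)=1$. For $\lambda\in\mathbb C\setminus\mathbb R$, $m_\pm(\lambda)$ is the number such that $s(\cdot,\lambda)\mp m_\pm(\lambda)c(\cdot,\lambda)\in L^2(\mathbb R_\pm)$. Put $M_\pm(\lambda):=\pm m_\pm(\pm\lambda)$; these are Nevanlinna–Herglotz functions. For a.e. $t\in\mathbb R$ the limit $M_\pm(t):=M_\pm(t+i0)$ exists, and $M_+(t)\ne M_-(t)$ for a.e. $t$. Closed operators $T_1,T_2$ in a Hilbert space are similar if there is a bounded operator $V$ with bounded inverse such that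 $V\operatorname{dom}(T_1)=\operatorname{dom}(T_2)$ and $T_2=VT_1V^{-1}$. *)

theory Defs
  imports "HOL-Analysis.Analysis"
begin

section \<open>The complex Hilbert space of square integrable functions on the line\<close>

definition square_integrable :: "(real \<Rightarrow> complex) \<Rightarrow> bool" where
  "square_integrable f \<longleftrightarrow>
     f \<in> borel_measurable lebesgue \<and> integrable lebesgue (\<lambda>x. (norm (f x))\<^sup>2)"

lemma square_integrable_0: "square_integrable (\<lambda>x. 0)"
  by (simp add: square_integrable_def)

lemma square_integrable_mult:
  assumes "square_integrable f" "square_integrable g"
  shows "integrable lebesgue (\<lambda>x. f x * cnj (g x))"
proof (rule Bochner_Integration.integrable_bound)
  show "integrable lebesgue (\<lambda>x. (norm (f x))\<^sup>2 + (norm (g x))\<^sup>2)"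
    using assms by (simp add: square_integrable_def)
  have [measurable]: "f \<in> borel_measurable lebesgue" "g \<in> borel_measurable lebesgue"
    using assms by (simp_all add: square_integrable_def)
  have "cnj \<in> borel_measurable borel"
    by (intro borel_measurable_continuous_onI continuous_intros)
  then have [measurable]: "(\<lambda>x. cnj (g x)) \<in> borel_measurable lebesgue"
    by measurable
  show "(\<lambda>x. f x * cnj (g x)) \<in> borel_measurable lebesgue"
    by measurable
  have "a * b \<le> a\<^sup>2 + b\<^sup>2" for a b :: real
  proof -
    have "2 * (a * b) \<le> a\<^sup>2 + b\<^sup>2" "0 \<le> a\<^sup>2 + b\<^sup>2"
      using sum_squares_bound [of a b] by simp_all
    then show ?thesis by linarith
  qed
  then show "AE x in lebesgue. norm (f x * cnj (g x)) \<le> norm ((norm (f x))\<^sup>2 + (norm (g x))\<^sup>2)"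
    by (auto simp: norm_mult)
qed

lemma square_integrable_scale:
  assumes "square_integrable f"
  shows "square_integrable (\<lambda>x. c * f x)"
  using assms by (auto simp: square_integrable_def norm_mult power_mult_distrib)

lemma square_integrable_add:
  assumes "square_integrable f" "square_integrable g"
  shows "square_integrable (\<lambda>x. f x + g x)"
proof -
  have [measurable]: "f \<in> borel_measurable lebesgue" "g \<in> borel_measurable lebesgue"
    using assms by (simp_all add: square_integrable_def)
  have "integrable lebesgue (\<lambda>x. (norm (f x + g x))\<^sup>2)"
  proof (rule Bochner_Integration.integrable_bound)
    show "integrable lebesgue (\<lambda>x. 2 * (norm (f x))\<^sup>2 + 2 * (norm (g x))\<^sup>2)"
      using assms by (simp add: square_integrable_def)
    show "(\<lambda>x. (norm (f x + g x))\<^sup>2) \<in> borel_measurable lebesgue"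
      by measurable
    have "(norm (a + b))\<^sup>2 \<le> 2 * (norm a)\<^sup>2 + 2 * (norm b)\<^sup>2" for a b :: complex
    proof -
      have "(norm (a + b))\<^sup>2 \<le> (norm a + norm b)\<^sup>2"
        by (intro power_mono norm_triangle_ineq) auto
      then show ?thesis
        using sum_squares_bound [of "norm a" "norm b"] by (simp add: power2_sum)
    qed
    then show "AE x in lebesgue.
        norm ((norm (f x + g x))\<^sup>2) \<le> norm (2 * (norm (f x))\<^sup>2 + 2 * (norm (g x))\<^sup>2)"
      by auto
  qed
  then show ?thesis
    by (simp add: square_integrable_def)
qed

lemma square_integrable_uminus:
  "square_integrable f \<Longrightarrow> square_integrable (\<lambda>x. - f x)"
  using square_integrable_scale [of f "-1"] by simp

lemma square_integrable_diff:
  "square_integrable f \<Longrightarrow> square_integrable g \<Longrightarrow> square_integrable (\<lambda>x. f x - g x)"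
  using square_integrable_add [of f "\<lambda>x. - g x"] square_integrable_uminus [of g] by simp

definition l2_eq :: "(real \<Rightarrow> complex) \<Rightarrow> (real \<Rightarrow> complex) \<Rightarrow> bool" where
  "l2_eq f g \<longleftrightarrow> square_integrable f \<and> square_integrable g \<and> (AE x in lebesgue. f x = g x)"

quotient_type l2 = "real \<Rightarrow> complex" / partial: l2_eq
  morphisms rep_l2 l2_of
proof (rule part_equivpI)
  show "\<exists>f. l2_eq f f"
    using square_integrable_0 by (auto simp: l2_eq_def)
  show "symp l2_eq"
    by (auto simp: symp_def l2_eq_def eq_commute)
  show "transp l2_eq"
    by (auto simp: transp_def l2_eq_def elim: AE_mp)
qed

lift_definition scaleC :: "complex \<Rightarrow> l2 \<Rightarrow> l2" is "\<lambda>c f x. c * f x"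
  by (auto simp: l2_eq_def square_integrable_scale)

lift_definition cinner :: "l2 \<Rightarrow> l2 \<Rightarrow> complex" is
  "\<lambda>f g. \<integral>x. f x * cnj (g x) \<partial>lebesgue"
proof -
  fix f f' g g' :: "real \<Rightarrow> complex"
  assume "l2_eq f f'" "l2_eq g g'"
  then have A: "square_integrable f" "square_integrable g" "square_integrable f'" "square_integrable g'"
    "AE x in lebesgue. f x = f' x" "AE x in lebesgue. g x = g' x"
    by (auto simp: l2_eq_def)
  show "(\<integral>x. f x * cnj (g x) \<partial>lebesgue) = (\<integral>x. f' x * cnj (g' x) \<partial>lebesgue)"
    by (rule Bochner_Integration.integral_cong_AE)
       (use A square_integrable_mult in \<open>auto simp: borel_measurable_integrable elim: AE_mp\<close>)
qed

instantiation l2 :: real_inner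
begin

lift_definition zero_l2 :: l2 is "\<lambda>x. 0"
  by (auto simp: l2_eq_def square_integrable_0)

lift_definition plus_l2 :: "l2 \<Rightarrow> l2 \<Rightarrow> l2" is "\<lambda>f g x. f x + g x"
  by (auto simp: l2_eq_def square_integrable_add elim: AE_mp)

lift_definition minus_l2 :: "l2 \<Rightarrow> l2 \<Rightarrow> l2" is "\<lambda>f g x. f x - g x"
  by (auto simp: l2_eq_def square_integrable_diff elim: AE_mp)

lift_definition uminus_l2 :: "l2 \<Rightarrow> l2" is "\<lambda>f x. - f x"
  by (auto simp: l2_eq_def square_integrable_uminus)

definition scaleR_l2 :: "real \<Rightarrow> l2 \<Rightarrow> l2" where
  "scaleR_l2 r f = scaleC (of_real r) f"

definition inner_l2 :: "l2 \<Rightarrow> l2 \<Rightarrow> real" where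
  "inner_l2 f g = Re (cinner f g)"

definition norm_l2 :: "l2 \<Rightarrow> real" where
  "norm_l2 f = sqrt (inner f f)"

definition dist_l2 :: "l2 \<Rightarrow> l2 \<Rightarrow> real" where
  "dist_l2 f g = norm (f - g)"

definition sgn_l2 :: "l2 \<Rightarrow> l2" where
  "sgn_l2 f = inverse (norm f) *\<^sub>R f"

definition uniformity_l2 :: "(l2 \<times> l2) filter" where
  "uniformity_l2 = (INF e\<in>{0<..}. principal {(f, g). dist f g < e})"

definition open_l2 :: "l2 set \<Rightarrow> bool" where
  "open_l2 S = (\<forall>f\<in>S. \<forall>\<^sub>F (f', g) in uniformity. f' = f \<longrightarrow> g \<in> S)"

instance
proof
  fix a b c :: l2 and r s :: real
  show "a + b + c = a + (b + c)"
    by transfer (auto simp: l2_eq_def square_integrable_add add.assoc)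
  show "a + b = b + a"
    by transfer (auto simp: l2_eq_def square_integrable_add add.commute)
  show "0 + a = a"
    by transfer (auto simp: l2_eq_def)
  show "- a + a = 0"
    by transfer (auto simp: l2_eq_def square_integrable_0)
  show "a - b = a + - b"
    by transfer (auto simp: l2_eq_def square_integrable_diff)
  show "r *\<^sub>R (a + b) = r *\<^sub>R a + r *\<^sub>R b"
    unfolding scaleR_l2_def
    by transfer (auto simp: l2_eq_def square_integrable_add square_integrable_scale distrib_left)
  show "(r + s) *\<^sub>R a = r *\<^sub>R a + s *\<^sub>R a"
    unfolding scaleR_l2_def
    by transfer (auto simp: l2_eq_def square_integrable_add square_integrable_scale distrib_right)
  show "r *\<^sub>R s *\<^sub>R a = (r * s) *\<^sub>R a"
    unfolding scaleR_l2_def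
    by transfer (auto simp: l2_eq_def square_integrable_scale mult.assoc)
  show "1 *\<^sub>R a = a"
    unfolding scaleR_l2_def by transfer (auto simp: l2_eq_def)
  show "inner a b = inner b a"
    unfolding inner_l2_def
  proof transfer
    fix f g
    assume "l2_eq f f" "l2_eq g g"
    have "(\<integral>x. g x * cnj (f x) \<partial>lebesgue) = (\<integral>x. cnj (f x * cnj (g x)) \<partial>lebesgue)"
      by (simp add: mult.commute)
    also have "\<dots> = cnj (\<integral>x. f x * cnj (g x) \<partial>lebesgue)"
      by (rule Bochner_Integration.integral_cnj)
    finally show "Re (\<integral>x. f x * cnj (g x) \<partial>lebesgue) = Re (\<integral>x. g x * cnj (f x) \<partial>lebesgue)"
      by simp
  qed
  show "inner (a + b) c = inner a c + inner b c"
    unfolding inner_l2_def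
    by transfer (simp add: l2_eq_def distrib_right square_integrable_mult)
  show "inner (r *\<^sub>R a) b = r * inner a b"
    unfolding inner_l2_def scaleR_l2_def
    by transfer (simp add: l2_eq_def mult.assoc)
  have sq: "(\<integral>x. f x * cnj (f x) \<partial>lebesgue) = of_real (\<integral>x. (norm (f x))\<^sup>2 \<partial>lebesgue)" for f
    by (simp only: complex_norm_square flip: integral_complex_of_real)
  show "0 \<le> inner a a"
    unfolding inner_l2_def by transfer (simp add: sq)
  show "inner a a = 0 \<longleftrightarrow> a = 0"
    unfolding inner_l2_def
    by transfer
      (auto simp: sq l2_eq_def square_integrable_0 square_integrable_def integral_nonneg_eq_0_iff_AE)
  show "norm a = sqrt (inner a a)" "dist a b = norm (a - b)" "sgn a = inverse (norm a) *\<^sub>R a"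
    by (simp_all add: norm_l2_def dist_l2_def sgn_l2_def)
  show "uniformity = (INF e\<in>{0<..}. principal {(x, y). dist (x::l2) y < e})"
    by (simp add: uniformity_l2_def)
  show "open U \<longleftrightarrow> (\<forall>x\<in>U. \<forall>\<^sub>F (x', y) in uniformity. x' = x \<longrightarrow> y \<in> U)" for U :: "l2 set"
    by (simp add: open_l2_def)
qed

end

global_interpretation l2: vector_space scaleC
proof
  show "scaleC c (f + g) = scaleC c f + scaleC c g" for c f g
    by transfer (auto simp: l2_eq_def square_integrable_add square_integrable_scale distrib_left)
  show "scaleC (c + d) f = scaleC c f + scaleC d f" for c d f
    by transfer (auto simp: l2_eq_def square_integrable_add square_integrable_scale distrib_right)
  show "scaleC c (scaleC d f) = scaleC (c * d) f" for c d f
    by transfer (auto simp: l2_eq_def square_integrable_scale mult.assoc)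
  show "scaleC 1 f = f" for f
    by transfer (auto simp: l2_eq_def)
qed

definition restrict0 :: "real set \<Rightarrow> (real \<Rightarrow> complex) \<Rightarrow> real \<Rightarrow> complex" where
  "restrict0 I f = (\<lambda>x. if x \<in> I then f x else 0)"

text \<open>For a subset \<open>I\<close> of the line, the space of square integrable functions on \<open>I\<close> is identified
  with the subspace of functions vanishing outside \<open>I\<close>.\<close>

definition L2_on :: "real set \<Rightarrow> l2 set" where
  "L2_on I = {l2_of (restrict0 I f) | f. square_integrable (restrict0 I f)}"


section \<open>Operators\<close>

text \<open>Unbounded operators are represented by their graphs. The adjoint is taken in the closed
  subspace \<open>H\<close>.\<close>

definition adjoint_in :: "l2 set \<Rightarrow> (l2 \<times> l2) set \<Rightarrow> (l2 \<times> l2) set" where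
  "adjoint_in H S = {(g, h). g \<in> H \<and> h \<in> H \<and> (\<forall>(f, k) \<in> S. cinner k g = cinner f h)}"

definition selfadjoint :: "(l2 \<times> l2) set \<Rightarrow> bool" where
  "selfadjoint T \<longleftrightarrow> single_valued T \<and> closure (Domain T) = UNIV \<and> adjoint_in UNIV T = T"

text \<open>The dimension of the kernel of \<open>S\<^sup>* - z\<close>; the deficiency indices are the values at
  \<open>z = \<i>\<close> and \<open>z = -\<i>\<close>. By the convention of \<open>l2.dim\<close>, an infinite dimension is reported as \<open>0\<close>.\<close>

definition deficiency_index :: "l2 set \<Rightarrow> (l2 \<times> l2) set \<Rightarrow> complex \<Rightarrow> nat" where
  "deficiency_index H S z = l2.dim {g. (g, scaleC z g) \<in> adjoint_in H S}"

definition similar :: "(l2 \<times> l2) set \<Rightarrow> (l2 \<times> l2) set \<Rightarrow> bool" where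
  "similar T1 T2 \<longleftrightarrow>
     (\<exists>V. Vector_Spaces.linear scaleC scaleC V \<and> bij V \<and>
          bounded_linear V \<and> bounded_linear (inv V) \<and>
          T2 = {(V f, V g) | f g. (f, g) \<in> T1})"


section \<open>Sturm-Liouville operators\<close>

text \<open>\<open>f\<close> is locally absolutely continuous on the interval \<open>I\<close>, with derivative \<open>g\<close> almost
  everywhere; absolute continuity is expressed as being an indefinite Lebesgue integral.\<close>

definition ac_deriv :: "real set \<Rightarrow> (real \<Rightarrow> complex) \<Rightarrow> (real \<Rightarrow> complex) \<Rightarrow> bool" where
  "ac_deriv I f g \<longleftrightarrow>
     (\<forall>a\<in>I. \<forall>b\<in>I. a \<le> b \<longrightarrow>
        g absolutely_integrable_on {a..b} \<and> (g has_integral (f b - f a)) {a..b})"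

text \<open>\<open>h = -y'' + q y\<close> on \<open>I\<close>, with \<open>y\<close> and \<open>y'\<close> locally absolutely continuous. Since \<open>y''\<close> is only
  determined almost everywhere, so is \<open>h\<close>.\<close>

definition sl_expr :: "(real \<Rightarrow> real) \<Rightarrow> real set \<Rightarrow> (real \<Rightarrow> complex) \<Rightarrow> (real \<Rightarrow> complex) \<Rightarrow> bool" where
  "sl_expr q I y h \<longleftrightarrow>
     (\<exists>y1 y2. ac_deriv I y y1 \<and> ac_deriv I y1 y2 \<and>
        (\<forall>x\<in>I. h x = - y2 x + of_real (q x) * y x))"

definition sl_max :: "(real \<Rightarrow> real) \<Rightarrow> real set \<Rightarrow> (l2 \<times> l2) set" where
  "sl_max q I = {(l2_of (restrict0 I y), l2_of (restrict0 I h)) | y h.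
     sl_expr q I y h \<and> square_integrable (restrict0 I y) \<and> square_integrable (restrict0 I h)}"

text \<open>The closure of the operator restricted to functions of compact support in the open
  interval \<open>I\<close>.\<close>

definition sl_min :: "(real \<Rightarrow> real) \<Rightarrow> real set \<Rightarrow> (l2 \<times> l2) set" where
  "sl_min q I = closure {(l2_of (restrict0 I y), l2_of (restrict0 I h)) | y h.
     sl_expr q I y h \<and> square_integrable (restrict0 I y) \<and> square_integrable (restrict0 I h) \<and>
     (\<exists>K. compact K \<and> K \<subseteq> I \<and> (\<forall>x\<in>I - K. y x = 0))}"

lift_definition sgn_mult :: "l2 \<Rightarrow> l2" is "\<lambda>f x. of_real (sgn x) * f x"
proof -
  fix f g :: "real \<Rightarrow> complex"
  have "square_integrable (\<lambda>x. of_real (sgn x) * f x)" if f: "square_integrable f" for f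
  proof -
    have [measurable]: "f \<in> borel_measurable lebesgue"
      using f by (simp add: square_integrable_def)
    have "sgn \<in> borel_measurable (borel :: real measure)"
      by simp
    then have [measurable]: "sgn \<in> borel_measurable (lebesgue :: real measure)"
      by (intro measurable_completion) simp
    have m: "(\<lambda>x. complex_of_real (sgn x) * f x) \<in> borel_measurable lebesgue"
      by measurable
    have "integrable lebesgue (\<lambda>x. (norm (of_real (sgn x) * f x))\<^sup>2)"
    proof (rule Bochner_Integration.integrable_bound)
      show "integrable lebesgue (\<lambda>x. (norm (f x))\<^sup>2)"
        using f by (simp add: square_integrable_def)
      show "(\<lambda>x. (norm (of_real (sgn x) * f x))\<^sup>2) \<in> borel_measurable lebesgue"
        using m by measurable
      show "AE x in lebesgue. norm ((norm (of_real (sgn x) * f x))\<^sup>2) \<le> norm ((norm (f x))\<^sup>2)"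
        by (auto simp: norm_mult sgn_if)
    qed
    with m show ?thesis
      by (simp add: square_integrable_def)
  qed
  then show "l2_eq f g \<Longrightarrow> l2_eq (\<lambda>x. of_real (sgn x) * f x) (\<lambda>x. of_real (sgn x) * g x)"
    by (auto simp: l2_eq_def)
qed

text \<open>The operator \<open>L\<close> on the whole line carries its maximal domain; when both half-line minimal
  operators have deficiency indices \<open>(1,1)\<close> this is the only selfadjoint realization.\<close>

definition sl_L :: "(real \<Rightarrow> real) \<Rightarrow> (l2 \<times> l2) set" where
  "sl_L q = sl_max q UNIV"

definition sl_A :: "(real \<Rightarrow> real) \<Rightarrow> (l2 \<times> l2) set" where
  "sl_A q = {(f, sgn_mult g) | f g. (f, g) \<in> sl_L q}"


section \<open>Weyl functions\<close>

text \<open>The solution of \<open>-y'' + q y = z y\<close> with \<open>y(0) = a\<close> and \<open>y'(0) = b\<close>.\<close>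

definition sl_sol :: "(real \<Rightarrow> real) \<Rightarrow> complex \<Rightarrow> complex \<Rightarrow> complex \<Rightarrow> real \<Rightarrow> complex" where
  "sl_sol q z a b = (THE y. \<exists>y'. y 0 = a \<and> y' 0 = b \<and>
     (\<forall>x. (y has_vector_derivative y' x) (at x) \<and>
          (y' has_vector_derivative (of_real (q x) - z) * y x) (at x)))"

definition sl_s :: "(real \<Rightarrow> real) \<Rightarrow> real \<Rightarrow> complex \<Rightarrow> complex" where
  "sl_s q x z = sl_sol q z 0 1 x"

definition sl_c :: "(real \<Rightarrow> real) \<Rightarrow> real \<Rightarrow> complex \<Rightarrow> complex" where
  "sl_c q x z = sl_sol q z 1 0 x"

definition m_plus :: "(real \<Rightarrow> real) \<Rightarrow> complex \<Rightarrow> complex" where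
  "m_plus q z = (THE m. square_integrable (restrict0 {0<..} (\<lambda>x. sl_s q x z - m * sl_c q x z)))"

definition m_minus :: "(real \<Rightarrow> real) \<Rightarrow> complex \<Rightarrow> complex" where
  "m_minus q z = (THE m. square_integrable (restrict0 {..<0} (\<lambda>x. sl_s q x z + m * sl_c q x z)))"

definition M_plus :: "(real \<Rightarrow> real) \<Rightarrow> complex \<Rightarrow> complex" where
  "M_plus q z = m_plus q z"

definition M_minus :: "(real \<Rightarrow> real) \<Rightarrow> complex \<Rightarrow> complex" where
  "M_minus q z = - m_minus q (- z)"

text \<open>The value \<open>M(t + \<i>0)\<close>, meaningful at those \<open>t\<close> where the limit exists.\<close>

definition boundary_value :: "(complex \<Rightarrow> complex) \<Rightarrow> real \<Rightarrow> complex" where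
  "boundary_value M t = Lim (at_right 0) (\<lambda>\<epsilon>::real. M (Complex t \<epsilon>))"

definition Linfty :: "(real \<Rightarrow> complex) set" where
  "Linfty = {f. f \<in> borel_measurable lebesgue \<and> (\<exists>C. AE t in lebesgue. norm (f t) \<le> C)}"

end

theory Submission
  imports Defs "HOL-Complex_Analysis.Complex_Analysis"
begin

text \<open>
  For nonreal \<open>z\<close> let \<open>u\<close> and \<open>v\<close> be the square integrable solutions of \<open>A y = z y\<close> on the right and
  on the left half-line with \<open>u'(0) = v'(0) = 1\<close>; then \<open>u(0) = - M\<^sub>+(z)\<close> and \<open>v(0) = - M\<^sub>-(z)\<close>. If
  \<open>A\<close> is similar to a selfadjoint operator, then \<open>\<bar>Im z\<bar> \<parallel>f\<parallel> \<le> K \<parallel>(A - z) f\<parallel>\<close> for all \<open>f\<close> in its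
  domain (\<open>similar_selfadjoint_resolvent_bound\<close>), and a single test function turns this into the
  desired estimate. The function \<open>u - cnj u\<close> has derivative \<open>0\<close> and value \<open>cnj M\<^sub>+ - M\<^sub>+\<close> at the
  origin. With \<open>\<kappa> = (M\<^sub>+ - M\<^sub>-) / (cnj M\<^sub>+ - M\<^sub>+)\<close>, the function \<open>f\<close> that equals
  \<open>u + \<kappa> (u - cnj u)\<close> on the right and \<open>v\<close> on the left is therefore continuously differentiable and
  lies in the domain of \<open>A\<close> (\<open>glued_solution_in_sl_A\<close>). Since \<open>cnj u\<close> solves \<open>A y = cnj z y\<close>, one has
  \<open>(A - z) f = \<kappa> (z - cnj z) cnj u\<close> on the right and \<open>0\<close> on the left, whereas
  \<open>\<parallel>f\<parallel> \<ge> (1 - 2 \<bar>\<kappa>\<bar>) \<parallel>u\<parallel>\<close>. Hence \<open>1 \<le> 2 (K + 1) \<bar>\<kappa>\<bar>\<close>, that is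
  \<open>\<bar>Im M\<^sub>+(z)\<bar> \<le> (K + 1) \<bar>M\<^sub>+(z) - M\<^sub>-(z)\<bar>\<close>; exchanging the half-lines gives the same bound for \<open>M\<^sub>-\<close>
  (\<open>weyl_ratio_bounds\<close>).

  It remains to let \<open>z\<close> tend to the real axis. Where a limit fails to exist, \<open>boundary_value\<close> is an
  unspecified number, so the almost everywhere existence of finite limits is indispensable. It is
  Fatou's theorem for Herglotz functions (\<open>herglotz_boundary_limit_AE\<close>), which is proved by way
  of a Lipschitz continuous primitive of a bounded holomorphic function. At points where the two limits
  coincide, the quotient in question is \<open>0\<close> by the convention \<open>x / 0 = 0\<close>.

  That \<open>M\<^sub>+\<close> and \<open>M\<^sub>-\<close> are Herglotz functions follows from the identity
  \<open>M(\<zeta>) - cnj (M(z)) = (\<zeta> - cnj z) \<langle>\<psi>\<^sub>\<zeta>, \<psi>\<^sub>z\<rangle>\<close> for the Weyl solutions (\<open>m_plus_kernel\<close>), the limit of the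
  corresponding identity for Dirichlet problems on \<open>[0, n]\<close>. It holds in the limit point case, and
  this case is what the deficiency indices provide: if all solutions at \<open>z = \<i>\<close> were square integrable, the kernel
  of \<open>S\<^sup>* - \<i>\<close>, with \<open>S\<close> the minimal operator on the half-line, would contain two linearly independent elements
  (\<open>deficiency_one_not_both\<close>).
\<close>

section \<open>Solutions of the Sturm-Liouville equation\<close>

text \<open>The derivative is carried along as a second function, so that initial data and Wronskians can be
  written without a differentiation operator.\<close>

definition sl_solves :: "(real \<Rightarrow> real) \<Rightarrow> complex \<Rightarrow> (real \<Rightarrow> complex) \<Rightarrow> (real \<Rightarrow> complex) \<Rightarrow> bool" where
  "sl_solves q z y y' \<longleftrightarrow> (\<forall>x. (y has_vector_derivative y' x) (at x) \<and>
          (y' has_vector_derivative (of_real (q x) - z) * y x) (at x))"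

lemma continuous_has_antiderivative:
  fixes f :: "real \<Rightarrow> 'a::banach"
  assumes "continuous_on UNIV f"
  obtains F where "F 0 = 0" "\<And>x. (F has_vector_derivative f x) (at x)"
proof -
  define F where "F x = (if 0 \<le> x then integral {0..x} f else - integral {x..0} f)" for x
  have int: "f integrable_on {a..b}" for a b
    by (rule integrable_continuous_real[OF continuous_on_subset[OF assms]]) auto
  have shift: "F x = integral {a..x} f - integral {a..0} f" if "a \<le> 0" "a \<le> x" for a x
  proof (cases "0 \<le> x")
    case True
    then have "integral {a..0} f + integral {0..x} f = integral {a..x} f"
      by (intro Henstock_Kurzweil_Integration.integral_combine) (use that int in auto)
    then show ?thesis using True by (simp add: F_def algebra_simps)
  next
    case False
    then have "integral {a..x} f + integral {x..0} f = integral {a..0} f"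
      by (intro Henstock_Kurzweil_Integration.integral_combine) (use that int in auto)
    then show ?thesis using False by (simp add: F_def algebra_simps)
  qed
  have "(F has_vector_derivative f x) (at x)" for x
  proof -
    define a where "a = - \<bar>x\<bar> - 1"
    define b where "b = \<bar>x\<bar> + 1"
    have ab: "a < x" "x < b" "a \<le> 0" by (auto simp: a_def b_def)
    have "((\<lambda>u. integral {a..u} f) has_vector_derivative f x) (at x within {a..b})"
      by (rule integral_has_vector_derivative[OF continuous_on_subset[OF assms]]) (use ab in auto)
    then have "((\<lambda>u. integral {a..u} f) has_vector_derivative f x) (at x)"
      using ab by (simp add: at_within_Icc_at)
    then have "((\<lambda>u. integral {a..u} f - integral {a..0} f) has_vector_derivative f x) (at x)"
      by (auto intro!: derivative_eq_intros)
    then show ?thesis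
      by (rule has_vector_derivative_transform_within_open[where S = "{a<..}"]) (use ab shift in auto)
  qed
  moreover have "F 0 = 0" by (simp add: F_def)
  ultimately show ?thesis by (rule that[rotated])
qed

text \<open>The function \<open>E exp (- K)\<close> is nonincreasing.\<close>

lemma gronwall:
  fixes E k K :: "real \<Rightarrow> real"
  assumes "a \<le> b"
    and E: "\<And>x. a \<le> x \<Longrightarrow> x \<le> b \<Longrightarrow> (E has_real_derivative E' x) (at x)"
    and K: "\<And>x. a \<le> x \<Longrightarrow> x \<le> b \<Longrightarrow> (K has_real_derivative k x) (at x)"
    and le: "\<And>x. a \<le> x \<Longrightarrow> x \<le> b \<Longrightarrow> E' x \<le> k x * E x"
  shows "E b \<le> E a * exp (K b - K a)"
proof -
  have "E b * exp (- K b) \<le> E a * exp (- K a)"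
  proof (rule DERIV_nonpos_imp_nonincreasing[OF assms(1)])
    fix x assume x: "a \<le> x" "x \<le> b"
    have "((\<lambda>x. E x * exp (- K x)) has_real_derivative (E' x - k x * E x) * exp (- K x)) (at x)"
      by (auto intro!: derivative_eq_intros E K x simp: algebra_simps)
    moreover have "(E' x - k x * E x) * exp (- K x) \<le> 0"
      using le[OF x] by (intro mult_nonpos_nonneg) auto
    ultimately show "\<exists>y. ((\<lambda>x. E x * exp (- K x)) has_real_derivative y) (at x) \<and> y \<le> 0" by blast
  qed
  then show ?thesis by (simp add: exp_minus exp_diff field_simps)
qed

lemma norm_square_derivative:
  fixes f :: "real \<Rightarrow> complex"
  assumes "(f has_vector_derivative f') (at x)"
  shows "((\<lambda>x. (cmod (f x))\<^sup>2) has_real_derivative 2 * Re (cnj (f x) * f')) (at x)"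
proof -
  have "((\<lambda>x. Re (f x)) has_real_derivative Re f') (at x)"
    "((\<lambda>x. Im (f x)) has_real_derivative Im f') (at x)"
    using bounded_linear.has_vector_derivative[OF bounded_linear_Re assms]
      bounded_linear.has_vector_derivative[OF bounded_linear_Im assms]
    unfolding has_real_derivative_iff_has_vector_derivative by blast+
  moreover have "((\<lambda>x. (r x)\<^sup>2 + (i x)\<^sup>2) has_real_derivative 2 * (r x * r' + i x * i')) (at x)"
    if "(r has_real_derivative r') (at x)" "(i has_real_derivative i') (at x)" for r i :: "real \<Rightarrow> real" and r' i'
    using that by (auto intro!: derivative_eq_intros simp: algebra_simps)
  ultimately show ?thesis
    unfolding cmod_power2 by force
qed

text \<open>The energy \<open>\<bar>y\<bar>\<^sup>2 + \<bar>y'\<bar>\<^sup>2\<close> has a derivative of modulus at most \<open>1 + \<bar>q - z\<bar>\<close> times the energy. By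
  Gronwall's inequality, applied forwards and, after reflection, backwards from \<open>0\<close>, it vanishes
  identically.\<close>

lemma sl_solves_zero:
  assumes q: "continuous_on UNIV q" and s: "sl_solves q z y y'" and 0: "y 0 = 0" "y' 0 = 0"
  shows "y x = 0" "y' x = 0"
proof -
  define k where "k x = 1 + cmod (of_real (q x) - z)" for x
  define E where "E x = (cmod (y x))\<^sup>2 + (cmod (y' x))\<^sup>2" for x
  define E' where "E' x = 2 * Re (cnj (y x) * y' x) + 2 * Re (cnj (y' x) * ((of_real (q x) - z) * y x))" for x
  have "continuous_on UNIV k" unfolding k_def by (intro continuous_intros q)
  then obtain K where K: "\<And>x. (K has_real_derivative k x) (at x)"
    using continuous_has_antiderivative[of k] unfolding has_real_derivative_iff_has_vector_derivative by blast
  have E: "(E has_real_derivative E' x) (at x)" for x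
    unfolding E_def E'_def
    by (intro DERIV_add norm_square_derivative) (use s in \<open>auto simp: sl_solves_def\<close>)
  have le: "\<bar>E' x\<bar> \<le> k x * E x" for x
  proof -
    let ?a = "cmod (y x)" and ?b = "cmod (y' x)" and ?c = "cmod (of_real (q x) - z)"
    have "\<bar>E' x\<bar> \<le> 2 * \<bar>Re (cnj (y x) * y' x)\<bar> + 2 * \<bar>Re (cnj (y' x) * ((of_real (q x) - z) * y x))\<bar>"
      unfolding E'_def by linarith
    also have "\<dots> \<le> 2 * (?a * ?b) + 2 * (?b * (?c * ?a))"
      using abs_Re_le_cmod[of "cnj (y x) * y' x"] abs_Re_le_cmod[of "cnj (y' x) * ((of_real (q x) - z) * y x)"]
      by (simp add: norm_mult)
    also have "\<dots> = k x * (2 * ?a * ?b)" by (simp add: k_def algebra_simps)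
    also have "\<dots> \<le> k x * E x"
      unfolding E_def using sum_squares_bound[of ?a ?b] by (intro mult_left_mono) (auto simp: k_def)
    finally show ?thesis .
  qed
  have "E x \<le> 0"
  proof (cases "0 \<le> x")
    case True
    have "E x \<le> E 0 * exp (K x - K 0)"
      by (rule gronwall[OF True E K]) (use le in \<open>auto simp: abs_le_iff\<close>)
    then show ?thesis by (simp add: E_def 0)
  next
    case False
    have d: "((\<lambda>x. f (- x)) has_real_derivative - g (- x)) (at x)"
      if "\<And>x. (f has_real_derivative g x) (at x)" for f g :: "real \<Rightarrow> real" and x
      using DERIV_mirror[of f "g (- x)" x] that[of "- x"] by simp
    have d': "((\<lambda>x. - K (- x)) has_real_derivative k (- x)) (at x)" for x
      using DERIV_minus[OF d[OF K], of x] by simp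
    have "E (- (- x)) \<le> E (- 0) * exp (- K (- (- x)) - - K (- 0))"
      by (rule gronwall[OF _ d[OF E] d']) (use False le in \<open>auto simp: abs_le_iff\<close>)
    then show ?thesis by (simp add: E_def 0)
  qed
  then show "y x = 0" "y' x = 0"
    using sum_power2_le_zero_iff[of "cmod (y x)" "cmod (y' x)"] by (auto simp: E_def)
qed

lemma norm_increment_le:
  fixes f :: "real \<Rightarrow> 'a::real_normed_vector"
  assumes f: "\<And>x. (f has_vector_derivative f' x) (at x)"
    and g: "\<And>x. (g has_real_derivative g' x) (at x)"
    and le: "\<And>x. norm (f' x) \<le> g' x"
  shows "norm (f x - f y) \<le> \<bar>g x - g y\<bar>"
proof -
  have *: "norm (f b - f a) \<le> g b - g a" if "a < b" for a b
  proof (rule differentiable_bound_general[OF that _ _ f])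
    show "continuous_on {a..b} f" "continuous_on {a..b} g"
      using f g by (auto intro!: continuous_at_imp_continuous_on has_vector_derivative_continuous DERIV_isCont)
    show "\<And>x. (g has_vector_derivative g' x) (at x)"
      using g by (simp add: has_real_derivative_iff_has_vector_derivative)
  qed (use le in auto)
  show ?thesis
    using *[of x y] *[of y x] by (cases x y rule: linorder_cases) (auto simp: norm_minus_commute)
qed

text \<open>Picard iteration on the whole line at once. If \<open>\<phi>' = k\<close> and \<open>\<phi>(0) = 0\<close>, then the weight
  \<open>w = cosh (2 \<phi>)\<close> satisfies \<open>\<bar>\<integral>\<^sub>0\<^sup>x k w\<bar> = \<bar>sinh (2 \<phi>(x))\<bar> / 2 \<le> w(x) / 2\<close>. The integral operator is
  therefore a contraction with factor \<open>1/2\<close> on the continuous functions bounded by a multiple of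
  \<open>w\<close>, which are written as \<open>w u\<close> with \<open>u\<close> bounded. Unlike \<open>exp (2 \<bar>\<phi>\<bar>)\<close>, this weight is differentiable at
  the origin.\<close>

lemma linear_system_exists:
  fixes A :: "real \<Rightarrow> 'a::banach \<Rightarrow> 'a"
  assumes k: "continuous_on UNIV k" "\<And>x. 0 < k x"
    and A: "\<And>u. continuous_on UNIV u \<Longrightarrow> continuous_on UNIV (\<lambda>x. A x (u x))"
    and lip: "\<And>x u v. norm (A x u - A x v) \<le> k x * norm (u - v)"
    and A0: "\<And>x. A x 0 = 0"
  obtains Y where "Y 0 = Y0" "\<And>x. (Y has_vector_derivative A x (Y x)) (at x)"
proof -
  obtain \<phi> where \<phi>: "\<phi> 0 = 0" "\<And>x. (\<phi> has_real_derivative k x) (at x)"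
    using continuous_has_antiderivative[OF k(1)] unfolding has_real_derivative_iff_has_vector_derivative by blast
  define w where "w x = cosh (2 * \<phi> x)" for x
  have w1: "1 \<le> w x" for x by (simp add: w_def cosh_real_ge_1)
  then have w0: "0 < w x" for x by (metis less_le_trans zero_less_one)
  have S: "((\<lambda>x. sinh (2 * \<phi> x) / 2) has_real_derivative k x * w x) (at x)" for x
    by (auto intro!: derivative_eq_intros \<phi> simp: w_def)
  have Sle: "\<bar>sinh (2 * \<phi> x) / 2\<bar> \<le> w x / 2" for x
  proof -
    have "\<bar>sinh t\<bar> \<le> cosh t" for t :: real
      by (auto simp: sinh_field_def cosh_field_def abs_le_iff divide_right_mono)
    then show ?thesis by (simp add: w_def)
  qed
  have "isCont \<phi> x" for x using \<phi>(2) by (rule DERIV_isCont)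
  then have wc: "continuous_on UNIV w"
    unfolding w_def by (auto intro!: continuous_intros simp: continuous_on_eq_continuous_at)
  define F where "F u = (SOME F. F 0 = 0 \<and> (\<forall>x. (F has_vector_derivative A x (w x *\<^sub>R apply_bcontfun u x)) (at x)))" for u :: "real \<Rightarrow>\<^sub>C 'a"
  have F: "F u 0 = 0" "(F u has_vector_derivative A x (w x *\<^sub>R apply_bcontfun u x)) (at x)" for u x
  proof -
    have "continuous_on UNIV (\<lambda>x. A x (w x *\<^sub>R apply_bcontfun u x))"
      by (intro A continuous_intros wc) auto
    then have "\<exists>F. F 0 = 0 \<and> (\<forall>x. (F has_vector_derivative A x (w x *\<^sub>R apply_bcontfun u x)) (at x))"
      by (rule continuous_has_antiderivative) blast
    from someI_ex[OF this] show "F u 0 = 0" "(F u has_vector_derivative A x (w x *\<^sub>R apply_bcontfun u x)) (at x)"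
      unfolding F_def by auto
  qed
  have Fc: "continuous_on UNIV (F u)" for u
    using F(2) by (auto simp: continuous_on_eq_continuous_at intro: has_vector_derivative_continuous)
  have Fdiff: "norm (F u x - F v x) \<le> dist u v * (w x / 2)" for u v x
  proof -
    have "norm ((F u x - F v x) - (F u 0 - F v 0)) \<le> \<bar>dist u v * (sinh (2 * \<phi> x) / 2) - dist u v * (sinh (2 * \<phi> 0) / 2)\<bar>"
    proof (rule norm_increment_le)
      fix x
      show "((\<lambda>x. F u x - F v x) has_vector_derivative A x (w x *\<^sub>R apply_bcontfun u x) - A x (w x *\<^sub>R apply_bcontfun v x)) (at x)"
        by (intro has_vector_derivative_diff F)
      show "((\<lambda>x. dist u v * (sinh (2 * \<phi> x) / 2)) has_real_derivative dist u v * (k x * w x)) (at x)"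
        by (intro DERIV_cmult S)
      have "norm (A x (w x *\<^sub>R apply_bcontfun u x) - A x (w x *\<^sub>R apply_bcontfun v x))
          \<le> k x * (w x * dist (apply_bcontfun u x) (apply_bcontfun v x))"
        using lip[of x "w x *\<^sub>R apply_bcontfun u x" "w x *\<^sub>R apply_bcontfun v x"] w0[of x]
        by (simp add: dist_norm flip: scaleR_diff_right)
      also have "\<dots> \<le> k x * (w x * dist u v)"
        using k(2)[of x] w0[of x] by (intro mult_left_mono dist_bounded) auto
      finally show "norm (A x (w x *\<^sub>R apply_bcontfun u x) - A x (w x *\<^sub>R apply_bcontfun v x)) \<le> dist u v * (k x * w x)"
        by (simp add: mult_ac)
    qed
    also have "\<dots> \<le> dist u v * (w x / 2)"
      using Sle[of x] by (auto simp: \<phi> abs_mult intro!: mult_left_mono)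
    finally show ?thesis by (simp add: F)
  qed
  have F0: "F 0 x = 0" for x
    using norm_increment_le[of "F 0" "\<lambda>_. 0" "\<lambda>_. 0" "\<lambda>_. 0" x 0] F[of 0] by (simp add: A0)
  \<comment> \<open>The Picard operator, conjugated by multiplication with the weight.\<close>
  define T where "T u x = (1 / w x) *\<^sub>R (Y0 + F u x)" for u x
  have T: "T u \<in> bcontfun" for u
  proof (rule bcontfun_normI)
    show "continuous_on UNIV (T u)"
      unfolding T_def using w0 by (intro continuous_intros wc Fc ballI) (simp add: less_imp_neq[symmetric])
    fix x
    have "norm (Y0 + F u x) \<le> norm Y0 + dist u 0 * (w x / 2)"
      using Fdiff[of u x 0] norm_triangle_ineq[of Y0 "F u x"] by (simp add: F0)
    also have "\<dots> \<le> norm Y0 * w x + dist u 0 * w x"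
      using w1[of x] by (intro add_mono mult_left_mono) (auto simp: mult_le_cancel_left1 not_less)
    finally have "norm (Y0 + F u x) / w x \<le> norm Y0 + dist u 0"
      using w0[of x] by (simp add: divide_le_eq algebra_simps)
    then show "norm (T u x) \<le> norm Y0 + dist u 0" using w0[of x] by (simp add: T_def)
  qed
  have "\<exists>!u. Bcontfun (T u) = u"
  proof (rule banach_fix_type)
    show "\<forall>u v. dist (Bcontfun (T u)) (Bcontfun (T v)) \<le> 1/2 * dist u v"
    proof (intro allI dist_bound)
      fix u v x
      have "T u x - T v x = (1 / w x) *\<^sub>R (F u x - F v x)" by (simp add: T_def algebra_simps)
      then have "dist (T u x) (T v x) \<le> 1/2 * dist u v"
        using Fdiff[of u x v] w0[of x] by (simp add: dist_norm[of "T u x"] divide_le_eq mult_ac)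
      then show "dist (apply_bcontfun (Bcontfun (T u)) x) (apply_bcontfun (Bcontfun (T v)) x) \<le> 1/2 * dist u v"
        by (simp add: Bcontfun_inverse T)
    qed
  qed auto
  then obtain u where u: "Bcontfun (T u) = u" by blast
  have ue: "w x *\<^sub>R apply_bcontfun u x = Y0 + F u x" for x
  proof -
    have "apply_bcontfun u x = T u x" using u by (metis Bcontfun_inverse T)
    then show ?thesis using w0[of x] by (simp add: T_def)
  qed
  show ?thesis
  proof
    show "Y0 + F u 0 = Y0" by (simp add: F)
    show "((\<lambda>x. Y0 + F u x) has_vector_derivative A x (Y0 + F u x)) (at x)" for x
      using F(2)[of u x] unfolding ue by (auto intro!: derivative_eq_intros)
  qed
qed

lemma sl_solves_exists:
  assumes q: "continuous_on UNIV q"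
  obtains y y' where "y 0 = a" "y' 0 = b" "sl_solves q z y y'"
proof -
  define k where "k x = 1 + cmod (of_real (q x) - z)" for x
  define A where "A x u = (snd u, (of_real (q x) - z) * fst u)" for x and u :: "complex \<times> complex"
  obtain Y where Y: "Y 0 = (a, b)" "\<And>x. (Y has_vector_derivative A x (Y x)) (at x)"
  proof (rule linear_system_exists[where A = A and k = k])
    show "continuous_on UNIV k" unfolding k_def by (intro continuous_intros q)
    show "0 < k x" for x by (simp add: k_def add_pos_nonneg)
    show "continuous_on UNIV (\<lambda>x. A x (u x))" if "continuous_on UNIV u" for u
      unfolding A_def by (intro continuous_intros q that)
    show "A x 0 = 0" for x by (simp add: A_def zero_prod_def)
    show "norm (A x u - A x v) \<le> k x * norm (u - v)" for x u v
    proof -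
      have "norm (A x u - A x v) = norm (snd (u - v), (of_real (q x) - z) * fst (u - v))"
        by (simp add: A_def algebra_simps)
      also have "\<dots> \<le> norm (snd (u - v)) + norm ((of_real (q x) - z) * fst (u - v))"
        by (rule norm_Pair_le)
      also have "\<dots> \<le> norm (u - v) + cmod (of_real (q x) - z) * norm (u - v)"
        unfolding norm_mult 
          using norm_fst_le[of "fst (u - v)" "snd (u - v)"] norm_snd_le[of "snd (u - v)" "fst (u - v)"]
          by (intro add_mono mult_left_mono) (auto simp del: fst_diff snd_diff)
      finally show ?thesis by (simp add: k_def algebra_simps)
    qed
  qed blast
  show ?thesis
  proof
    show "fst (Y 0) = a" "snd (Y 0) = b" using Y(1) by auto
    show "sl_solves q z (\<lambda>x. fst (Y x)) (\<lambda>x. snd (Y x))"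
      unfolding sl_solves_def
    proof (intro allI conjI)
      fix x
      show "((\<lambda>x. fst (Y x)) has_vector_derivative snd (Y x)) (at x)"
        using bounded_linear.has_vector_derivative[OF bounded_linear_fst Y(2)[of x]] by (simp add: A_def)
      show "((\<lambda>x. snd (Y x)) has_vector_derivative (of_real (q x) - z) * fst (Y x)) (at x)"
        using bounded_linear.has_vector_derivative[OF bounded_linear_snd Y(2)[of x]] by (simp add: A_def)
    qed
  qed
qed

section \<open>The Hilbert space and Nevanlinna kernels\<close>

lemma l2_of_eq_iff:
  "square_integrable f \<Longrightarrow> square_integrable g \<Longrightarrow> l2_of f = l2_of g \<longleftrightarrow> (AE x in lebesgue. f x = g x)"
  using Quotient_rel[OF Quotient_l2, of f g] by (auto simp: l2_eq_def)

lemma l2_of_add: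
  "square_integrable f \<Longrightarrow> square_integrable g \<Longrightarrow> l2_of f + l2_of g = l2_of (\<lambda>x. f x + g x)"
  by (rule plus_l2.abs_eq) (auto simp: eq_onp_def l2_eq_def)

lemma l2_of_diff:
  "square_integrable f \<Longrightarrow> square_integrable g \<Longrightarrow> l2_of f - l2_of g = l2_of (\<lambda>x. f x - g x)"
  by (rule minus_l2.abs_eq) (auto simp: eq_onp_def l2_eq_def)

lemma l2_of_scaleC: "square_integrable f \<Longrightarrow> scaleC c (l2_of f) = l2_of (\<lambda>x. c * f x)"
  by (rule scaleC.abs_eq) (auto simp: eq_onp_def l2_eq_def)

lemma l2_of_sgn_mult: "square_integrable f \<Longrightarrow> sgn_mult (l2_of f) = l2_of (\<lambda>x. of_real (sgn x) * f x)"
  by (rule sgn_mult.abs_eq) (auto simp: eq_onp_def l2_eq_def)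

lemma cinner_l2_of:
  "square_integrable f \<Longrightarrow> square_integrable g \<Longrightarrow>
    cinner (l2_of f) (l2_of g) = (\<integral>x. f x * cnj (g x) \<partial>lebesgue)"
  by (rule cinner.abs_eq) (auto simp: eq_onp_def l2_eq_def)

lemma norm_l2_of_square:
  assumes "square_integrable f"
  shows "(norm (l2_of f))\<^sup>2 = (\<integral>x. (cmod (f x))\<^sup>2 \<partial>lebesgue)"
proof -
  have "(norm (l2_of f))\<^sup>2 = inner (l2_of f) (l2_of f)" by (simp add: power2_norm_eq_inner)
  also have "\<dots> = Re (\<integral>x. f x * cnj (f x) \<partial>lebesgue)"
    by (simp add: inner_l2_def cinner_l2_of assms)
  also have "(\<integral>x. f x * cnj (f x) \<partial>lebesgue) = of_real (\<integral>x. (cmod (f x))\<^sup>2 \<partial>lebesgue)"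
    by (simp only: complex_norm_square flip: integral_complex_of_real)
  finally show ?thesis by simp
qed

lemma cinner_commute: "cinner g f = cnj (cinner f g)"
proof transfer
  fix f g :: "real \<Rightarrow> complex"
  have "(\<integral>x. g x * cnj (f x) \<partial>lebesgue) = (\<integral>x. cnj (f x * cnj (g x)) \<partial>lebesgue)"
    by (simp add: mult.commute)
  also have "\<dots> = cnj (\<integral>x. f x * cnj (g x) \<partial>lebesgue)"
    by (rule Bochner_Integration.integral_cnj)
  finally show "(\<integral>x. g x * cnj (f x) \<partial>lebesgue) = cnj (\<integral>x. f x * cnj (g x) \<partial>lebesgue)" .
qed

lemma cinner_add_left: "cinner (f + g) h = cinner f h + cinner g h"
  by transfer (simp add: l2_eq_def distrib_right square_integrable_mult)

lemma cinner_scaleC_left: "cinner (scaleC c f) g = c * cinner f g"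
  by transfer (simp add: mult.assoc)

lemma cinner_scaleC_right: "cinner f (scaleC c g) = cnj c * cinner f g"
  by (metis cinner_commute cinner_scaleC_left complex_cnj_cnj complex_cnj_mult)

lemma cinner_add_right: "cinner h (f + g) = cinner h f + cinner h g"
  by (metis cinner_commute cinner_add_left complex_cnj_add)

lemma scaleR_conv_scaleC: "r *\<^sub>R f = scaleC (of_real r) (f :: l2)"
  by (simp add: scaleR_l2_def)

lemma cinner_diff_left: "cinner (f - g) h = cinner f h - cinner g h"
  using cinner_add_left[of "f - g" g h] by simp

lemma cinner_self: "cinner f f = of_real ((norm f)\<^sup>2)"
proof (rule complex_eqI)
  show "Re (cinner f f) = Re (of_real ((norm f)\<^sup>2))"
    by (simp add: power2_norm_eq_inner inner_l2_def)
  show "Im (cinner f f) = Im (of_real ((norm f)\<^sup>2))"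
    using arg_cong[OF cinner_commute[of f f], of Im] by simp
qed

lemma norm_scaleC: "norm (scaleC c f) = cmod c * norm f"
proof -
  have "complex_of_real ((norm (scaleC c f))\<^sup>2) = of_real ((cmod c * norm f)\<^sup>2)"
    unfolding cinner_self[symmetric] cinner_scaleC_left cinner_scaleC_right
    unfolding cinner_self power_mult_distrib of_real_mult complex_norm_square by (simp add: mult_ac)
  then show ?thesis
    unfolding of_real_eq_iff by (rule power2_eq_imp_eq) auto
qed

text \<open>The real Cauchy-Schwarz inequality, after rotating \<open>f\<close> so that the inner product becomes
  nonnegative.\<close>

lemma cmod_cinner_le: "cmod (cinner f g) \<le> norm f * norm g"
proof (cases "cinner f g = 0")
  case False
  define c where "c = cnj (cinner f g) / cmod (cinner f g)"
  have "c * cinner f g = cmod (cinner f g)"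
    using False by (simp add: c_def complex_norm_square[symmetric] power2_eq_square mult.commute)
  then have "inner (scaleC c f) g = cmod (cinner f g)"
    by (simp add: inner_l2_def cinner_scaleC_left)
  moreover have "cmod c = 1" using False by (simp add: c_def norm_divide)
  ultimately show ?thesis
    using norm_cauchy_schwarz[of "scaleC c f" g] by (simp add: norm_scaleC)
qed simp

lemma bounded_bilinear_cinner: "bounded_bilinear cinner"
proof
  show "\<exists>K. \<forall>a b. norm (cinner a b) \<le> norm a * norm b * K"
    using cmod_cinner_le by (intro exI[of _ 1]) simp
qed (auto simp: cinner_add_left cinner_add_right cinner_scaleC_left cinner_scaleC_right
       scaleR_conv_scaleC scaleR_conv_of_real)

lemma norm_diff_square:
  "(norm (f - g))\<^sup>2 = (norm f)\<^sup>2 + (norm g)\<^sup>2 - 2 * Re (cinner f g)"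
  by (simp add: power2_norm_eq_inner inner_diff_left inner_diff_right inner_commute inner_l2_def[of f g])

text \<open>Choosing \<open>\<zeta> = cnj z\<close> shows \<open>M (cnj z) = cnj (M z)\<close>, so that the difference quotient of \<open>M\<close> is
  \<open>\<langle>\<Psi> \<zeta>, \<Psi> (cnj z)\<rangle>\<close>. The formula for \<open>Im M\<close> bounds \<open>\<parallel>\<Psi>\<parallel>\<close> locally, which makes \<open>M\<close> continuous;
  expanding \<open>\<parallel>\<Psi> \<zeta> - \<Psi> z\<parallel>\<^sup>2\<close> by means of the kernel then shows that \<open>\<Psi>\<close> is continuous, and with it the
  difference quotient has a limit.\<close>

lemma nevanlinna_kernel:
  fixes M :: "complex \<Rightarrow> complex" and \<Psi> :: "complex \<Rightarrow> l2"
  assumes ker: "\<And>z \<zeta>. Im z \<noteq> 0 \<Longrightarrow> Im \<zeta> \<noteq> 0 \<Longrightarrow>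
    M \<zeta> - cnj (M z) = (\<zeta> - cnj z) * cinner (\<Psi> \<zeta>) (\<Psi> z)"
  shows nevanlinna_kernel_Im: "\<And>z. Im z \<noteq> 0 \<Longrightarrow> Im (M z) = Im z * (norm (\<Psi> z))\<^sup>2"
    and nevanlinna_kernel_holomorphic: "M holomorphic_on {z. Im z \<noteq> 0}"
proof -
  show im: "Im (M z) = Im z * (norm (\<Psi> z))\<^sup>2" if "Im z \<noteq> 0" for z
    using arg_cong[OF ker[OF that that], of Im] by (simp add: cinner_self)
  have diff: "M \<zeta> - M z = (\<zeta> - z) * cinner (\<Psi> \<zeta>) (\<Psi> (cnj z))" if "Im z \<noteq> 0" "Im \<zeta> \<noteq> 0" for z \<zeta>
  proof -
    have "M (cnj z) = cnj (M z)" using ker[of z "cnj z"] that by simp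
    then show ?thesis using ker[of "cnj z" \<zeta>] that by simp
  qed
  have op: "open {z. Im z \<noteq> 0}"
    by (simp add: open_Collect_neq continuous_on_Im continuous_on_id)
  have "M field_differentiable at z" if z: "Im z \<noteq> 0" for z
  proof -
    have ev: "\<forall>\<^sub>F \<zeta> in at z. Im \<zeta> \<noteq> 0"
      using eventually_at_in_open'[OF op, of z] z by (auto elim: eventually_mono)
    have nzc: "z \<noteq> cnj z" using z by (auto simp: complex_eq_iff)
    have tIm: "((\<lambda>\<zeta>. \<bar>Im \<zeta>\<bar>) \<longlongrightarrow> \<bar>Im z\<bar>) (at z)" by (intro tendsto_intros)
    have tid: "((\<lambda>\<zeta>. cmod (\<zeta> - z)) \<longlongrightarrow> 0) (at z)" by (auto intro!: tendsto_eq_intros)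
    \<comment> \<open>With \<open>p = \<parallel>\<Psi> \<zeta>\<parallel> \<ge> 1\<close>, the kernel gives \<open>\<bar>Im \<zeta>\<bar> p\<^sup>2 \<le> \<bar>M z\<bar> + \<bar>\<zeta> - z\<bar> p \<parallel>\<Psi> (cnj z)\<parallel> \<le> B p\<close>.\<close>
    define B where "B = cmod (M z) + norm (\<Psi> (cnj z)) + 1"
    have bound: "norm (\<Psi> \<zeta>) \<le> 1 + 2 * B / \<bar>Im z\<bar>"
      if \<zeta>: "\<bar>Im \<zeta>\<bar> > \<bar>Im z\<bar> / 2" "cmod (\<zeta> - z) < 1" for \<zeta>
    proof (cases "norm (\<Psi> \<zeta>) \<le> 1")
      case False
      let ?p = "norm (\<Psi> \<zeta>)"
      have nz: "Im \<zeta> \<noteq> 0" using \<zeta> z by auto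
      have "\<bar>Im \<zeta>\<bar> * ?p\<^sup>2 = \<bar>Im (M \<zeta>)\<bar>" by (simp add: im[OF nz] abs_mult)
      also have "\<dots> \<le> cmod (M z + (M \<zeta> - M z))" using abs_Im_le_cmod[of "M \<zeta>"] by simp
      also have "\<dots> \<le> cmod (M z) + cmod (\<zeta> - z) * (?p * norm (\<Psi> (cnj z)))"
        unfolding diff[OF z nz]
        by (intro norm_triangle_mono order_refl) (simp add: norm_mult mult_left_mono cmod_cinner_le)
      also have "\<dots> \<le> cmod (M z) * ?p + 1 * (?p * norm (\<Psi> (cnj z)))"
        using \<zeta>(2) False by (intro add_mono mult_right_mono) (auto simp: mult_le_cancel_left1)
      also have "\<dots> \<le> B * ?p" by (simp add: B_def algebra_simps)
      finally have "(\<bar>Im \<zeta>\<bar> * ?p) * ?p \<le> B * ?p"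
        by (simp add: power2_eq_square mult.assoc)
      then have "\<bar>Im \<zeta>\<bar> * ?p \<le> B"
        by (rule mult_right_le_imp_le) (use False in linarith)
      moreover have "\<bar>Im z\<bar> / 2 * ?p \<le> \<bar>Im \<zeta>\<bar> * ?p" using \<zeta> by (intro mult_right_mono) auto
      ultimately have "?p \<le> 2 * B / \<bar>Im z\<bar>" using z by (simp add: field_simps)
      then show ?thesis by simp
    next
      case True
      have "0 \<le> 2 * B / \<bar>Im z\<bar>" by (simp add: B_def)
      then show ?thesis using True by linarith
    qed
    have evb: "\<forall>\<^sub>F \<zeta> in at z. norm (\<Psi> \<zeta>) \<le> 1 + 2 * B / \<bar>Im z\<bar>"
    proof -
      have "\<forall>\<^sub>F \<zeta> in at z. \<bar>Im z\<bar> / 2 < \<bar>Im \<zeta>\<bar>" by (rule order_tendstoD(1)[OF tIm]) (use z in simp)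
      moreover have "\<forall>\<^sub>F \<zeta> in at z. cmod (\<zeta> - z) < 1" by (rule order_tendstoD(2)[OF tid]) simp
      ultimately show ?thesis by eventually_elim (use bound in auto)
    qed
    have cont: "(M \<longlongrightarrow> M z) (at z)"
    proof (rule Lim_null[THEN iffD2], rule Lim_null_comparison)
      show "\<forall>\<^sub>F \<zeta> in at z. norm (M \<zeta> - M z) \<le> cmod (\<zeta> - z) * ((1 + 2 * B / \<bar>Im z\<bar>) * norm (\<Psi> (cnj z)))"
        using ev evb
      proof eventually_elim
        case (elim \<zeta>)
        have "cmod (cinner (\<Psi> \<zeta>) (\<Psi> (cnj z))) \<le> (1 + 2 * B / \<bar>Im z\<bar>) * norm (\<Psi> (cnj z))"
          using elim by (intro order_trans[OF cmod_cinner_le] mult_right_mono) auto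
        then show ?case using elim z by (simp add: diff norm_mult mult_left_mono)
      qed
      show "((\<lambda>\<zeta>. cmod (\<zeta> - z) * ((1 + 2 * B / \<bar>Im z\<bar>) * norm (\<Psi> (cnj z)))) \<longlongrightarrow> 0) (at z)"
        by (rule tendsto_mult_left_zero[OF tid])
    qed
    have "((\<lambda>\<zeta>. (norm (\<Psi> \<zeta> - \<Psi> z))\<^sup>2) \<longlongrightarrow> 0) (at z)"
    proof -
      let ?h = "\<lambda>\<zeta>. Im (M \<zeta>) / Im \<zeta> + (norm (\<Psi> z))\<^sup>2 - 2 * Re ((M \<zeta> - cnj (M z)) / (\<zeta> - cnj z))"
      have "(?h \<longlongrightarrow> Im (M z) / Im z + (norm (\<Psi> z))\<^sup>2 - 2 * Re ((M z - cnj (M z)) / (z - cnj z))) (at z)"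
        using z by (intro tendsto_intros cont) (auto simp: complex_eq_iff)
      also have "Im (M z) / Im z + (norm (\<Psi> z))\<^sup>2 - 2 * Re ((M z - cnj (M z)) / (z - cnj z)) = 0"
      proof -
        have "(M z - cnj (M z)) / (z - cnj z) = of_real ((norm (\<Psi> z))\<^sup>2)"
          using nzc ker[OF z z] by (simp add: cinner_self)
        then show ?thesis using z by (simp add: im)
      qed
      finally show ?thesis
      proof (rule Lim_transform_eventually)
        show "\<forall>\<^sub>F \<zeta> in at z. ?h \<zeta> = (norm (\<Psi> \<zeta> - \<Psi> z))\<^sup>2"
          using ev tendsto_imp_eventually_ne[OF tendsto_ident_at, of z "cnj z" UNIV, OF nzc]
        proof eventually_elim
          case (elim \<zeta>)
          then show ?case using z ker[OF z, of \<zeta>] by (simp add: norm_diff_square im)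
        qed
      qed
    qed
    from tendsto_real_sqrt[OF this] have "((\<lambda>\<zeta>. norm (\<Psi> \<zeta> - \<Psi> z)) \<longlongrightarrow> 0) (at z)"
      by simp
    then have "(\<Psi> \<longlongrightarrow> \<Psi> z) (at z)"
      by (subst Lim_null) (rule tendsto_norm_zero_cancel)
    then have "((\<lambda>\<zeta>. cinner (\<Psi> \<zeta>) (\<Psi> (cnj z))) \<longlongrightarrow> cinner (\<Psi> z) (\<Psi> (cnj z))) (at z)"
      by (intro bounded_bilinear.tendsto[OF bounded_bilinear_cinner] tendsto_const)
    moreover have "\<forall>\<^sub>F \<zeta> in at z. cinner (\<Psi> \<zeta>) (\<Psi> (cnj z)) = (M \<zeta> - M z) / (\<zeta> - z)"
      using ev eventually_neq_at_within[of z z UNIV]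
    proof eventually_elim
      case (elim \<zeta>)
      then show ?case using diff[OF z elim(1)] by simp
    qed
    ultimately have "((\<lambda>\<zeta>. (M \<zeta> - M z) / (\<zeta> - z)) \<longlongrightarrow> cinner (\<Psi> z) (\<Psi> (cnj z))) (at z)"
      by (rule Lim_transform_eventually)
    then show ?thesis
      unfolding field_differentiable_def has_field_derivative_iff by blast
  qed
  then show "M holomorphic_on {z. Im z \<noteq> 0}"
    by (auto simp: holomorphic_on_def intro: field_differentiable_at_within)
qed

section \<open>Weyl discs and Weyl solutions\<close>

lemma sl_solvesD:
  assumes "sl_solves q z u u'"
  shows "(u has_vector_derivative u' x) (at x)"
    and "(u' has_vector_derivative (of_real (q x) - z) * u x) (at x)"
  using assms unfolding sl_solves_def by blast+

lemma sl_solves_lincomb: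
  assumes u: "sl_solves q z u u'" and v: "sl_solves q z v v'"
  shows "sl_solves q z (\<lambda>x. a * u x + b * v x) (\<lambda>x. a * u' x + b * v' x)"
  unfolding sl_solves_def
proof (intro allI conjI)
  fix x
  show "((\<lambda>x. a * u x + b * v x) has_vector_derivative a * u' x + b * v' x) (at x)"
    by (intro has_vector_derivative_add has_vector_derivative_mult_right sl_solvesD[OF u] sl_solvesD[OF v])
  have "((\<lambda>x. a * u' x + b * v' x) has_vector_derivative
      a * ((of_real (q x) - z) * u x) + b * ((of_real (q x) - z) * v x)) (at x)"
    by (intro has_vector_derivative_add has_vector_derivative_mult_right sl_solvesD[OF u] sl_solvesD[OF v])
  then show "((\<lambda>x. a * u' x + b * v' x) has_vector_derivative
      (of_real (q x) - z) * (a * u x + b * v x)) (at x)"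
    by (simp only: distrib_left mult.left_commute)
qed

lemma sl_solves_wronskian_derivative:
  assumes u: "sl_solves q z u u'" and v: "sl_solves q \<zeta> v v'"
  shows "((\<lambda>x. u' x * v x - u x * v' x) has_vector_derivative (\<zeta> - z) * (u x * v x)) (at x)"
proof -
  have "((\<lambda>x. u' x * v x - u x * v' x) has_vector_derivative
      (u' x * v' x + (of_real (q x) - z) * u x * v x) - (u x * ((of_real (q x) - \<zeta>) * v x) + u' x * v' x)) (at x)"
    by (intro has_vector_derivative_diff has_vector_derivative_mult sl_solvesD[OF u] sl_solvesD[OF v])
  moreover have "(u' x * v' x + (of_real (q x) - z) * u x * v x) - (u x * ((of_real (q x) - \<zeta>) * v x) + u' x * v' x)
      = (\<zeta> - z) * (u x * v x)"
    by (simp add: algebra_simps)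
  ultimately show ?thesis by simp
qed

lemma sl_solves_cnj:
  assumes "sl_solves q z u u'"
  shows "sl_solves q (cnj z) (\<lambda>x. cnj (u x)) (\<lambda>x. cnj (u' x))"
  unfolding sl_solves_def
proof (intro allI conjI)
  fix x
  note u = sl_solvesD[OF assms, of x]
  show "((\<lambda>x. cnj (u x)) has_vector_derivative cnj (u' x)) (at x)"
    by (rule has_vector_derivative_cnj[OF u(1)])
  show "((\<lambda>x. cnj (u' x)) has_vector_derivative (of_real (q x) - cnj z) * cnj (u x)) (at x)"
    using has_vector_derivative_cnj[OF u(2)] by simp
qed

lemma sl_solves_continuous:
  assumes "sl_solves q z u u'"
  shows "continuous_on UNIV u" "continuous_on UNIV u'" "continuous_on A u" "continuous_on A u'"
proof -
  show "continuous_on UNIV u" "continuous_on UNIV u'"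
    using sl_solvesD[OF assms]
    by (auto simp: continuous_on_eq_continuous_at intro: has_vector_derivative_continuous)
  then show "continuous_on A u" "continuous_on A u'" by (auto intro: continuous_on_subset)
qed

definition sl_sol' :: "(real \<Rightarrow> real) \<Rightarrow> complex \<Rightarrow> complex \<Rightarrow> complex \<Rightarrow> real \<Rightarrow> complex" where
  "sl_sol' q z a b x = vector_derivative (sl_sol q z a b) (at x)"

lemma sl_solves_unique:
  assumes q: "continuous_on UNIV q" and "sl_solves q z u u'" "sl_solves q z v v'"
    and "u 0 = v 0" "u' 0 = v' 0"
  shows "u = v" "u' = v'"
proof -
  have "sl_solves q z (\<lambda>x. 1 * u x + (-1) * v x) (\<lambda>x. 1 * u' x + (-1) * v' x)"
    by (rule sl_solves_lincomb) fact+
  from sl_solves_zero[OF q this] assms(4,5) have "u x - v x = 0" "u' x - v' x = 0" for x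
    by simp_all
  then show "u = v" "u' = v'" by (simp_all add: fun_eq_iff)
qed

lemma sl_sol:
  assumes q: "continuous_on UNIV q"
  shows "sl_solves q z (sl_sol q z a b) (sl_sol' q z a b)"
    and "sl_sol q z a b 0 = a" "sl_sol' q z a b 0 = b"
proof -
  obtain y y' where y: "y 0 = a" "y' 0 = b" "sl_solves q z y y'"
    using sl_solves_exists[OF q, of a b z] by metis
  have e: "sl_sol q z a b = y"
    unfolding sl_sol_def sl_solves_def[symmetric]
  proof (rule the_equality)
    show "\<exists>y'. y 0 = a \<and> y' 0 = b \<and> sl_solves q z y y'" using y by blast
    show "v = y" if "\<exists>v'. v 0 = a \<and> v' 0 = b \<and> sl_solves q z v v'" for v
      using that sl_solves_unique(1)[OF q _ y(3)] y(1,2) by metis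
  qed
  moreover have "sl_sol' q z a b = y'"
    unfolding sl_sol'_def e fun_eq_iff using vector_derivative_at[OF sl_solvesD(1)[OF y(3)]] by simp
  ultimately show "sl_solves q z (sl_sol q z a b) (sl_sol' q z a b)"
    "sl_sol q z a b 0 = a" "sl_sol' q z a b 0 = b" using y by auto
qed

lemma sl_sol_unique:
  assumes q: "continuous_on UNIV q" and "sl_solves q z u u'"
  shows "u = sl_sol q z (u 0) (u' 0)" "u' = sl_sol' q z (u 0) (u' 0)"
  by (rule sl_solves_unique[OF q assms(2) sl_sol(1)[OF q, of z "u 0" "u' 0"]]; simp add: sl_sol(2,3)[OF q])+

lemma lagrange_identity:
  assumes u: "sl_solves q z u u'" and v: "sl_solves q \<zeta> v v'" and "a \<le> b"
  shows "((\<lambda>x. (\<zeta> - z) * (u x * v x)) has_integral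
    ((u' b * v b - u b * v' b) - (u' a * v a - u a * v' a))) {a..b}"
proof (rule fundamental_theorem_of_calculus[OF assms(3)])
  fix x
  show "((\<lambda>x. u' x * v x - u x * v' x) has_vector_derivative (\<zeta> - z) * (u x * v x)) (at x within {a..b})"
    by (rule has_vector_derivative_at_within[OF sl_solves_wronskian_derivative[OF u v]])
qed

lemma wronskian_constant:
  assumes u: "sl_solves q z u u'" and v: "sl_solves q z v v'"
  shows "u' x * v x - u x * v' x = u' 0 * v 0 - u 0 * v' 0"
proof -
  have "u' b * v b - u b * v' b = u' a * v a - u a * v' a" if "a \<le> b" for a b
  proof -
    have "((\<lambda>x. 0) has_integral ((u' b * v b - u b * v' b) - (u' a * v a - u a * v' a))) {a..b}"
      using lagrange_identity[OF u v that] by simp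
    from has_integral_unique[OF this has_integral_0] show ?thesis by simp
  qed
  from this[of 0 x] this[of x 0] show ?thesis by (cases "0 \<le> x") auto
qed

lemma sl_solves_zero_on_open:
  assumes "sl_solves q z u u'" "open S" "x \<in> S" "\<And>y. y \<in> S \<Longrightarrow> u y = 0"
  shows "u x = 0" "u' x = 0"
proof -
  show "u x = 0" using assms by simp
  have "(u has_vector_derivative 0) (at x)"
    by (rule has_vector_derivative_transform_within_open[of "\<lambda>_. 0" 0 x S]) (use assms in auto)
  with sl_solvesD(1)[OF assms(1), of x] show "u' x = 0"
    by (rule vector_derivative_unique_at)
qed

definition sqnorm :: "(real \<Rightarrow> complex) \<Rightarrow> real \<Rightarrow> real" where
  "sqnorm u b = integral {0..b} (\<lambda>x. (cmod (u x))\<^sup>2)"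

lemma sqnorm_has_integral:
  "continuous_on UNIV u \<Longrightarrow> ((\<lambda>x. (cmod (u x))\<^sup>2) has_integral sqnorm u b) {0..b}"
  unfolding sqnorm_def
  by (intro integrable_integral integrable_continuous_real continuous_intros) (auto intro: continuous_on_subset)

lemma sqnorm_nonneg: "continuous_on UNIV u \<Longrightarrow> 0 \<le> sqnorm u b"
  using has_integral_nonneg[OF sqnorm_has_integral] by auto

lemma sqnorm_mono: "continuous_on UNIV u \<Longrightarrow> a \<le> b \<Longrightarrow> sqnorm u a \<le> sqnorm u b"
  by (rule has_integral_subset_le[OF _ sqnorm_has_integral sqnorm_has_integral]) auto

lemma sqnorm_scale: "sqnorm (\<lambda>x. a * u x) b = (cmod a)\<^sup>2 * sqnorm u b"
  unfolding sqnorm_def norm_mult power_mult_distrib by simp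

lemma sqnorm_pos:
  assumes "continuous_on UNIV u" "x \<in> {0..b}" "u x \<noteq> 0" "0 < b"
  shows "0 < sqnorm u b"
proof (rule ccontr)
  assume "\<not> 0 < sqnorm u b"
  then have "sqnorm u b = 0" using sqnorm_nonneg[OF assms(1), of b] by simp
  then have "(cmod (u x))\<^sup>2 = 0"
    by (intro has_integral_0_cbox_imp_0[of 0 b "\<lambda>x. (cmod (u x))\<^sup>2"])
       (use sqnorm_has_integral[OF assms(1), of b] assms in \<open>auto intro!: continuous_intros intro: continuous_on_subset\<close>)
  then show False using assms(3) by simp
qed

lemma Im_mult_sqnorm:
  assumes u: "sl_solves q z u u'" and "0 \<le> b"
  shows "Im z * sqnorm u b = Im (u' 0 * cnj (u 0)) - Im (u' b * cnj (u b))"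
proof -
  have *: "((\<lambda>x. - (Im z * (cmod (u x))\<^sup>2)) has_integral (Im (u' b * cnj (u b)) - Im (u' 0 * cnj (u 0)))) {0..b}"
  proof (rule fundamental_theorem_of_calculus[OF assms(2)])
    fix x
    have "((\<lambda>x. u' x * cnj (u x)) has_vector_derivative
        u' x * cnj (u' x) + (of_real (q x) - z) * u x * cnj (u x)) (at x)"
      by (intro has_vector_derivative_mult has_vector_derivative_cnj sl_solvesD[OF u])
    then have "((\<lambda>x. Im (u' x * cnj (u x))) has_vector_derivative
        Im (u' x * cnj (u' x) + (of_real (q x) - z) * u x * cnj (u x))) (at x)"
      by (rule bounded_linear.has_vector_derivative[OF bounded_linear_Im])
    moreover have "Im (u' x * cnj (u' x) + (of_real (q x) - z) * u x * cnj (u x)) = - (Im z * (cmod (u x))\<^sup>2)"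
      unfolding mult.assoc complex_norm_square[symmetric] by simp
    ultimately show "((\<lambda>x. Im (u' x * cnj (u x))) has_vector_derivative - (Im z * (cmod (u x))\<^sup>2)) (at x within {0..b})"
      by (simp add: has_vector_derivative_at_within)
  qed
  have "((\<lambda>x. - (Im z * (cmod (u x))\<^sup>2)) has_integral (- (Im z * sqnorm u b))) {0..b}"
    by (intro has_integral_neg has_integral_mult_right sqnorm_has_integral sl_solves_continuous[OF u])
  from has_integral_unique[OF * this] show ?thesis by simp
qed

definition weyl_sol :: "(real \<Rightarrow> real) \<Rightarrow> complex \<Rightarrow> complex \<Rightarrow> real \<Rightarrow> complex" where
  "weyl_sol q z m = sl_sol q z (- m) 1"

lemma weyl_sol_eq:
  assumes q: "continuous_on UNIV q"
  shows "weyl_sol q z m = (\<lambda>x. sl_s q x z - m * sl_c q x z)"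
    and "sl_sol' q z (- m) 1 = (\<lambda>x. sl_sol' q z 0 1 x - m * sl_sol' q z 1 0 x)"
proof -
  have s: "sl_solves q z (\<lambda>x. sl_sol q z 0 1 x - m * sl_sol q z 1 0 x)
      (\<lambda>x. sl_sol' q z 0 1 x - m * sl_sol' q z 1 0 x)"
    using sl_solves_lincomb[OF sl_sol(1)[OF q, of z 0 1] sl_sol(1)[OF q, of z 1 0], of 1 "- m"] by simp
  show "weyl_sol q z m = (\<lambda>x. sl_s q x z - m * sl_c q x z)"
    unfolding weyl_sol_def sl_s_def sl_c_def
    by (rule sl_solves_unique(1)[OF q sl_sol(1)[OF q] s]) (simp_all add: sl_sol(2,3)[OF q])
  show "sl_sol' q z (- m) 1 = (\<lambda>x. sl_sol' q z 0 1 x - m * sl_sol' q z 1 0 x)"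
    by (rule sl_solves_unique(2)[OF q sl_sol(1)[OF q] s]) (simp_all add: sl_sol(2,3)[OF q])
qed

text \<open>The parameter for which \<open>s - m c\<close> vanishes at \<open>b\<close>, a point on the Weyl circle of the interval \<open>[0, b]\<close>.\<close>

definition dirichlet_m :: "(real \<Rightarrow> real) \<Rightarrow> complex \<Rightarrow> real \<Rightarrow> complex" where
  "dirichlet_m q z b = sl_s q b z / sl_c q b z"

context
  fixes q :: "real \<Rightarrow> real" and z :: complex
  assumes q: "continuous_on UNIV q" and z: "Im z \<noteq> 0"
begin

lemma sl_c_continuous: "continuous_on UNIV (\<lambda>x. sl_c q x z)"
  unfolding sl_c_def by (rule sl_solves_continuous[OF sl_sol(1)[OF q]])

lemma weyl_sol_continuous: "continuous_on UNIV (weyl_sol q z m)"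
  unfolding weyl_sol_def by (rule sl_solves_continuous[OF sl_sol(1)[OF q]])

lemma sqnorm_c_pos: "0 < b \<Longrightarrow> 0 < sqnorm (\<lambda>x. sl_c q x z) b"
  by (rule sqnorm_pos[OF sl_c_continuous, of 0]) (simp_all add: sl_c_def sl_sol(2)[OF q])

lemma sqnorm_c: "0 \<le> b \<Longrightarrow> Im z * sqnorm (\<lambda>x. sl_c q x z) b = - Im (sl_sol' q z 1 0 b * cnj (sl_c q b z))"
  using Im_mult_sqnorm[OF sl_sol(1)[OF q, of z 1 0]] by (simp add: sl_sol(2,3)[OF q] sl_c_def)

lemma sl_c_nonzero: "0 < b \<Longrightarrow> sl_c q b z \<noteq> 0"
  using sqnorm_c[of b] sqnorm_c_pos[of b] z by auto

text \<open>The boundary term at \<open>b\<close> in Lagrange's identity for \<open>\<psi> = s - m c\<close> and its conjugate is a quadratic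
  function of the difference \<open>d\<close> to the point \<open>m\<^sub>b\<close> of the Weyl circle: one has \<open>\<psi>(b) = - d c(b)\<close>
  and, as the Wronskian of \<open>s\<close> and \<open>c\<close> is constant, \<open>\<psi>'(b) = 1 / c(b) - d c'(b)\<close>.\<close>

lemma sqnorm_weyl_sol:
  assumes b: "0 < b" and d: "d = m - dirichlet_m q z b"
  shows "Im z * sqnorm (weyl_sol q z m) b - Im m =
    (cmod d)\<^sup>2 * (Im z * sqnorm (\<lambda>x. sl_c q x z) b) + Im (cnj d * (cnj (sl_c q b z) / sl_c q b z))"
proof -
  let ?s = "sl_s q b z" and ?c = "sl_c q b z" and ?s' = "sl_sol' q z 0 1 b" and ?c' = "sl_sol' q z 1 0 b"
  have nz: "?c \<noteq> 0" by (rule sl_c_nonzero[OF b])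
  have W: "?s' * ?c - ?s * ?c' = 1"
    using wronskian_constant[OF sl_sol(1)[OF q, of z 0 1] sl_sol(1)[OF q, of z 1 0], of b]
    by (simp add: sl_sol(2,3)[OF q] sl_s_def sl_c_def)
  have \<psi>: "weyl_sol q z m b = - d * ?c"
    using nz by (simp add: weyl_sol_eq[OF q] d dirichlet_m_def field_simps)
  have \<psi>': "sl_sol' q z (- m) 1 b = 1 / ?c - d * ?c'"
  proof -
    have "?s' = (1 + ?s * ?c') / ?c" using W nz by (simp add: field_simps)
    then show ?thesis using nz by (simp add: weyl_sol_eq[OF q] d dirichlet_m_def field_simps)
  qed
  have "Im z * sqnorm (weyl_sol q z m) b - Im m = - Im (sl_sol' q z (- m) 1 b * cnj (weyl_sol q z m b))"
    using Im_mult_sqnorm[OF sl_sol(1)[OF q, of z "- m" 1], of b] b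
    by (simp add: sl_sol(2,3)[OF q] weyl_sol_def)
  also have "\<dots> = - Im ((1 / ?c - d * ?c') * cnj (- d * ?c))"
    unfolding \<psi> \<psi>' ..
  also have "(1 / ?c - d * ?c') * cnj (- d * ?c) = of_real ((cmod d)\<^sup>2) * (?c' * cnj ?c) - cnj d * (cnj ?c / ?c)"
    unfolding complex_norm_square by (simp add: algebra_simps)
  also have "- Im \<dots> = (cmod d)\<^sup>2 * (- Im (?c' * cnj ?c)) + Im (cnj d * (cnj ?c / ?c))"
    by (simp add: algebra_simps)
  finally show ?thesis unfolding sqnorm_c[OF less_imp_le[OF b]] .
qed

lemma sqnorm_weyl_sol_dirichlet: "0 < b \<Longrightarrow> sqnorm (weyl_sol q z (dirichlet_m q z b)) b = Im (dirichlet_m q z b) / Im z"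
  using sqnorm_weyl_sol[of b 0 "dirichlet_m q z b"] z by (simp add: field_simps)

text \<open>By \<open>sqnorm_weyl_sol\<close>, membership in the Weyl disc makes a quadratic expression in \<open>d = m - m\<^sub>b\<close>
  nonpositive, in which the linear term has modulus at most \<open>\<bar>d\<bar>\<close>.\<close>

lemma weyl_disc_radius:
  assumes b: "0 < b" and m: "sqnorm (weyl_sol q z m) b \<le> Im m / Im z"
  shows "cmod (m - dirichlet_m q z b) * (\<bar>Im z\<bar> * sqnorm (\<lambda>x. sl_c q x z) b) \<le> 1"
proof -
  let ?d = "m - dirichlet_m q z b" and ?h = "sqnorm (\<lambda>x. sl_c q x z) b"
  let ?e = "Im (cnj ?d * (cnj (sl_c q b z) / sl_c q b z))"
  have "\<bar>?e\<bar> \<le> cmod (cnj ?d * (cnj (sl_c q b z) / sl_c q b z))"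
    by (rule abs_Im_le_cmod)
  also have "\<dots> = cmod ?d"
    using sl_c_nonzero[OF b] by (simp only: norm_mult norm_divide complex_mod_cnj) simp
  finally have "\<bar>?e\<bar> \<le> cmod ?d" .
  moreover have "(cmod ?d)\<^sup>2 * ?h * \<bar>Im z\<bar> \<le> \<bar>?e\<bar>"
  proof -
    have eq: "Im z * (sqnorm (weyl_sol q z m) b - Im m / Im z) = Im z * ((cmod ?d)\<^sup>2 * ?h) + ?e"
      using sqnorm_weyl_sol[OF b refl, of m] z by (simp add: algebra_simps)
    show ?thesis
    proof (cases "0 < Im z")
      case True
      then have "Im z * (sqnorm (weyl_sol q z m) b - Im m / Im z) \<le> 0"
        using m by (simp add: mult_le_0_iff)
      then have "Im z * ((cmod ?d)\<^sup>2 * ?h) \<le> - ?e" using eq by simp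
      then show ?thesis using True by (simp add: mult_ac)
    next
      case False
      then have "0 \<le> Im z * (sqnorm (weyl_sol q z m) b - Im m / Im z)"
        using m z by (simp add: zero_le_mult_iff)
      then have "- Im z * ((cmod ?d)\<^sup>2 * ?h) \<le> ?e" using eq by simp
      then show ?thesis using False by (simp add: mult_ac)
    qed
  qed
  ultimately have "cmod ?d * (cmod ?d * (\<bar>Im z\<bar> * ?h)) \<le> cmod ?d * 1"
    by (simp add: power2_eq_square mult_ac)
  then show ?thesis
    by (cases "?d = 0") (auto dest: mult_left_le_imp_le)
qed

lemma sqnorm_weyl_sol_tendsto:
  assumes "(\<mu> \<longlongrightarrow> m) F"
  shows "((\<lambda>n. sqnorm (weyl_sol q z (\<mu> n)) b) \<longlongrightarrow> sqnorm (weyl_sol q z m) b) F"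
proof -
  let ?s = "\<lambda>x. sl_s q x z" and ?c = "\<lambda>x. sl_c q x z"
  have c: "continuous_on {0..b} ?s" "continuous_on {0..b} ?c"
    unfolding sl_s_def sl_c_def by (rule sl_solves_continuous[OF sl_sol(1)[OF q]])+
  have "sqnorm (weyl_sol q z \<mu>) b = sqnorm ?s b + (cmod \<mu>)\<^sup>2 * sqnorm ?c b
      - (2 * Re \<mu> * integral {0..b} (\<lambda>x. Re (?c x * cnj (?s x)))
      - 2 * Im \<mu> * integral {0..b} (\<lambda>x. Im (?c x * cnj (?s x))))" for \<mu>
  proof -
    have i: "(\<lambda>x. (cmod (?s x))\<^sup>2) integrable_on {0..b}" "(\<lambda>x. (cmod (?c x))\<^sup>2) integrable_on {0..b}"
      "(\<lambda>x. Re (?c x * cnj (?s x))) integrable_on {0..b}" "(\<lambda>x. Im (?c x * cnj (?s x))) integrable_on {0..b}"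
      by (intro integrable_continuous_real continuous_intros c)+
    have "(cmod (weyl_sol q z \<mu> x))\<^sup>2 = ((cmod (?s x))\<^sup>2 + (cmod \<mu>)\<^sup>2 * (cmod (?c x))\<^sup>2)
      - (2 * Re \<mu> * Re (?c x * cnj (?s x)) - 2 * Im \<mu> * Im (?c x * cnj (?s x)))" for x
      unfolding weyl_sol_eq[OF q] cmod_power2 by (simp add: power2_eq_square algebra_simps)
    moreover have "((\<lambda>x. ((cmod (?s x))\<^sup>2 + (cmod \<mu>)\<^sup>2 * (cmod (?c x))\<^sup>2)
        - (2 * Re \<mu> * Re (?c x * cnj (?s x)) - 2 * Im \<mu> * Im (?c x * cnj (?s x)))) has_integral
      (sqnorm ?s b + (cmod \<mu>)\<^sup>2 * sqnorm ?c b
      - (2 * Re \<mu> * integral {0..b} (\<lambda>x. Re (?c x * cnj (?s x)))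
      - 2 * Im \<mu> * integral {0..b} (\<lambda>x. Im (?c x * cnj (?s x)))))) {0..b}"
      unfolding sqnorm_def
      by (intro has_integral_diff has_integral_add has_integral_mult_right integrable_integral i)
    ultimately show ?thesis
      unfolding sqnorm_def[of "weyl_sol q z \<mu>"] by (simp only: integral_unique)
  qed
  then show ?thesis
    by (simp only:) (intro tendsto_intros assms)
qed

text \<open>The Weyl discs are compact and shrink as \<open>b\<close> grows. Any limit point of the Dirichlet parameters
  of the intervals \<open>[0, n]\<close> lies in all of them.\<close>

lemma weyl_disc_nonempty: "\<exists>m. \<forall>b\<ge>0. sqnorm (weyl_sol q z m) b \<le> Im m / Im z"
proof -
  define \<mu> where "\<mu> n = dirichlet_m q z (real (Suc n))" for n
  have in_disc: "sqnorm (weyl_sol q z (\<mu> n)) b \<le> Im (\<mu> n) / Im z" if "b \<le> real (Suc n)" for n b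
    using sqnorm_mono[OF weyl_sol_continuous that, of "\<mu> n"] sqnorm_weyl_sol_dirichlet[of "real (Suc n)"]
    by (simp add: \<mu>_def)
  define h where "h = \<bar>Im z\<bar> * sqnorm (\<lambda>x. sl_c q x z) 1"
  have h: "0 < h" using sqnorm_c_pos[of 1] z by (simp add: h_def)
  have "cmod (\<mu> n - dirichlet_m q z 1) \<le> 1 / h" for n
    using weyl_disc_radius[of 1 "\<mu> n"] in_disc[of 1 n] h by (simp add: h_def[symmetric] field_simps)
  then have "range \<mu> \<subseteq> cball (dirichlet_m q z 1) (1 / h)"
    by (auto simp: dist_norm norm_minus_commute)
  then obtain m r where r: "strict_mono r" "(\<mu> \<circ> r) \<longlonglongrightarrow> m"
    using compact_cball[of "dirichlet_m q z 1" "1 / h"] unfolding compact_def by (metis range_subsetD)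
  have "sqnorm (weyl_sol q z m) b \<le> Im m / Im z" for b
  proof (rule tendsto_le)
    show "(\<lambda>n. Im ((\<mu> \<circ> r) n) / Im z) \<longlonglongrightarrow> Im m / Im z" by (intro tendsto_intros r z)
    show "(\<lambda>n. sqnorm (weyl_sol q z ((\<mu> \<circ> r) n)) b) \<longlonglongrightarrow> sqnorm (weyl_sol q z m) b"
      by (rule sqnorm_weyl_sol_tendsto[OF r(2)])
    obtain N :: nat where N: "b \<le> real N" using real_arch_simple by blast
    show "\<forall>\<^sub>F n in sequentially. sqnorm (weyl_sol q z ((\<mu> \<circ> r) n)) b \<le> Im ((\<mu> \<circ> r) n) / Im z"
      using eventually_ge_at_top[of N]
    proof eventually_elim
      case (elim n)
      then have "b \<le> real (Suc (r n))" using N seq_suble[OF r(1), of n] by simp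
      then show ?case using in_disc by simp
    qed
  qed auto
  then show ?thesis by blast
qed

end

text \<open>Variation of constants: if \<open>y = \<alpha> u + \<beta> v\<close> with \<open>u\<close>, \<open>v\<close> a fundamental system at \<open>z\<close>, then the derivative of
  \<open>\<bar>\<alpha>\<bar>\<^sup>2 + \<bar>\<beta>\<bar>\<^sup>2\<close> is at most \<open>2 \<bar>\<zeta> - z\<bar> (\<bar>u\<bar>\<^sup>2 + \<bar>v\<bar>\<^sup>2)\<close> times that quantity. When \<open>u\<close> and \<open>v\<close> are
  square integrable, Gronwall's inequality keeps \<open>\<alpha>\<close> and \<open>\<beta>\<close> bounded.\<close>

lemma weyl_alternative:
  assumes q: "continuous_on UNIV q"
    and bd: "\<And>b. 0 \<le> b \<Longrightarrow> sqnorm (\<lambda>x. sl_s q x z) b \<le> B" "\<And>b. 0 \<le> b \<Longrightarrow> sqnorm (\<lambda>x. sl_c q x z) b \<le> B"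
    and y: "sl_solves q \<zeta> y y'"
  obtains B' where "\<And>b. 0 \<le> b \<Longrightarrow> sqnorm y b \<le> B'"
proof -
  define u where "u = sl_sol q z 1 0"
  define u' where "u' = sl_sol' q z 1 0"
  define v where "v = sl_sol q z 0 1"
  define v' where "v' = sl_sol' q z 0 1"
  have u: "sl_solves q z u u'" and v: "sl_solves q z v v'"
    unfolding u_def u'_def v_def v'_def by (rule sl_sol(1)[OF q])+
  have W: "u x * v' x - u' x * v x = 1" for x
    using wronskian_constant[OF v u] by (simp add: u_def u'_def v_def v'_def sl_sol(2,3)[OF q] algebra_simps)
  have cu: "continuous_on UNIV u" and cv: "continuous_on UNIV v" and cy: "continuous_on UNIV y"
    using sl_solves_continuous u v y by blast+
  \<comment> \<open>The coordinates of \<open>(y, y')\<close> with respect to \<open>(u, u')\<close> and \<open>(v, v')\<close>, by Cramer's rule.\<close>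
  define \<alpha> where "\<alpha> x = y x * v' x - y' x * v x" for x
  define \<beta> where "\<beta> x = u x * y' x - u' x * y x" for x
  have y_eq: "y x = \<alpha> x * u x + \<beta> x * v x" for x
  proof -
    have "\<alpha> x * u x + \<beta> x * v x = y x * (u x * v' x - u' x * v x)"
      by (simp add: \<alpha>_def \<beta>_def algebra_simps)
    then show ?thesis by (simp add: W)
  qed
  have \<alpha>': "(\<alpha> has_vector_derivative (\<zeta> - z) * (y x * v x)) (at x)" for x
    using has_vector_derivative_minus[OF sl_solves_wronskian_derivative[OF y v, of x]]
    by (simp add: \<alpha>_def[abs_def] algebra_simps)
  have \<beta>': "(\<beta> has_vector_derivative (z - \<zeta>) * (y x * u x)) (at x)" for x
    using has_vector_derivative_minus[OF sl_solves_wronskian_derivative[OF u y, of x]]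
    by (simp add: \<beta>_def[abs_def] algebra_simps)
  define g where "g x = (cmod (u x))\<^sup>2 + (cmod (v x))\<^sup>2" for x
  define E where "E x = (cmod (\<alpha> x))\<^sup>2 + (cmod (\<beta> x))\<^sup>2" for x
  define E' where "E' x = 2 * Re (cnj (\<alpha> x) * ((\<zeta> - z) * (y x * v x))) + 2 * Re (cnj (\<beta> x) * ((z - \<zeta>) * (y x * u x)))" for x
  define k where "k = 2 * cmod (\<zeta> - z)"
  have g: "continuous_on UNIV g" unfolding g_def by (intro continuous_intros cu cv)
  obtain G where G: "\<And>x. (G has_vector_derivative g x) (at x)"
    using continuous_has_antiderivative[OF g] by blast
  have cs: "a * c + b * d \<le> sqrt (a\<^sup>2 + b\<^sup>2) * sqrt (c\<^sup>2 + d\<^sup>2)" for a b c d :: real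
  proof -
    have "(a * c + b * d)\<^sup>2 + (a * d - b * c)\<^sup>2 = (a\<^sup>2 + b\<^sup>2) * (c\<^sup>2 + d\<^sup>2)"
      by (simp add: power2_eq_square algebra_simps)
    then have "(a * c + b * d)\<^sup>2 \<le> (a\<^sup>2 + b\<^sup>2) * (c\<^sup>2 + d\<^sup>2)"
      using zero_le_power2[of "a * d - b * c"] by linarith
    then show ?thesis unfolding real_sqrt_mult[symmetric] by (rule real_le_rsqrt)
  qed
  have y2: "cmod (y x) \<le> sqrt (E x) * sqrt (g x)" for x
  proof -
    have "cmod (y x) \<le> cmod (\<alpha> x) * cmod (u x) + cmod (\<beta> x) * cmod (v x)"
      unfolding y_eq[of x] using norm_triangle_ineq[of "\<alpha> x * u x" "\<beta> x * v x"] by (simp add: norm_mult)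
    also have "\<dots> \<le> sqrt (E x) * sqrt (g x)" unfolding E_def g_def by (rule cs)
    finally show ?thesis .
  qed
  have E0: "0 \<le> E x" "0 \<le> g x" for x by (auto simp: E_def g_def)
  have Ebd: "E b \<le> E 0 * exp (k * (2 * B))" if b: "0 \<le> b" for b
  proof -
    have "E b \<le> E 0 * exp (k * G b - k * G 0)"
    proof (rule gronwall[OF b, where E' = E' and k = "\<lambda>x. k * g x"])
      fix x assume x: "0 \<le> x" "x \<le> b"
      show "(E has_real_derivative E' x) (at x)"
        unfolding E_def E'_def by (intro DERIV_add norm_square_derivative \<alpha>' \<beta>')
      show "((\<lambda>x. k * G x) has_real_derivative k * g x) (at x)"
        using G by (intro DERIV_cmult) (simp add: has_real_derivative_iff_has_vector_derivative)
      have "E' x \<le> 2 * cmod (cnj (\<alpha> x) * ((\<zeta> - z) * (y x * v x))) + 2 * cmod (cnj (\<beta> x) * ((z - \<zeta>) * (y x * u x)))"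
        unfolding E'_def by (intro add_mono mult_left_mono complex_Re_le_cmod) auto
      also have "\<dots> = k * cmod (y x) * (cmod (\<alpha> x) * cmod (v x) + cmod (\<beta> x) * cmod (u x))"
        unfolding norm_mult k_def complex_mod_cnj norm_minus_commute[of z \<zeta>] by (simp add: algebra_simps)
      also have "\<dots> \<le> k * (sqrt (E x) * sqrt (g x)) * (sqrt (E x) * sqrt (g x))"
      proof (intro mult_mono)
        show "cmod (\<alpha> x) * cmod (v x) + cmod (\<beta> x) * cmod (u x) \<le> sqrt (E x) * sqrt (g x)"
          unfolding E_def g_def by (subst (2) add.commute) (rule cs)
      qed (use y2[of x] in \<open>auto simp: k_def E0\<close>)
      also have "\<dots> = k * g x * E x" using E0[of x] by (simp add: mult_ac)
      finally show "E' x \<le> k * g x * E x" .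
    qed
    moreover have "G b - G 0 \<le> 2 * B"
    proof -
      have "(g has_integral (G b - G 0)) {0..b}"
        by (rule fundamental_theorem_of_calculus[OF b]) (rule has_vector_derivative_at_within[OF G])
      moreover have "(g has_integral (sqnorm u b + sqnorm v b)) {0..b}"
        unfolding g_def by (intro has_integral_add sqnorm_has_integral cu cv)
      ultimately have "G b - G 0 = sqnorm u b + sqnorm v b" by (rule has_integral_unique)
      then show ?thesis using bd[OF b] by (simp add: sl_s_def sl_c_def u_def v_def)
    qed
    then have "k * G b - k * G 0 \<le> k * (2 * B)"
      unfolding right_diff_distrib[symmetric] by (intro mult_left_mono) (auto simp: k_def)
    then have "E 0 * exp (k * G b - k * G 0) \<le> E 0 * exp (k * (2 * B))"
      using E0[of 0] by (intro mult_left_mono) auto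
    ultimately show ?thesis by linarith
  qed
  define C where "C = E 0 * exp (k * (2 * B))"
  have C0: "0 \<le> C" using E0[of 0] by (simp add: C_def)
  have "sqnorm y b \<le> C * (2 * B)" if b: "0 \<le> b" for b
  proof -
    have "sqnorm y b \<le> C * (sqnorm u b + sqnorm v b)"
    proof (rule has_integral_le[OF sqnorm_has_integral[OF cy]])
      show "((\<lambda>x. C * g x) has_integral (C * (sqnorm u b + sqnorm v b))) {0..b}"
        unfolding g_def by (intro has_integral_mult_right has_integral_add sqnorm_has_integral cu cv)
      fix x assume "x \<in> {0..b}"
      then have x: "0 \<le> x" by simp
      have "(cmod (y x))\<^sup>2 \<le> (sqrt (E x) * sqrt (g x))\<^sup>2"
        by (rule power_mono[OF y2]) simp
      also have "\<dots> = E x * g x" using E0[of x] by (simp add: power_mult_distrib)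
      also have "\<dots> \<le> C * g x" using Ebd[OF x] E0[of x] by (intro mult_right_mono) (auto simp: C_def)
      finally show "(cmod (y x))\<^sup>2 \<le> C * g x" .
    qed
    also have "\<dots> \<le> C * (2 * B)"
      using bd[OF b] C0 by (intro mult_left_mono) (auto simp: sl_s_def sl_c_def u_def v_def)
    finally show ?thesis .
  qed
  then show ?thesis by (rule that)
qed

lemma restrict0_measurable:
  "continuous_on UNIV u \<Longrightarrow> I \<in> sets borel \<Longrightarrow> restrict0 I u \<in> borel_measurable lebesgue"
  unfolding restrict0_def
  by (intro measurable_completion, simp, intro measurable_If_set borel_measurable_continuous_onI) auto

lemma restrict0_interval_integral:
  fixes f :: "real \<Rightarrow> 'a::euclidean_space"
  assumes "continuous_on UNIV f"
  shows "integrable lebesgue (\<lambda>x. if x \<in> {a..b} then f x else 0)"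
    and "(\<integral>x. (if x \<in> {a..b} then f x else 0) \<partial>lebesgue) = integral {a..b} f"
proof -
  have "f absolutely_integrable_on {a..b}"
    by (rule absolutely_integrable_continuous_real[OF continuous_on_subset[OF assms]]) simp
  moreover have "(\<lambda>x. indicat_real {a..b} x *\<^sub>R f x) = (\<lambda>x. if x \<in> {a..b} then f x else 0)"
    by (auto simp: indicator_def)
  ultimately show "integrable lebesgue (\<lambda>x. if x \<in> {a..b} then f x else 0)"
    "(\<integral>x. (if x \<in> {a..b} then f x else 0) \<partial>lebesgue) = integral {a..b} f"
    using set_lebesgue_integral_eq_integral(2)[of "{a..b}" f]
    by (simp_all add: set_integrable_def set_lebesgue_integral_def)
qed

lemma square_integrable_interval:
  assumes "continuous_on UNIV u"
  shows "square_integrable (restrict0 {a..b} u)"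
proof -
  have "(\<lambda>x. (cmod (restrict0 {a..b} u x))\<^sup>2) = (\<lambda>x. if x \<in> {a..b} then (cmod (u x))\<^sup>2 else 0)"
    by (auto simp: restrict0_def)
  then show ?thesis
    unfolding square_integrable_def
    using restrict0_measurable[OF assms, of "{a..b}"] restrict0_interval_integral(1)[of "\<lambda>x. (cmod (u x))\<^sup>2" a b] assms
    by (simp add: continuous_intros)
qed

lemma cinner_interval:
  assumes "continuous_on UNIV u" "continuous_on UNIV v"
  shows "cinner (l2_of (restrict0 {a..b} u)) (l2_of (restrict0 {a..b} v)) = integral {a..b} (\<lambda>x. u x * cnj (v x))"
proof -
  have "(\<lambda>x. restrict0 {a..b} u x * cnj (restrict0 {a..b} v x)) = (\<lambda>x. if x \<in> {a..b} then u x * cnj (v x) else 0)"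
    by (auto simp: restrict0_def)
  then show ?thesis
    using restrict0_interval_integral(2)[of "\<lambda>x. u x * cnj (v x)" a b] assms
    by (simp add: cinner_l2_of square_integrable_interval continuous_intros)
qed

lemma norm_interval:
  assumes "continuous_on UNIV u"
  shows "(norm (l2_of (restrict0 {0..b} u)))\<^sup>2 = sqnorm u b"
proof -
  have "(\<lambda>x. (cmod (restrict0 {0..b} u x))\<^sup>2) = (\<lambda>x. if x \<in> {0..b} then (cmod (u x))\<^sup>2 else 0)"
    by (auto simp: restrict0_def)
  then show ?thesis
    unfolding norm_l2_of_square[OF square_integrable_interval[OF assms]] sqnorm_def
    using restrict0_interval_integral(2)[of "\<lambda>x. (cmod (u x))\<^sup>2" 0 b] assms
    by (simp add: continuous_intros)
qed

lemma AE_nonzero: "AE x in lebesgue. x \<noteq> (0 :: real)"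
  by (intro AE_completion AE_lborel_singleton)

lemma square_integrable_half_line_iff:
  assumes u: "continuous_on UNIV u"
  shows "square_integrable (restrict0 {0<..} u) \<longleftrightarrow> (\<exists>B. \<forall>b\<ge>0. sqnorm u b \<le> B)"
proof
  assume s: "square_integrable (restrict0 {0<..} u)"
  have "sqnorm u b \<le> (\<integral>x. (cmod (restrict0 {0<..} u x))\<^sup>2 \<partial>lebesgue)" for b
    unfolding norm_interval[OF u, symmetric] norm_l2_of_square[OF square_integrable_interval[OF u]]
  proof (rule integral_mono_AE)
    show "AE x in lebesgue. (cmod (restrict0 {0..b} u x))\<^sup>2 \<le> (cmod (restrict0 {0<..} u x))\<^sup>2"
      using AE_nonzero by eventually_elim (auto simp: restrict0_def)
  qed (use s square_integrable_interval[OF u] in \<open>auto simp: square_integrable_def\<close>)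
  then show "\<exists>B. \<forall>b\<ge>0. sqnorm u b \<le> B" by blast
next
  assume "\<exists>B. \<forall>b\<ge>0. sqnorm u b \<le> B"
  then obtain B where B: "\<And>b. 0 \<le> b \<Longrightarrow> sqnorm u b \<le> B" by blast
  define f where "f n x = (cmod (restrict0 {0..real n} u x))\<^sup>2" for n x
  have int: "integral\<^sup>L lebesgue (f n) = sqnorm u (real n)" for n
    unfolding f_def norm_interval[OF u, symmetric] norm_l2_of_square[OF square_integrable_interval[OF u]] ..
  have "incseq (\<lambda>n. sqnorm u (real n))"
    by (auto intro!: incseq_SucI sqnorm_mono[OF u])
  then obtain L where L: "(\<lambda>n. sqnorm u (real n)) \<longlonglongrightarrow> L"
    by (rule incseq_convergent[of _ B]) (use B in auto)
  have meas: "(\<lambda>x. (cmod (restrict0 {0<..} u x))\<^sup>2) \<in> borel_measurable lebesgue"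
    using restrict0_measurable[OF u, of "{0<..}"] by (intro borel_measurable_power borel_measurable_norm) auto
  have "integrable lebesgue (\<lambda>x. (cmod (restrict0 {0<..} u x))\<^sup>2)"
  proof (rule integrable_monotone_convergence[of lebesgue f])
    show "integrable lebesgue (f n)" for n
      using square_integrable_interval[OF u] by (simp add: f_def[abs_def] square_integrable_def)
    show "AE x in lebesgue. mono (\<lambda>n. f n x)"
      by (intro AE_I2 monoI) (auto simp: f_def restrict0_def)
    show "AE x in lebesgue. (\<lambda>n. f n x) \<longlonglongrightarrow> (cmod (restrict0 {0<..} u x))\<^sup>2"
      using AE_nonzero
    proof eventually_elim
      case (elim x)
      obtain N :: nat where N: "x \<le> real N" using real_arch_simple by blast
      have "\<forall>\<^sub>F n in sequentially. f n x = (cmod (restrict0 {0<..} u x))\<^sup>2"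
        using eventually_ge_at_top[of N] by eventually_elim (use N elim in \<open>auto simp: f_def restrict0_def\<close>)
      then show ?case by (rule tendsto_eventually)
    qed
    show "(\<lambda>n. integral\<^sup>L lebesgue (f n)) \<longlonglongrightarrow> L" unfolding int by (rule L)
  qed (rule meas)
  then show "square_integrable (restrict0 {0<..} u)"
    using restrict0_measurable[OF u, of "{0<..}"] by (simp add: square_integrable_def)
qed

lemma half_line_truncation_tendsto:
  assumes u: "continuous_on UNIV u" and s: "square_integrable (restrict0 {0<..} u)"
  shows "(\<lambda>n. l2_of (restrict0 {0..real n} u)) \<longlonglongrightarrow> l2_of (restrict0 {0<..} u)"
proof -
  let ?d = "\<lambda>n x. restrict0 {0..real n} u x - restrict0 {0<..} u x"
  note si = square_integrable_interval[OF u]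
  have sd: "square_integrable (?d n)" for n by (intro square_integrable_diff si s)
  have "(\<lambda>n. \<integral>x. (cmod (?d n x))\<^sup>2 \<partial>lebesgue) \<longlonglongrightarrow> (\<integral>x. 0 \<partial>(lebesgue :: real measure))"
  proof (rule integral_dominated_convergence[where w = "\<lambda>x. (cmod (restrict0 {0<..} u x))\<^sup>2"])
    show "(\<lambda>x. (cmod (?d n x))\<^sup>2) \<in> borel_measurable lebesgue" for n
      using sd[of n] by (simp add: square_integrable_def borel_measurable_integrable)
    show "integrable lebesgue (\<lambda>x. (cmod (restrict0 {0<..} u x))\<^sup>2)"
      using s by (simp add: square_integrable_def)
    show "AE x in lebesgue. norm ((cmod (?d n x))\<^sup>2) \<le> (cmod (restrict0 {0<..} u x))\<^sup>2" for n
      using AE_nonzero by eventually_elim (auto simp: restrict0_def)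
    show "AE x in lebesgue. (\<lambda>n. (cmod (?d n x))\<^sup>2) \<longlonglongrightarrow> 0"
      using AE_nonzero
    proof eventually_elim
      case (elim x)
      obtain N :: nat where N: "x \<le> real N" using real_arch_simple by blast
      have "\<forall>\<^sub>F n in sequentially. (cmod (?d n x))\<^sup>2 = 0"
        using eventually_ge_at_top[of N] by eventually_elim (use N elim in \<open>auto simp: restrict0_def\<close>)
      then show ?case by (rule tendsto_eventually)
    qed
  qed simp
  moreover have "(\<integral>x. (cmod (?d n x))\<^sup>2 \<partial>lebesgue) = (norm (l2_of (restrict0 {0..real n} u) - l2_of (restrict0 {0<..} u)))\<^sup>2" for n
    by (simp add: l2_of_diff[OF si s] norm_l2_of_square[OF sd])
  ultimately have "(\<lambda>n. (norm (l2_of (restrict0 {0..real n} u) - l2_of (restrict0 {0<..} u)))\<^sup>2) \<longlonglongrightarrow> 0"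
    by simp
  from tendsto_real_sqrt[OF this]
  have "(\<lambda>n. norm (l2_of (restrict0 {0..real n} u) - l2_of (restrict0 {0<..} u))) \<longlonglongrightarrow> 0"
    by simp
  then show ?thesis
    by (subst Lim_null) (rule tendsto_norm_zero_cancel)
qed

text \<open>Since some solution \<open>s - m c\<close> is always square integrable, \<open>c\<close> is square integrable if and only if all
  solutions are.\<close>

definition limit_point :: "(real \<Rightarrow> real) \<Rightarrow> bool" where
  "limit_point q \<longleftrightarrow> (\<forall>z. Im z \<noteq> 0 \<longrightarrow> \<not> square_integrable (restrict0 {0<..} (\<lambda>x. sl_c q x z)))"

definition weyl_vector :: "(real \<Rightarrow> real) \<Rightarrow> complex \<Rightarrow> l2" where
  "weyl_vector q z = l2_of (restrict0 {0<..} (weyl_sol q z (m_plus q z)))"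

text \<open>By Weyl's alternative, square integrability of all solutions at one \<open>z\<close> would carry over to \<open>\<i>\<close>.\<close>

lemma limit_pointI:
  assumes q: "continuous_on UNIV q"
    and not_both: "\<not> (square_integrable (restrict0 {0<..} (\<lambda>x. sl_s q x \<i>)) \<and> square_integrable (restrict0 {0<..} (\<lambda>x. sl_c q x \<i>)))"
  shows "limit_point q"
  unfolding limit_point_def
proof (intro allI impI notI)
  fix z assume z: "Im z \<noteq> 0" and c: "square_integrable (restrict0 {0<..} (\<lambda>x. sl_c q x z))"
  have cont: "continuous_on UNIV (\<lambda>x. sl_s q x \<zeta>)" "continuous_on UNIV (\<lambda>x. sl_c q x \<zeta>)" for \<zeta>
    unfolding sl_s_def sl_c_def by (rule sl_solves_continuous[OF sl_sol(1)[OF q]])+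
  obtain m where "\<forall>b\<ge>0. sqnorm (weyl_sol q z m) b \<le> Im m / Im z"
    using weyl_disc_nonempty[OF q z] by blast
  then have w: "square_integrable (restrict0 {0<..} (weyl_sol q z m))"
    unfolding square_integrable_half_line_iff[OF weyl_sol_continuous[OF q z]] by blast
  have "square_integrable (\<lambda>x. restrict0 {0<..} (weyl_sol q z m) x + m * restrict0 {0<..} (\<lambda>x. sl_c q x z) x)"
    by (intro square_integrable_add square_integrable_scale w c)
  moreover have "(\<lambda>x. restrict0 {0<..} (weyl_sol q z m) x + m * restrict0 {0<..} (\<lambda>x. sl_c q x z) x) = restrict0 {0<..} (\<lambda>x. sl_s q x z)"
    by (auto simp: restrict0_def weyl_sol_eq[OF q])
  ultimately have s: "square_integrable (restrict0 {0<..} (\<lambda>x. sl_s q x z))" by simp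
  obtain B1 B2 where B: "\<And>b. 0 \<le> b \<Longrightarrow> sqnorm (\<lambda>x. sl_s q x z) b \<le> B1" "\<And>b. 0 \<le> b \<Longrightarrow> sqnorm (\<lambda>x. sl_c q x z) b \<le> B2"
    using s c unfolding square_integrable_half_line_iff[OF cont(1)] square_integrable_half_line_iff[OF cont(2)] by blast
  have B': "\<And>b. 0 \<le> b \<Longrightarrow> sqnorm (\<lambda>x. sl_s q x z) b \<le> max B1 B2" "\<And>b. 0 \<le> b \<Longrightarrow> sqnorm (\<lambda>x. sl_c q x z) b \<le> max B1 B2"
    using B by (auto simp: le_max_iff_disj)
  have "\<exists>B'. \<forall>b\<ge>0. sqnorm y b \<le> B'" if "sl_solves q \<i> y y'" for y y'
    using weyl_alternative[OF q B' that] by metis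
  then show False
    using not_both sl_sol(1)[OF q] unfolding square_integrable_half_line_iff[OF cont(1)] square_integrable_half_line_iff[OF cont(2)]
    unfolding sl_s_def sl_c_def by blast
qed

context
  fixes q :: "real \<Rightarrow> real"
  assumes q: "continuous_on UNIV q" and lp: "limit_point q"
begin

text \<open>The parameter found in the intersection of the Weyl discs is the only one whose solution is
  square integrable, because the difference of two such solutions is a multiple of \<open>c\<close>.\<close>

lemma m_plus_props:
  assumes z: "Im z \<noteq> 0"
  shows "square_integrable (restrict0 {0<..} (weyl_sol q z (m_plus q z)))"
    and "0 \<le> b \<Longrightarrow> sqnorm (weyl_sol q z (m_plus q z)) b \<le> Im (m_plus q z) / Im z"
proof -
  obtain m where m: "\<forall>b\<ge>0. sqnorm (weyl_sol q z m) b \<le> Im m / Im z"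
    using weyl_disc_nonempty[OF q z] by blast
  then have w: "square_integrable (restrict0 {0<..} (weyl_sol q z m))"
    unfolding square_integrable_half_line_iff[OF weyl_sol_continuous[OF q z]] by blast
  have "m_plus q z = m"
    unfolding m_plus_def weyl_sol_eq(1)[OF q, symmetric]
  proof (rule the_equality)
    show "square_integrable (restrict0 {0<..} (weyl_sol q z m))" by (rule w)
    fix m' assume w': "square_integrable (restrict0 {0<..} (weyl_sol q z m'))"
    show "m' = m"
    proof (rule ccontr)
      assume ne: "m' \<noteq> m"
      have "square_integrable (\<lambda>x. (1 / (m - m')) * (restrict0 {0<..} (weyl_sol q z m') x - restrict0 {0<..} (weyl_sol q z m) x))"
        by (intro square_integrable_scale square_integrable_diff w w')
      moreover have "(\<lambda>x. (1 / (m - m')) * (restrict0 {0<..} (weyl_sol q z m') x - restrict0 {0<..} (weyl_sol q z m) x))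
          = restrict0 {0<..} (\<lambda>x. sl_c q x z)"
        using ne by (auto simp: restrict0_def weyl_sol_eq[OF q] field_simps)
      ultimately show False using lp z by (simp add: limit_point_def)
    qed
  qed
  with m w show "square_integrable (restrict0 {0<..} (weyl_sol q z (m_plus q z)))"
    "0 \<le> b \<Longrightarrow> sqnorm (weyl_sol q z (m_plus q z)) b \<le> Im (m_plus q z) / Im z" by auto
qed

lemma sqnorm_c_at_top:
  assumes z: "Im z \<noteq> 0"
  shows "filterlim (\<lambda>n. sqnorm (\<lambda>x. sl_c q x z) (real n)) at_top sequentially"
  unfolding filterlim_at_top
proof
  fix Z
  note cc = sl_c_continuous[OF q z]
  have "\<not> (\<exists>B. \<forall>b\<ge>0. sqnorm (\<lambda>x. sl_c q x z) b \<le> B)"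
    using lp z unfolding limit_point_def square_integrable_half_line_iff[OF cc, symmetric] by blast
  then obtain b where b: "Z < sqnorm (\<lambda>x. sl_c q x z) b" by (meson not_le)
  obtain N :: nat where "b \<le> real N" using real_arch_simple by blast
  then have "Z \<le> sqnorm (\<lambda>x. sl_c q x z) (real n)" if "N \<le> n" for n
    using b sqnorm_mono[OF cc, of b "real n"] that by simp
  then show "\<forall>\<^sub>F n in sequentially. Z \<le> sqnorm (\<lambda>x. sl_c q x z) (real n)"
    by (auto simp: eventually_sequentially)
qed

text \<open>The distance of \<open>m\<^sub>n\<close> to the limit is at most \<open>1 / (\<bar>Im z\<bar> \<parallel>c\<parallel>\<^sup>2)\<close>, with the norm taken over
  \<open>[0, n]\<close>. The solutions differ by a multiple of \<open>c\<close>, and the squared norm of the difference is at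
  most \<open>1 / (\<bar>Im z\<bar>\<^sup>2 \<parallel>c\<parallel>\<^sup>2)\<close>, which tends to \<open>0\<close> in the limit point case.\<close>

lemma dirichlet_m_tendsto:
  assumes z: "Im z \<noteq> 0"
  shows "(\<lambda>n. dirichlet_m q z (real n)) \<longlonglongrightarrow> m_plus q z"
    and "(\<lambda>n. l2_of (restrict0 {0..real n} (weyl_sol q z (dirichlet_m q z (real n))))) \<longlonglongrightarrow> weyl_vector q z"
proof -
  let ?m = "m_plus q z" and ?\<mu> = "\<lambda>n. dirichlet_m q z (real n)" and ?h = "\<lambda>n. sqnorm (\<lambda>x. sl_c q x z) (real n)"
  have radius: "cmod (?m - ?\<mu> n) * (\<bar>Im z\<bar> * ?h n) \<le> 1" if "0 < n" for n
    by (rule weyl_disc_radius[OF q z]) (use that m_plus_props(2)[OF z] in auto)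
  have hpos: "0 < ?h n" if "0 < n" for n using sqnorm_c_pos[OF q z] that by simp
  have hinv: "(\<lambda>n. inverse (?h n)) \<longlonglongrightarrow> 0"
    by (rule tendsto_inverse_0_at_top[OF sqnorm_c_at_top[OF z]])
  show "?\<mu> \<longlonglongrightarrow> ?m"
  proof (rule Lim_null[THEN iffD2], rule Lim_null_comparison)
    show "\<forall>\<^sub>F n in sequentially. norm (?\<mu> n - ?m) \<le> inverse (?h n) * (1 / \<bar>Im z\<bar>)"
      using eventually_gt_at_top[of 0]
    proof eventually_elim
      case (elim n)
      then show ?case using radius[OF elim] hpos[OF elim] z by (simp add: field_simps norm_minus_commute)
    qed
    show "(\<lambda>n. inverse (?h n) * (1 / \<bar>Im z\<bar>)) \<longlonglongrightarrow> 0"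
      by (rule tendsto_mult_left_zero[OF hinv])
  qed
  let ?\<psi> = "weyl_sol q z ?m" and ?P = "\<lambda>n. l2_of (restrict0 {0..real n} (weyl_sol q z (?\<mu> n)))"
  let ?Q = "\<lambda>n. l2_of (restrict0 {0..real n} (weyl_sol q z ?m))"
  have wc: "continuous_on UNIV (weyl_sol q z m)" for m by (rule weyl_sol_continuous[OF q z])
  have diff: "(norm (?P n - ?Q n))\<^sup>2 = (cmod (?m - ?\<mu> n))\<^sup>2 * ?h n" for n
  proof -
    have e: "(\<lambda>x. restrict0 {0..real n} (weyl_sol q z (?\<mu> n)) x - restrict0 {0..real n} (weyl_sol q z ?m) x)
        = restrict0 {0..real n} (\<lambda>x. (?m - ?\<mu> n) * sl_c q x z)"
      by (auto simp: restrict0_def weyl_sol_eq[OF q] algebra_simps)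
    have "continuous_on UNIV (\<lambda>x. (?m - ?\<mu> n) * sl_c q x z)"
      by (intro continuous_intros sl_c_continuous[OF q z])
    from norm_interval[OF this] show ?thesis
      by (simp add: l2_of_diff square_integrable_interval[OF wc] e sqnorm_scale)
  qed
  have "(\<lambda>n. (norm (?P n - ?Q n))\<^sup>2) \<longlonglongrightarrow> 0"
  proof (rule Lim_null_comparison)
    show "\<forall>\<^sub>F n in sequentially. norm ((norm (?P n - ?Q n))\<^sup>2) \<le> inverse (?h n) * (1 / \<bar>Im z\<bar>)\<^sup>2"
      using eventually_gt_at_top[of 0]
    proof eventually_elim
      case (elim n)
      have "cmod (?m - ?\<mu> n) * ?h n \<le> 1 / \<bar>Im z\<bar>"
        using radius[OF elim] z by (simp add: field_simps)
      then have "(cmod (?m - ?\<mu> n) * ?h n)\<^sup>2 \<le> (1 / \<bar>Im z\<bar>)\<^sup>2"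
        using hpos[OF elim] by (intro power_mono) auto
      then have "(cmod (?m - ?\<mu> n))\<^sup>2 * ?h n * ?h n \<le> (1 / \<bar>Im z\<bar>)\<^sup>2"
        by (simp add: power_mult_distrib power2_eq_square mult_ac)
      then have "(cmod (?m - ?\<mu> n))\<^sup>2 * ?h n \<le> (1 / \<bar>Im z\<bar>)\<^sup>2 / ?h n"
        using hpos[OF elim] by (subst pos_le_divide_eq) auto
      then show ?case unfolding diff using hpos[OF elim] by (simp add: divide_inverse mult_ac)
    qed
    show "(\<lambda>n. inverse (?h n) * (1 / \<bar>Im z\<bar>)\<^sup>2) \<longlonglongrightarrow> 0"
      by (rule tendsto_mult_left_zero[OF hinv])
  qed
  from tendsto_real_sqrt[OF this] have "(\<lambda>n. norm (?P n - ?Q n)) \<longlonglongrightarrow> 0" by simp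
  then have "(\<lambda>n. ?P n - ?Q n) \<longlonglongrightarrow> 0" by (rule tendsto_norm_zero_cancel)
  moreover have "?Q \<longlonglongrightarrow> weyl_vector q z"
    unfolding weyl_vector_def by (rule half_line_truncation_tendsto[OF wc m_plus_props(1)[OF z]])
  ultimately have "(\<lambda>n. (?P n - ?Q n) + ?Q n) \<longlonglongrightarrow> 0 + weyl_vector q z" by (rule tendsto_add)
  then show "?P \<longlonglongrightarrow> weyl_vector q z" by simp
qed

text \<open>The Dirichlet solutions on \<open>[0, n]\<close> vanish at \<open>n\<close>, so that Lagrange's identity leaves only the boundary
  term at \<open>0\<close>. Both sides converge as \<open>n\<close> grows.\<close>

theorem m_plus_kernel:
  assumes z: "Im z \<noteq> 0" and \<zeta>: "Im \<zeta> \<noteq> 0"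
  shows "m_plus q \<zeta> - cnj (m_plus q z) = (\<zeta> - cnj z) * cinner (weyl_vector q \<zeta>) (weyl_vector q z)"
proof (rule LIMSEQ_unique)
  let ?P = "\<lambda>z n. l2_of (restrict0 {0..real n} (weyl_sol q z (dirichlet_m q z (real n))))"
  show "(\<lambda>n. dirichlet_m q \<zeta> (real n) - cnj (dirichlet_m q z (real n))) \<longlonglongrightarrow> m_plus q \<zeta> - cnj (m_plus q z)"
    by (intro tendsto_intros dirichlet_m_tendsto z \<zeta>)
  have lim: "(\<lambda>n. (\<zeta> - cnj z) * cinner (?P \<zeta> n) (?P z n)) \<longlonglongrightarrow> (\<zeta> - cnj z) * cinner (weyl_vector q \<zeta>) (weyl_vector q z)"
    by (intro tendsto_mult tendsto_const bounded_bilinear.tendsto[OF bounded_bilinear_cinner] dirichlet_m_tendsto z \<zeta>)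
  have eq: "(\<zeta> - cnj z) * cinner (?P \<zeta> n) (?P z n) = dirichlet_m q \<zeta> (real n) - cnj (dirichlet_m q z (real n))"
    if n: "0 < n" for n
  proof -
    let ?b = "real n" and ?m = "dirichlet_m q z (real n)" and ?\<mu> = "dirichlet_m q \<zeta> (real n)"
    have z0: "weyl_sol q z ?m ?b = 0" "weyl_sol q \<zeta> ?\<mu> ?b = 0"
      using sl_c_nonzero[OF q z, of ?b] sl_c_nonzero[OF q \<zeta>, of ?b] n
      by (simp_all add: weyl_sol_eq[OF q] dirichlet_m_def)
    have "((\<lambda>x. (\<zeta> - cnj z) * (cnj (weyl_sol q z ?m x) * weyl_sol q \<zeta> ?\<mu> x)) has_integral (?\<mu> - cnj ?m)) {0..?b}"
      using lagrange_identity[OF sl_solves_cnj[OF sl_sol(1)[OF q, of z "- ?m" 1]] sl_sol(1)[OF q, of \<zeta> "- ?\<mu>" 1], of 0 ?b] z0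
      by (simp add: weyl_sol_def sl_sol(2,3)[OF q])
    then have "integral {0..?b} (\<lambda>x. (\<zeta> - cnj z) * (weyl_sol q \<zeta> ?\<mu> x * cnj (weyl_sol q z ?m x))) = ?\<mu> - cnj ?m"
      by (intro integral_unique) (simp add: mult_ac)
    then show ?thesis
      by (simp add: cinner_interval weyl_sol_continuous[OF q z] weyl_sol_continuous[OF q \<zeta>])
  qed
  show "(\<lambda>n. dirichlet_m q \<zeta> (real n) - cnj (dirichlet_m q z (real n))) \<longlonglongrightarrow> (\<zeta> - cnj z) * cinner (weyl_vector q \<zeta>) (weyl_vector q z)"
    by (rule Lim_transform_eventually[OF lim], rule eventually_mono[OF eventually_gt_at_top[of 0]], rule eq)
qed

text \<open>A solution that vanishes on \<open>[0, 1]\<close> has Wronskian \<open>0\<close> with \<open>c\<close>, whereas the derivative \<open>1\<close> at the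
  origin makes this Wronskian \<open>1\<close>.\<close>

lemma weyl_vector_nonzero:
  assumes z: "Im z \<noteq> 0"
  shows "weyl_vector q z \<noteq> 0"
proof
  assume "weyl_vector q z = 0"
  moreover have "sqnorm (weyl_sol q z (m_plus q z)) 1 \<le> (norm (weyl_vector q z))\<^sup>2"
    unfolding norm_interval[OF weyl_sol_continuous[OF q z], symmetric] weyl_vector_def
      norm_l2_of_square[OF square_integrable_interval[OF weyl_sol_continuous[OF q z]]]
      norm_l2_of_square[OF m_plus_props(1)[OF z]]
  proof (rule integral_mono_AE)
    show "AE x in lebesgue. (cmod (restrict0 {0..1} (weyl_sol q z (m_plus q z)) x))\<^sup>2
        \<le> (cmod (restrict0 {0<..} (weyl_sol q z (m_plus q z)) x))\<^sup>2"
      using AE_nonzero by eventually_elim (auto simp: restrict0_def)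
  qed (use m_plus_props(1)[OF z] square_integrable_interval[OF weyl_sol_continuous[OF q z]] in \<open>auto simp: square_integrable_def\<close>)
  ultimately have "sqnorm (weyl_sol q z (m_plus q z)) 1 \<le> 0" by simp
  moreover have "0 < sqnorm (weyl_sol q z (m_plus q z)) 1"
  proof (rule ccontr)
    assume "\<not> ?thesis"
    then have h: "sqnorm (weyl_sol q z (m_plus q z)) 1 = 0"
      using sqnorm_nonneg[OF weyl_sol_continuous[OF q z], of "m_plus q z" 1] by simp
    then have "weyl_sol q z (m_plus q z) x = 0" if "x \<in> {0..1}" for x
      using sqnorm_pos[OF weyl_sol_continuous[OF q z] that] by fastforce
    then have "sl_sol q z (- m_plus q z) 1 (1/2) = 0 \<and> sl_sol' q z (- m_plus q z) 1 (1/2) = 0"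
      using sl_solves_zero_on_open[OF sl_sol(1)[OF q], of "{0<..<1}" "1/2" z "- m_plus q z" 1]
      by (auto simp: weyl_sol_def)
    moreover have "sl_sol' q z (- m_plus q z) 1 (1/2) * sl_sol q z 1 0 (1/2) - sl_sol q z (- m_plus q z) 1 (1/2) * sl_sol' q z 1 0 (1/2) = 1"
      using wronskian_constant[OF sl_sol(1)[OF q, of z "- m_plus q z" 1] sl_sol(1)[OF q, of z 1 0], of "1/2"]
      by (simp add: sl_sol(2,3)[OF q])
    ultimately show False by simp
  qed
  ultimately show False by simp
qed

end

section \<open>Deficiency indices and the limit point case\<close>

text \<open>Integration by parts where one factor is only absolutely continuous. As functions of the upper
  limit of integration the two sides differ by a function \<open>D\<close> with
  \<open>\<bar>D y - D x\<bar> \<le> 2 L \<bar>y - x\<bar> \<bar>F y - F x\<bar>\<close>, where \<open>F\<close> is a primitive of \<open>\<bar>f2\<bar>\<close> and \<open>L\<close> a bound for \<open>v'\<close>.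
  As \<open>F\<close> is continuous, \<open>D\<close> has derivative \<open>0\<close> everywhere, including the points where \<open>f1\<close> is not
  differentiable.\<close>

lemma absolutely_continuous_product_integral:
  fixes f1 f2 v v' :: "real \<Rightarrow> complex"
  assumes ab: "a \<le> b"
    and f1: "\<And>x y. a \<le> x \<Longrightarrow> x \<le> y \<Longrightarrow> y \<le> b \<Longrightarrow> (f2 has_integral (f1 y - f1 x)) {x..y}"
    and f2: "f2 absolutely_integrable_on {a..b}"
    and v: "\<And>x. (v has_vector_derivative v' x) (at x)" and v': "continuous_on UNIV v'"
  shows "((\<lambda>x. f2 x * v x + f1 x * v' x) has_integral (f1 b * v b - f1 a * v a)) {a..b}"
proof -
  have vc: "continuous_on S v" for S
    using v by (intro continuous_at_imp_continuous_on) (auto intro: has_vector_derivative_continuous)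
  have v'c: "continuous_on S v'" for S using v' by (rule continuous_on_subset) simp
  have f2i: "f2 integrable_on {a..b}" using f2 by (rule set_lebesgue_integral_eq_integral(1))
  have f1_eq: "f1 x = f1 a + integral {a..x} f2" if "x \<in> {a..b}" for x
    using integral_unique[OF f1[of a x]] that by simp
  have f1c: "continuous_on {a..b} f1"
    by (subst continuous_on_cong[OF refl f1_eq], assumption)
       (intro continuous_intros indefinite_integral_continuous_1 f2i)
  define \<phi> where "\<phi> x = f2 x * v x + f1 x * v' x" for x
  have "(\<lambda>x. v x * f2 x) absolutely_integrable_on {a..b}"
  proof (rule absolutely_integrable_bounded_measurable_product[OF bilinear_times])
    show "v \<in> borel_measurable (lebesgue_on {a..b})"
      by (rule continuous_imp_measurable_on_sets_lebesgue[OF vc]) simp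
    show "bounded (v ` {a..b})"
      by (intro compact_imp_bounded compact_continuous_image vc) simp
  qed (use f2 in auto)
  then have "(\<lambda>x. f2 x * v x) integrable_on {a..b}"
    by (simp add: mult.commute set_lebesgue_integral_eq_integral(1))
  moreover have "(\<lambda>x. f1 x * v' x) integrable_on {a..b}"
    by (intro integrable_continuous_real continuous_intros f1c v'c)
  ultimately have \<phi>i: "\<phi> integrable_on {a..b}"
    unfolding \<phi>_def by (rule integrable_add)
  have sub: "g integrable_on {x..y}" if "g integrable_on {a..b}" "a \<le> x" "y \<le> b" for x y and g :: "real \<Rightarrow> 'z::euclidean_space"
    using integrable_on_subinterval[OF that(1), of x y] that by auto
  define F where "F x = integral {a..x} (\<lambda>t. cmod (f2 t))" for x
  have n2i: "(\<lambda>t. cmod (f2 t)) integrable_on {a..b}"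
    using f2 by (auto simp: absolutely_integrable_on_def)
  have Fc: "continuous_on {a..b} F" unfolding F_def by (rule indefinite_integral_continuous_1[OF n2i])
  have Fdiff: "integral {x..y} (\<lambda>t. cmod (f2 t)) = F y - F x" if "a \<le> x" "x \<le> y" "y \<le> b" for x y
    using Henstock_Kurzweil_Integration.integral_combine[of a x y "\<lambda>t. cmod (f2 t)"] that sub[OF n2i, of a y]
    by (simp add: F_def)
  obtain L where L: "\<And>x. x \<in> {a..b} \<Longrightarrow> cmod (v' x) \<le> L" "0 < L"
    using compact_imp_bounded[OF compact_continuous_image[OF v'c[of "{a..b}"] compact_Icc]]
    unfolding bounded_pos by blast
  define D where "D x = integral {a..x} \<phi> - f1 x * v x" for x
  have key: "cmod (D y - D x) \<le> 2 * L * (y - x) * (F y - F x)" if xy: "a \<le> x" "x \<le> y" "y \<le> b" for x y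
  proof -
    have "integral {x..y} \<phi> = integral {a..y} \<phi> - integral {a..x} \<phi>"
      using Henstock_Kurzweil_Integration.integral_combine[of a x y \<phi>] xy sub[OF \<phi>i, of a y]
      by (simp add: algebra_simps)
    then have "(\<phi> has_integral (integral {a..y} \<phi> - integral {a..x} \<phi>)) {x..y}"
      using integrable_integral[OF sub[OF \<phi>i, of x y]] xy by simp
    moreover have "((\<lambda>t. f2 t * v x) has_integral (f1 y - f1 x) * v x) {x..y}"
      by (intro has_integral_mult_left f1 xy)
    moreover have "((\<lambda>t. f1 y * v' t) has_integral f1 y * (v y - v x)) {x..y}"
      by (intro has_integral_mult_right fundamental_theorem_of_calculus xy has_vector_derivative_at_within[OF v])
    ultimately have "((\<lambda>t. \<phi> t - f2 t * v x - f1 y * v' t) has_integral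
        (integral {a..y} \<phi> - integral {a..x} \<phi> - (f1 y - f1 x) * v x - f1 y * (v y - v x))) {x..y}"
      by (intro has_integral_diff)
    moreover have "(\<lambda>t. \<phi> t - f2 t * v x - f1 y * v' t) = (\<lambda>t. f2 t * (v t - v x) + (f1 t - f1 y) * v' t)"
      by (auto simp: \<phi>_def algebra_simps)
    moreover have "integral {a..y} \<phi> - integral {a..x} \<phi> - (f1 y - f1 x) * v x - f1 y * (v y - v x) = D y - D x"
      by (simp add: D_def algebra_simps)
    ultimately have h: "((\<lambda>t. f2 t * (v t - v x) + (f1 t - f1 y) * v' t) has_integral (D y - D x)) {x..y}"
      by simp
    let ?\<Delta> = "F y - F x"
    have b: "cmod (f2 t * (v t - v x) + (f1 t - f1 y) * v' t) \<le> cmod (f2 t) * (L * (y - x)) + ?\<Delta> * L"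
      if t: "t \<in> {x..y}" for t
    proof -
      have "cmod (v t - v x) \<le> L * (t - x)"
      proof -
        have "norm (v t - v x) \<le> L * t - L * x" if "x < t"
          by (rule differentiable_bound_general[OF that vc, where f' = v' and \<phi>' = "\<lambda>_. L"])
             (use v L xy t in \<open>auto intro!: continuous_intros derivative_eq_intros\<close>)
        then show ?thesis using t by (cases "x = t") (auto simp: algebra_simps)
      qed
      also have "\<dots> \<le> L * (y - x)" using t L(2) by (intro mult_left_mono) auto
      finally have 1: "cmod (v t - v x) \<le> L * (y - x)" .
      have "cmod (f1 y - f1 t) \<le> integral {t..y} (\<lambda>s. cmod (f2 s))"
        using integral_unique[OF f1[of t y]] integral_norm_bound_integral[OF sub[OF f2i, of t y] sub[OF n2i, of t y]] t xy
        by simp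
      also have "\<dots> \<le> integral {x..y} (\<lambda>s. cmod (f2 s))"
        by (rule integral_subset_le) (use t xy sub[OF n2i] in auto)
      finally have 2: "cmod (f1 t - f1 y) \<le> ?\<Delta>" using Fdiff[OF xy] by (simp add: norm_minus_commute)
      have "cmod (f2 t * (v t - v x) + (f1 t - f1 y) * v' t) \<le> cmod (f2 t) * cmod (v t - v x) + cmod (f1 t - f1 y) * cmod (v' t)"
        by (metis norm_triangle_ineq norm_mult)
      also have "\<dots> \<le> cmod (f2 t) * (L * (y - x)) + ?\<Delta> * L"
        using 1 2 L t xy by (intro add_mono mult_mono order_trans[OF norm_ge_zero 2]) auto
      finally show ?thesis .
    qed
    have g: "((\<lambda>t. cmod (f2 t) * (L * (y - x)) + ?\<Delta> * L) has_integral (?\<Delta> * (L * (y - x)) + (y - x) *\<^sub>R (?\<Delta> * L))) {x..y}"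
    proof (intro has_integral_add has_integral_mult_left)
      show "((\<lambda>t. cmod (f2 t)) has_integral ?\<Delta>) {x..y}"
        using integrable_integral[OF sub[OF n2i, of x y]] xy by (simp add: Fdiff)
      show "((\<lambda>t. ?\<Delta> * L) has_integral (y - x) *\<^sub>R (?\<Delta> * L)) {x..y}"
        using has_integral_const_real[of "?\<Delta> * L" x y] xy by simp
    qed
    have "norm (integral {x..y} (\<lambda>t. f2 t * (v t - v x) + (f1 t - f1 y) * v' t))
        \<le> integral {x..y} (\<lambda>t. cmod (f2 t) * (L * (y - x)) + ?\<Delta> * L)"
      by (rule integral_norm_bound_integral[OF has_integral_integrable[OF h] has_integral_integrable[OF g] b])
    then have "cmod (D y - D x) \<le> ?\<Delta> * (L * (y - x)) + (y - x) *\<^sub>R (?\<Delta> * L)"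
      by (simp only: integral_unique[OF h] integral_unique[OF g])
    then show ?thesis by (simp add: algebra_simps)
  qed
  have "D b = D a"
  proof (rule has_derivative_zero_unique[of "{a..b}" D b a])
    fix x assume x: "x \<in> {a..b}"
    have "((\<lambda>y. 2 * L * \<bar>F y - F x\<bar>) \<longlongrightarrow> 2 * L * \<bar>F x - F x\<bar>) (at x within {a..b})"
      by (intro tendsto_intros) (use Fc x in \<open>auto simp: continuous_on_def\<close>)
    then have lim: "((\<lambda>y. 2 * L * \<bar>F y - F x\<bar>) \<longlongrightarrow> 0) (at x within {a..b})" by simp
    have "((\<lambda>y. cmod (D y - D x) / \<bar>y - x\<bar>) \<longlongrightarrow> 0) (at x within {a..b})"
    proof (rule Lim_null_comparison[OF _ lim])
      show "\<forall>\<^sub>F y in at x within {a..b}. norm (cmod (D y - D x) / \<bar>y - x\<bar>) \<le> 2 * L * \<bar>F y - F x\<bar>"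
        unfolding eventually_at_filter
      proof (intro always_eventually allI impI)
        fix y assume y: "y \<noteq> x" "y \<in> {a..b}"
        have "cmod (D y - D x) \<le> 2 * L * \<bar>F y - F x\<bar> * \<bar>y - x\<bar>"
        proof (cases "x \<le> y")
          case True
          then have "cmod (D y - D x) \<le> 2 * L * (y - x) * (F y - F x)" using key[of x y] x y by auto
          also have "\<dots> \<le> 2 * L * (y - x) * \<bar>F y - F x\<bar>" using True L(2) by (intro mult_left_mono) auto
          also have "\<dots> = 2 * L * \<bar>F y - F x\<bar> * \<bar>y - x\<bar>" using True by (simp only: mult_ac abs_of_nonneg diff_ge_0_iff_ge)
          finally show ?thesis .
        next
          case False
          then have "cmod (D y - D x) \<le> 2 * L * (x - y) * (F x - F y)" using key[of y x] x y by (auto simp: norm_minus_commute)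
          also have "\<dots> \<le> 2 * L * (x - y) * \<bar>F y - F x\<bar>" using False L(2) by (intro mult_left_mono) auto
          also have "\<dots> = 2 * L * \<bar>F y - F x\<bar> * \<bar>y - x\<bar>" using False by simp
          finally show ?thesis .
        qed
        then show "norm (cmod (D y - D x) / \<bar>y - x\<bar>) \<le> 2 * L * \<bar>F y - F x\<bar>"
          using y(1) by (simp add: divide_le_eq)
      qed
    qed
    then show "(D has_derivative (\<lambda>h. 0)) (at x within {a..b})"
      unfolding has_derivative_iff_norm by simp
  qed (use ab in auto)
  then have "integral {a..b} \<phi> = f1 b * v b - f1 a * v a" by (simp add: D_def algebra_simps)
  then show ?thesis using integrable_integral[OF \<phi>i] by (simp add: \<phi>_def[abs_def])
qed

lemma ac_derivD:
  assumes "ac_deriv I f g" "{a..b} \<subseteq> I" "a \<le> x" "x \<le> y" "y \<le> b"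
  shows "g absolutely_integrable_on {x..y}" "(g has_integral (f y - f x)) {x..y}"
proof -
  have "x \<in> I" "y \<in> I" using assms by auto
  then show "g absolutely_integrable_on {x..y}" "(g has_integral (f y - f x)) {x..y}"
    using assms unfolding ac_deriv_def by blast+
qed

lemma ac_deriv_zero:
  assumes ac: "ac_deriv I f f1" and c: "continuous_on {p..r} f1" and I: "{p..r} \<subseteq> I" and "p < r"
    and 0: "\<And>x. x \<in> {p<..<r} \<Longrightarrow> f x = 0" and x: "x \<in> {p..r}"
  shows "f x = 0" "f1 x = 0"
proof -
  have fx: "f y = f p + integral {p..y} f1" if "y \<in> {p..r}" for y
  proof -
    have "(f1 has_integral (f y - f p)) {p..y}"
      using ac_derivD(2)[OF ac I, of p y] that by auto
    from integral_unique[OF this] show ?thesis by simp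
  qed
  have "continuous_on {p..r} (\<lambda>y. f p + integral {p..y} f1)"
    by (intro continuous_intros indefinite_integral_continuous_1 integrable_continuous_real c)
  then have fc: "continuous_on {p..r} f"
    by (subst continuous_on_cong[OF refl fx]) auto
  have f0: "f y = 0" if "y \<in> {p..r}" for y
  proof (rule continuous_constant_on_closure[of "{p<..<r}" f 0])
    show "continuous_on (closure {p<..<r}) f" "y \<in> closure {p<..<r}" using fc that \<open>p < r\<close> by auto
  qed (rule 0)
  then show "f x = 0" using x .
  have "((\<lambda>y. integral {p..y} f1) has_vector_derivative f1 x) (at x within {p..r})"
    by (rule integral_has_vector_derivative[OF c x])
  moreover have "((\<lambda>y. integral {p..y} f1) has_vector_derivative 0) (at x within {p..r})"
  proof (rule has_vector_derivative_transform[OF x])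
    show "\<And>y. y \<in> {p..r} \<Longrightarrow> integral {p..y} f1 = 0" using fx f0 \<open>p < r\<close> by (metis add.left_neutral atLeastAtMost_iff less_imp_le order_refl)
  qed simp
  ultimately show "f1 x = 0"
    by (rule vector_derivative_unique_within[rotated])
       (use \<open>p < r\<close> x in \<open>auto simp: trivial_limit_within islimpt_Icc\<close>)
qed

lemma ac_deriv_continuous:
  assumes ac: "ac_deriv I f g" and I: "{a..b} \<subseteq> I"
  shows "continuous_on {a..b} f"
proof (cases "a \<le> b")
  case True
  have fx: "f x = f a + integral {a..x} g" if "x \<in> {a..b}" for x
  proof -
    have "(g has_integral (f x - f a)) {a..x}" using ac_derivD(2)[OF ac I, of a x] that by auto
    from integral_unique[OF this] show ?thesis by simp
  qed
  have "g integrable_on {a..b}"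
    using ac_derivD(2)[OF ac I, of a b] True by (auto intro: has_integral_integrable)
  then have "continuous_on {a..b} (\<lambda>x. f a + integral {a..x} g)"
    by (intro continuous_intros indefinite_integral_continuous_1)
  then show ?thesis
    by (subst continuous_on_cong[OF refl fx]) auto
qed auto

text \<open>The boundary terms of two integrations by parts vanish, because \<open>f\<close> and its derivative are \<open>0\<close> near
  both ends of the interval.\<close>

lemma green_compact_support:
  assumes q: "continuous_on UNIV q" and e: "sl_expr q I f k" and ab: "a < p" "p \<le> r" "r < b" and I: "{a..b} \<subseteq> I"
    and 0: "\<And>x. x \<in> I \<Longrightarrow> x \<notin> {p..r} \<Longrightarrow> f x = 0"
    and w: "sl_solves q z w w'"
  shows "((\<lambda>x. k x * w x - f x * (z * w x)) has_integral 0) {a..b}"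
proof -
  obtain f1 f2 where ac: "ac_deriv I f f1" "ac_deriv I f1 f2"
    and k: "\<And>x. x \<in> I \<Longrightarrow> k x = - f2 x + of_real (q x) * f x"
    using e unfolding sl_expr_def by blast
  note wc = sl_solves_continuous[OF w]
  have hasint: "(f2 has_integral (f1 y - f1 x)) {x..y}" "(f1 has_integral (f y - f x)) {x..y}"
    if "a \<le> x" "x \<le> y" "y \<le> b" for x y
    using ac_derivD(2)[OF ac(1) I] ac_derivD(2)[OF ac(2) I] that by auto
  have absint: "f2 absolutely_integrable_on {a..b}" "f1 absolutely_integrable_on {a..b}"
    using ac_derivD(1)[OF ac(1) I, of a b] ac_derivD(1)[OF ac(2) I, of a b] ab by auto
  have f1c: "continuous_on {x..y} f1" if "{x..y} \<subseteq> {a..b}" for x y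
    by (rule ac_deriv_continuous[OF ac(2) order_trans[OF that I]])
  have "f a = 0" "f1 a = 0"
    using ac_deriv_zero[OF ac(1) f1c[of a p], of a] 0 ab I by (auto simp: subset_iff)
  moreover have "f b = 0" "f1 b = 0"
    using ac_deriv_zero[OF ac(1) f1c[of r b], of b] 0 ab I by (auto simp: subset_iff)
  moreover have 1: "((\<lambda>x. f2 x * w x + f1 x * w' x) has_integral (f1 b * w b - f1 a * w a)) {a..b}"
    by (rule absolutely_continuous_product_integral) (use ab hasint absint wc sl_solvesD[OF w] in auto)
  moreover have 2: "((\<lambda>x. f1 x * w' x + f x * ((of_real (q x) - z) * w x)) has_integral (f b * w' b - f a * w' a)) {a..b}"
  proof (rule absolutely_continuous_product_integral)
    show "continuous_on UNIV (\<lambda>x. (of_real (q x) - z) * w x)" by (intro continuous_intros q wc)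
  qed (use ab hasint absint sl_solvesD[OF w] in auto)
  ultimately have "((\<lambda>x. (f1 x * w' x + f x * ((of_real (q x) - z) * w x)) - (f2 x * w x + f1 x * w' x)) has_integral 0) {a..b}"
    using has_integral_diff[OF 2 1] by simp
  then show ?thesis
  proof (rule has_integral_eq[rotated])
    fix x assume "x \<in> {a..b}"
    then have kx: "k x = - f2 x + of_real (q x) * f x" using k I by auto
    then show "(f1 x * w' x + f x * ((of_real (q x) - z) * w x)) - (f2 x * w x + f1 x * w' x) = k x * w x - f x * (z * w x)"
      unfolding kx by (simp add: algebra_simps)
  qed
qed

text \<open>The relation that defines membership in the adjoint is closed, so it may be verified on functions of compact
  support, where it is Green's formula. The image of such a function vanishes off the support only
  almost everywhere; the integral over \<open>I\<close> is therefore obtained as a limit over the exhausting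
  intervals \<open>[\<alpha> n, \<beta> n]\<close>.\<close>

lemma solution_in_adjoint_sl_min:
  assumes q: "continuous_on UNIV q"
    and exh: "\<And>n. {\<alpha> n..\<beta> n} \<subseteq> I" "\<And>x. x \<in> I \<Longrightarrow> \<forall>\<^sub>F n in sequentially. \<alpha> n < x \<and> x < \<beta> n"
    and u: "sl_solves q z u u'" and s: "square_integrable (restrict0 I u)"
  shows "(l2_of (restrict0 I u), scaleC z (l2_of (restrict0 I u))) \<in> adjoint_in (L2_on I) (sl_min q I)"
proof -
  let ?U = "l2_of (restrict0 I u)"
  have r: "(\<lambda>x. z * restrict0 I u x) = restrict0 I (\<lambda>x. z * u x)" by (auto simp: restrict0_def)
  have zU: "scaleC z ?U = l2_of (restrict0 I (\<lambda>x. z * u x))"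
    by (simp add: l2_of_scaleC[OF s] r)
  have szu: "square_integrable (restrict0 I (\<lambda>x. z * u x))"
    using square_integrable_scale[OF s, of z] by (simp add: r)
  let ?S = "{(l2_of (restrict0 I y), l2_of (restrict0 I h)) | y h.
     sl_expr q I y h \<and> square_integrable (restrict0 I y) \<and> square_integrable (restrict0 I h) \<and>
     (\<exists>K. compact K \<and> K \<subseteq> I \<and> (\<forall>x\<in>I - K. y x = 0))}"
  let ?C = "{p. cinner (snd p) ?U = cinner (fst p) (scaleC z ?U)}"
  have "closed ?C"
    by (intro closed_Collect_eq bounded_bilinear.continuous_on[OF bounded_bilinear_cinner] continuous_intros)
  moreover have "?S \<subseteq> ?C"
  proof clarsimp
    fix f k K
    assume e: "sl_expr q I f k" and sf: "square_integrable (restrict0 I f)" and sk: "square_integrable (restrict0 I k)"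
      and K: "compact K" "K \<subseteq> I" "\<forall>x\<in>I - K. f x = 0"
    let ?w = "\<lambda>x. cnj (u x)"
    define \<phi> where "\<phi> x = restrict0 I k x * cnj (restrict0 I u x) - restrict0 I f x * cnj (restrict0 I (\<lambda>x. z * u x) x)" for x
    have int: "integrable lebesgue (\<lambda>x. restrict0 I k x * cnj (restrict0 I u x))"
      "integrable lebesgue (\<lambda>x. restrict0 I f x * cnj (restrict0 I (\<lambda>x. z * u x) x))"
      by (intro square_integrable_mult s sk sf szu)+
    then have \<phi>: "integrable lebesgue \<phi>" unfolding \<phi>_def by (rule Bochner_Integration.integrable_diff)
    have "\<forall>\<^sub>F n in sequentially. (\<integral>x. indicat_real {\<alpha> n..\<beta> n} x *\<^sub>R \<phi> x \<partial>lebesgue) = 0"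
    proof -
      have "\<forall>\<^sub>F n in sequentially. I \<noteq> {} \<longrightarrow> (\<exists>p r. \<alpha> n < p \<and> p \<le> r \<and> r < \<beta> n \<and> K \<subseteq> {p..r})"
      proof (cases "K = {}")
        case True
        show ?thesis
        proof (cases "I = {}")
          case False
          then obtain x where "x \<in> I" by blast
          from exh(2)[OF this] show ?thesis
            by eventually_elim (use True in auto)
        qed simp
      next
        case False
        have "Inf K \<in> K" "Sup K \<in> K"
          by (intro closed_contains_Inf closed_contains_Sup False bounded_imp_bdd_below bounded_imp_bdd_above
              compact_imp_bounded compact_imp_closed K(1))+
        then have "Inf K \<in> I" "Sup K \<in> I" using K(2) by auto
        from exh(2)[OF this(1)] exh(2)[OF this(2)] show ?thesis
        proof eventually_elim
          case (elim n)
          have "K \<subseteq> {Inf K..Sup K}"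
            using K(1) by (auto intro!: cInf_lower cSup_upper bounded_imp_bdd_below bounded_imp_bdd_above compact_imp_bounded)
          moreover have "Inf K \<le> Sup K" using calculation False by fastforce
          ultimately show ?case using elim by blast
        qed
      qed
      then show ?thesis
      proof eventually_elim
        case (elim n)
        show ?case
        proof (cases "I = {}")
          case True
          then show ?thesis by (simp add: \<phi>_def restrict0_def)
        next
          case False
          then obtain p r where pr: "\<alpha> n < p" "p \<le> r" "r < \<beta> n" "K \<subseteq> {p..r}" using elim by blast
          have "((\<lambda>x. k x * ?w x - f x * (cnj z * ?w x)) has_integral 0) {\<alpha> n..\<beta> n}"
            by (rule green_compact_support[OF q e pr(1-3) exh(1) _ sl_solves_cnj[OF u]]) (use K pr in auto)
          then have "(\<phi> has_integral 0) {\<alpha> n..\<beta> n}"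
            by (rule has_integral_eq[rotated]) (use exh(1)[of n] in \<open>auto simp: \<phi>_def restrict0_def\<close>)
          moreover have "\<phi> absolutely_integrable_on {\<alpha> n..\<beta> n}"
            unfolding set_integrable_def by (rule integrable_mult_indicator[OF _ \<phi>]) simp
          ultimately show ?thesis
            using set_lebesgue_integral_eq_integral(2)[of "{\<alpha> n..\<beta> n}" \<phi>]
            by (simp add: integral_unique set_lebesgue_integral_def)
        qed
      qed
    qed
    then have "(\<lambda>n. \<integral>x. indicat_real {\<alpha> n..\<beta> n} x *\<^sub>R \<phi> x \<partial>lebesgue) \<longlonglongrightarrow> 0"
      by (rule tendsto_eventually)
    moreover have "(\<lambda>n. \<integral>x. indicat_real {\<alpha> n..\<beta> n} x *\<^sub>R \<phi> x \<partial>lebesgue) \<longlonglongrightarrow> (\<integral>x. \<phi> x \<partial>lebesgue)"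
    proof (rule integral_dominated_convergence[where w = "\<lambda>x. cmod (\<phi> x)"])
      show "\<phi> \<in> borel_measurable lebesgue" using \<phi> by (rule borel_measurable_integrable)
      then show "(\<lambda>x. indicat_real {\<alpha> n..\<beta> n} x *\<^sub>R \<phi> x) \<in> borel_measurable lebesgue" for n
        by (intro borel_measurable_scaleR borel_measurable_indicator) auto
      show "integrable lebesgue (\<lambda>x. cmod (\<phi> x))" using \<phi> by (rule integrable_norm)
      show "AE x in lebesgue. norm (indicat_real {\<alpha> n..\<beta> n} x *\<^sub>R \<phi> x) \<le> cmod (\<phi> x)" for n
        by (auto simp: indicator_def)
      show "AE x in lebesgue. (\<lambda>n. indicat_real {\<alpha> n..\<beta> n} x *\<^sub>R \<phi> x) \<longlonglongrightarrow> \<phi> x"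
      proof (rule AE_I2)
        fix x
        show "(\<lambda>n. indicat_real {\<alpha> n..\<beta> n} x *\<^sub>R \<phi> x) \<longlonglongrightarrow> \<phi> x"
        proof (cases "x \<in> I")
          case True
          show ?thesis
            by (rule tendsto_eventually, rule eventually_mono[OF exh(2)[OF True]]) (auto simp: indicator_def)
        qed (simp add: \<phi>_def restrict0_def)
      qed
    qed
    ultimately have "(\<integral>x. \<phi> x \<partial>lebesgue) = 0" using LIMSEQ_unique by blast
    then show "cinner (l2_of (restrict0 I k)) ?U = cinner (l2_of (restrict0 I f)) (scaleC z ?U)"
      unfolding zU cinner_l2_of[OF sk s] cinner_l2_of[OF sf szu] \<phi>_def
      using Bochner_Integration.integral_diff[OF int] by simp
  qed
  ultimately have "sl_min q I \<subseteq> ?C"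
    unfolding sl_min_def by (rule closure_minimal[rotated])
  moreover have "?U \<in> L2_on I" "scaleC z ?U \<in> L2_on I"
    unfolding zU using s szu by (auto simp: L2_on_def)
  ultimately show ?thesis
    unfolding adjoint_in_def by auto
qed

lemma AE_zero_continuous_imp_zero:
  fixes g :: "real \<Rightarrow> complex"
  assumes "continuous_on UNIV g" "open I" "AE x in lebesgue. x \<in> I \<longrightarrow> g x = 0" "x \<in> I"
  shows "g x = 0"
proof (rule ccontr)
  assume g: "g x \<noteq> 0"
  let ?S = "{y. g y \<noteq> 0} \<inter> I"
  have "open ?S" using assms by (intro open_Int open_Collect_neq continuous_intros) auto
  moreover have "negligible ?S"
    unfolding negligible_iff_null_sets
    using assms(3) by (subst AE_iff_null_sets) (use \<open>open ?S\<close> in \<open>auto elim!: eventually_mono\<close>)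
  ultimately show False using open_not_negligible[of ?S] assms(4) g by auto
qed

text \<open>If \<open>s\<close> and \<open>c\<close> are both square integrable, some nontrivial combination of them vanishes almost
  everywhere on \<open>I\<close>, hence everywhere on \<open>I\<close> together with its derivative, contradicting that the
  Wronskian is nonzero.\<close>

lemma deficiency_one_not_both:
  assumes q: "continuous_on UNIV q" and I: "open I" "I \<noteq> {}"
    and exh: "\<And>n. {\<alpha> n..\<beta> n} \<subseteq> I" "\<And>x. x \<in> I \<Longrightarrow> \<forall>\<^sub>F n in sequentially. \<alpha> n < x \<and> x < \<beta> n"
    and def1: "deficiency_index (L2_on I) (sl_min q I) z = 1"
  shows "\<not> (square_integrable (restrict0 I (\<lambda>x. sl_s q x z)) \<and> square_integrable (restrict0 I (\<lambda>x. sl_c q x z)))"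
proof
  assume "square_integrable (restrict0 I (\<lambda>x. sl_s q x z)) \<and> square_integrable (restrict0 I (\<lambda>x. sl_c q x z))"
  then have s: "square_integrable (restrict0 I (sl_sol q z 0 1))" and c: "square_integrable (restrict0 I (sl_sol q z 1 0))"
    by (simp_all add: sl_s_def[abs_def] sl_c_def[abs_def])
  let ?S = "l2_of (restrict0 I (sl_sol q z 0 1))" and ?C = "l2_of (restrict0 I (sl_sol q z 1 0))"
  define V where "V = {g. (g, scaleC z g) \<in> adjoint_in (L2_on I) (sl_min q I)}"
  have "?S \<in> V" "?C \<in> V"
    unfolding V_def using solution_in_adjoint_sl_min[OF q exh sl_sol(1)[OF q]] s c by auto
  \<comment> \<open>In the absence of a finite basis \<open>l2.dim\<close> is \<open>0\<close>, so the value \<open>1\<close> provides a basis with one element.\<close>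
  obtain B where B: "l2.independent B" "l2.span B = l2.span V" "card B = 1"
  proof -
    have d: "l2.dim V = 1" using def1 by (simp add: deficiency_index_def V_def)
    then have "\<exists>b. l2.independent b \<and> l2.span b = l2.span V"
      unfolding l2.dim_def by (metis zero_neq_one)
    then show ?thesis using that d l2.dim_eq_card by metis
  qed
  obtain b where "B = {b}" using B(3) by (auto simp: card_1_singleton_iff)
  then have "V \<subseteq> range (\<lambda>k. scaleC k b)"
    using B(2) l2.span_superset[of V] by (simp add: l2.span_singleton)
  then obtain \<sigma> \<gamma> where \<sigma>: "?S = scaleC \<sigma> b" and \<gamma>: "?C = scaleC \<gamma> b"
    using \<open>?S \<in> V\<close> \<open>?C \<in> V\<close> by (metis (no_types, lifting) imageE subsetD)
  obtain a a' where a: "(a, a') \<noteq> (0, 0)" "scaleC a ?S + scaleC a' ?C = 0"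
  proof (cases "\<gamma> = 0 \<and> \<sigma> = 0")
    case True
    then show ?thesis using that[of 1 0] by (simp add: \<sigma> \<gamma>)
  next
    case False
    then show ?thesis using that[of \<gamma> "- \<sigma>"]
      by (auto simp: \<sigma> \<gamma> mult.commute simp flip: l2.scale_left_distrib)
  qed
  define u where "u x = a * sl_sol q z 0 1 x + a' * sl_sol q z 1 0 x" for x
  define u' where "u' x = a * sl_sol' q z 0 1 x + a' * sl_sol' q z 1 0 x" for x
  have u: "sl_solves q z u u'" unfolding u_def u'_def by (intro sl_solves_lincomb sl_sol(1)[OF q])
  have e: "(\<lambda>x. a * restrict0 I (sl_sol q z 0 1) x + a' * restrict0 I (sl_sol q z 1 0) x) = restrict0 I u"
    by (auto simp: restrict0_def u_def)
  have su: "square_integrable (restrict0 I u)"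
    unfolding e[symmetric] by (intro square_integrable_add square_integrable_scale s c)
  have "l2_of (restrict0 I u) = 0"
    using a(2) by (simp add: l2_of_scaleC s c l2_of_add square_integrable_scale e)
  then have "AE x in lebesgue. restrict0 I u x = 0"
    using su square_integrable_0 by (simp add: zero_l2_def l2_of_eq_iff)
  then have "AE x in lebesgue. x \<in> I \<longrightarrow> u x = 0" by eventually_elim (auto simp: restrict0_def)
  then have u0: "u x = 0" if "x \<in> I" for x
    using AE_zero_continuous_imp_zero[OF sl_solves_continuous(1)[OF u] I(1) _ that] by blast
  obtain x where x: "x \<in> I" using I by blast
  have z: "u x = 0" "u' x = 0" using sl_solves_zero_on_open[OF u I(1) x u0] by auto
  have W: "sl_sol' q z 0 1 x * sl_sol q z 1 0 x - sl_sol q z 0 1 x * sl_sol' q z 1 0 x = 1"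
    using wronskian_constant[OF sl_sol(1)[OF q, of z 0 1] sl_sol(1)[OF q, of z 1 0], of x]
    by (simp add: sl_sol(2,3)[OF q])
  have "a = u' x * sl_sol q z 1 0 x - u x * sl_sol' q z 1 0 x"
    "a' = sl_sol' q z 0 1 x * u x - sl_sol q z 0 1 x * u' x"
    using arg_cong[OF W, of "\<lambda>w. a * w"] arg_cong[OF W, of "\<lambda>w. a' * w"]
    by (simp_all add: u_def u'_def algebra_simps)
  then show False using a(1) z by simp
qed

lemma sl_solves_reflect:
  assumes "sl_solves q z u u'"
  shows "sl_solves (\<lambda>x. q (- x)) z (\<lambda>x. u (- x)) (\<lambda>x. - u' (- x))"
  unfolding sl_solves_def
proof (intro allI conjI)
  fix x :: real
  have m: "(uminus has_vector_derivative - 1) (at x)"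
    by (auto intro!: derivative_eq_intros)
  show "((\<lambda>x. u (- x)) has_vector_derivative - u' (- x)) (at x)"
    using vector_diff_chain_at[OF m, of u "u' (- x)"] sl_solvesD(1)[OF assms, of "- x"] by (simp add: o_def)
  have "((\<lambda>x. u' (- x)) has_vector_derivative - ((of_real (q (- x)) - z) * u (- x))) (at x)"
    using vector_diff_chain_at[OF m, of u' "(of_real (q (- x)) - z) * u (- x)"] sl_solvesD(2)[OF assms, of "- x"] by (simp add: o_def)
  from has_vector_derivative_minus[OF this]
  show "((\<lambda>x. - u' (- x)) has_vector_derivative (of_real (q (- x)) - z) * u (- x)) (at x)" by simp
qed

lemma sl_sol_reflect:
  assumes q: "continuous_on UNIV q"
  shows "sl_sol (\<lambda>x. q (- x)) z a b x = sl_sol q z a (- b) (- x)"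
proof -
  have "continuous_on UNIV (\<lambda>x. q (- x))"
    by (rule continuous_on_compose2[OF q]) (auto intro: continuous_intros)
  from sl_sol_unique(1)[OF this sl_solves_reflect[OF sl_sol(1)[OF q, of z a "- b"]]]
  show ?thesis by (simp add: sl_sol(2,3)[OF q] fun_eq_iff)
qed

lemma square_integrable_reflect:
  assumes [measurable]: "f \<in> borel_measurable borel"
  shows "square_integrable (\<lambda>x. f (- x)) \<longleftrightarrow> square_integrable f"
    and "(\<integral>x. (cmod (f (- x)))\<^sup>2 \<partial>lebesgue) = (\<integral>x. (cmod (f x))\<^sup>2 \<partial>lebesgue)"
proof -
  have m: "(\<lambda>x. f (- x)) \<in> borel_measurable borel" by measurable
  have l: "g \<in> borel_measurable lebesgue" if "g \<in> borel_measurable borel" for g :: "real \<Rightarrow> complex"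
    using that by (intro measurable_completion) simp
  have i: "integrable lebesgue (\<lambda>x. (cmod (g x))\<^sup>2) \<longleftrightarrow> integrable lborel (\<lambda>x. (cmod (g x))\<^sup>2)"
    if [measurable]: "g \<in> borel_measurable borel" for g :: "real \<Rightarrow> complex"
    by (rule integrable_completion) simp
  show "square_integrable (\<lambda>x. f (- x)) \<longleftrightarrow> square_integrable f"
    unfolding square_integrable_def using l[OF m] l[OF assms] i[OF m] i[OF assms]
      lborel_integrable_real_affine_iff[of "-1" "\<lambda>x. (cmod (f x))\<^sup>2" 0] by simp
  show "(\<integral>x. (cmod (f (- x)))\<^sup>2 \<partial>lebesgue) = (\<integral>x. (cmod (f x))\<^sup>2 \<partial>lebesgue)"
    using lborel_integral_real_affine[of "-1" "\<lambda>x. (cmod (f x))\<^sup>2" 0]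
    by (simp add: integral_completion)
qed

lemma restrict0_half_line_reflect: "restrict0 {..<0} u = (\<lambda>x. restrict0 {0<..} (\<lambda>x. u (- x)) (- x))"
  by (auto simp: restrict0_def)

lemma square_integrable_left:
  assumes u: "continuous_on UNIV u"
  shows "square_integrable (restrict0 {..<0} u) \<longleftrightarrow> square_integrable (restrict0 {0<..} (\<lambda>x. u (- x)))"
    and "(\<integral>x. (cmod (restrict0 {..<0} u x))\<^sup>2 \<partial>lebesgue) = (\<integral>x. (cmod (restrict0 {0<..} (\<lambda>x. u (- x)) x))\<^sup>2 \<partial>lebesgue)"
proof -
  have "continuous_on UNIV (\<lambda>x. u (- x))"
    by (rule continuous_on_compose2[OF u]) (auto intro: continuous_intros)
  then have "restrict0 {0<..} (\<lambda>x. u (- x)) \<in> borel_measurable borel"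
    unfolding restrict0_def by (intro measurable_If_set borel_measurable_continuous_onI) auto
  from square_integrable_reflect[OF this]
  show "square_integrable (restrict0 {..<0} u) \<longleftrightarrow> square_integrable (restrict0 {0<..} (\<lambda>x. u (- x)))"
    "(\<integral>x. (cmod (restrict0 {..<0} u x))\<^sup>2 \<partial>lebesgue) = (\<integral>x. (cmod (restrict0 {0<..} (\<lambda>x. u (- x)) x))\<^sup>2 \<partial>lebesgue)"
    unfolding restrict0_half_line_reflect by auto
qed

lemma eventually_exhaust:
  fixes x :: real
  shows "\<forall>\<^sub>F n in sequentially. x < real n"
    and "0 < x \<Longrightarrow> \<forall>\<^sub>F n in sequentially. 1 / real (Suc n) < x"
proof -
  show "\<forall>\<^sub>F n in sequentially. x < real n"
    using filterlim_real_sequentially by (auto simp: filterlim_at_top_dense)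
  show "\<forall>\<^sub>F n in sequentially. 1 / real (Suc n) < x" if "0 < x"
    using order_tendstoD(2)[OF LIMSEQ_inverse_real_of_nat that] by (simp only: inverse_eq_divide)
qed

lemma limit_point_right:
  assumes q: "continuous_on UNIV q"
    and "deficiency_index (L2_on {0<..}) (sl_min q {0<..}) \<i> = 1"
  shows "limit_point q"
proof (rule limit_pointI[OF q], rule deficiency_one_not_both[OF q _ _ _ _ assms(2), of "\<lambda>n. 1 / real (Suc n)" "\<lambda>n. real n"])
  show "\<forall>\<^sub>F n in sequentially. 1 / real (Suc n) < x \<and> x < real n" if "x \<in> {0<..}" for x
    using eventually_exhaust(2)[of x] eventually_exhaust(1)[of x] that by (intro eventually_conj) auto
qed (auto intro: less_le_trans[of 0 "1 / real (Suc n)" for n])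

text \<open>The reflection \<open>x \<mapsto> - x\<close> carries the left half-line with potential \<open>q\<close> to the right half-line with
  potential \<open>q (- x)\<close>.\<close>

lemma limit_point_left:
  assumes q: "continuous_on UNIV q"
    and "deficiency_index (L2_on {..<0}) (sl_min q {..<0}) \<i> = 1"
  shows "limit_point (\<lambda>x. q (- x))"
proof (rule limit_pointI)
  show "continuous_on UNIV (\<lambda>x. q (- x))"
    by (rule continuous_on_compose2[OF q]) (auto intro: continuous_intros)
  have "\<not> (square_integrable (restrict0 {..<0} (\<lambda>x. sl_s q x \<i>)) \<and> square_integrable (restrict0 {..<0} (\<lambda>x. sl_c q x \<i>)))"
  proof (rule deficiency_one_not_both[OF q _ _ _ _ assms(2), of "\<lambda>n. - real n" "\<lambda>n. - 1 / real (Suc n)"])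
    show "\<forall>\<^sub>F n in sequentially. - real n < x \<and> x < - 1 / real (Suc n)" if "x \<in> {..<0}" for x
    proof -
      have "\<forall>\<^sub>F n in sequentially. - x < real n" "\<forall>\<^sub>F n in sequentially. 1 / real (Suc n) < - x"
        using eventually_exhaust(1)[of "- x"] eventually_exhaust(2)[of "- x"] that by auto
      then show ?thesis by eventually_elim auto
    qed
  qed (auto intro: le_less_trans[of _ "- 1 / real (Suc n)" for n])
  moreover have "continuous_on UNIV (\<lambda>x. sl_s q x \<i>)" "continuous_on UNIV (\<lambda>x. sl_c q x \<i>)"
    unfolding sl_s_def sl_c_def by (rule sl_solves_continuous[OF sl_sol(1)[OF q]])+
  moreover have "sl_s q (- x) \<i> = - sl_s (\<lambda>x. q (- x)) x \<i>" "sl_c q (- x) \<i> = sl_c (\<lambda>x. q (- x)) x \<i>" for x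
  proof -
    have "sl_sol q \<i> 0 (- 1) = (\<lambda>x. - sl_sol q \<i> 0 1 x)"
      using sl_sol_unique(1)[OF q sl_solves_lincomb[OF sl_sol(1)[OF q, of \<i> 0 1] sl_sol(1)[OF q, of \<i> 0 1], of "- 1" 0]]
      by (simp add: sl_sol(2,3)[OF q])
    then show "sl_s q (- x) \<i> = - sl_s (\<lambda>x. q (- x)) x \<i>" "sl_c q (- x) \<i> = sl_c (\<lambda>x. q (- x)) x \<i>"
      by (simp_all add: sl_s_def sl_c_def sl_sol_reflect[OF q])
  qed
  moreover have "square_integrable (restrict0 I (\<lambda>x. - f x)) \<longleftrightarrow> square_integrable (restrict0 I f)" for I f
  proof -
    have "restrict0 I (\<lambda>x. - f x) = (\<lambda>x. - restrict0 I f x)" by (auto simp: restrict0_def)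
    then show ?thesis
      using square_integrable_uminus[of "restrict0 I f"] square_integrable_uminus[of "\<lambda>x. - restrict0 I f x"] by auto
  qed
  ultimately show "\<not> (square_integrable (restrict0 {0<..} (\<lambda>x. sl_s (\<lambda>x. q (- x)) x \<i>)) \<and> square_integrable (restrict0 {0<..} (\<lambda>x. sl_c (\<lambda>x. q (- x)) x \<i>)))"
    by (simp add: square_integrable_left)
qed

section \<open>The resolvent estimate and the Weyl functions\<close>

text \<open>For symmetric \<open>T\<close> the imaginary part of \<open>\<langle>(T - z) u, u\<rangle>\<close> is \<open>- Im z \<parallel>u\<parallel>\<^sup>2\<close>, which yields the bound
  with constant \<open>1\<close>; the similarity costs the factor \<open>\<parallel>V\<parallel> \<parallel>V\<^sup>-\<^sup>1\<parallel>\<close>.\<close>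

lemma similar_selfadjoint_resolvent_bound:
  assumes T: "selfadjoint T" and sim: "similar A T"
  obtains K where "0 \<le> K" "\<And>f g z. (f, g) \<in> A \<Longrightarrow> \<bar>Im z\<bar> * norm f \<le> K * norm (g - scaleC z f)"
proof -
  obtain V where V: "Vector_Spaces.linear scaleC scaleC V" "bij V" "bounded_linear V" "bounded_linear (inv V)"
    and TV: "T = {(V f, V g) | f g. (f, g) \<in> A}"
    using sim unfolding similar_def by blast
  interpret V: Vector_Spaces.linear scaleC scaleC V by (rule V(1))
  obtain B where B: "0 < B" "\<And>x. norm (V x) \<le> norm x * B"
    using bounded_linear.pos_bounded[OF V(3)] by blast
  obtain C where C: "0 < C" "\<And>x. norm (inv V x) \<le> norm x * C"
    using bounded_linear.pos_bounded[OF V(4)] by blast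
  have "\<bar>Im z\<bar> * norm f \<le> (B * C) * norm (g - scaleC z f)" if fg: "(f, g) \<in> A" for f g z
  proof -
    let ?u = "V f" and ?v = "V g"
    have uv: "(?u, ?v) \<in> T" using TV fg by blast
    then have "(?u, ?v) \<in> adjoint_in UNIV T" using T by (simp add: selfadjoint_def)
    then have "cinner ?v ?u = cinner ?u ?v" using uv unfolding adjoint_in_def by blast
    then have "Im (cinner ?v ?u) = 0"
      using arg_cong[OF cinner_commute[of ?v ?u], of Im] by simp
    then have "Im (cinner (?v - scaleC z ?u) ?u) = - (Im z * (norm ?u)\<^sup>2)"
      by (simp add: cinner_diff_left cinner_scaleC_left cinner_self)
    then have "\<bar>Im z\<bar> * (norm ?u)\<^sup>2 = \<bar>Im (cinner (?v - scaleC z ?u) ?u)\<bar>"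
      by (simp add: abs_mult)
    also have "\<dots> \<le> norm (?v - scaleC z ?u) * norm ?u"
      using abs_Im_le_cmod cmod_cinner_le by (rule order_trans)
    finally have "(\<bar>Im z\<bar> * norm ?u) * norm ?u \<le> norm (?v - scaleC z ?u) * norm ?u"
      by (simp add: power2_eq_square mult.assoc)
    then have 1: "\<bar>Im z\<bar> * norm ?u \<le> norm (?v - scaleC z ?u)"
      by (cases "norm ?u = 0") (auto dest: mult_right_le_imp_le)
    have "?v - scaleC z ?u = V (g - scaleC z f)" by (simp add: V.diff V.scale)
    then have 2: "norm (?v - scaleC z ?u) \<le> norm (g - scaleC z f) * B" using B(2) by simp
    have "norm f \<le> norm ?u * C" using C(2)[of ?u] V(2) by (simp add: bij_is_inj)
    then have "\<bar>Im z\<bar> * norm f \<le> \<bar>Im z\<bar> * (norm ?u * C)" by (rule mult_left_mono) simp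
    also have "\<dots> \<le> (norm (g - scaleC z f) * B) * C"
      using order_trans[OF 1 2] C(1) by (simp add: mult.assoc[symmetric])
    finally show ?thesis by (simp add: mult_ac)
  qed
  then show ?thesis using B(1) C(1) by (intro that[of "B * C"]) auto
qed

lemma ac_deriv_glue:
  fixes a b a' b' :: "real \<Rightarrow> complex"
  assumes a: "\<And>x. (a has_vector_derivative a' x) (at x)" "continuous_on UNIV a'"
    and b: "\<And>x. (b has_vector_derivative b' x) (at x)" "continuous_on UNIV b'"
    and 0: "a 0 = b 0"
  shows "ac_deriv UNIV (\<lambda>x. if 0 \<le> x then a x else b x) (\<lambda>x. if 0 \<le> x then a' x else b' x)"
  unfolding ac_deriv_def
proof (intro ballI impI conjI)
  fix l r :: real assume lr: "l \<le> r"
  have "set_integrable lebesgue ({l..r} \<inter> {0..}) a'" "set_integrable lebesgue ({l..r} \<inter> {..<0}) b'"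
    by (rule set_integrable_subset[of _ "{l..r}"],
        rule absolutely_integrable_continuous_real, auto intro: continuous_on_subset a(2) b(2))+
  then have "integrable lebesgue (\<lambda>x. indicat_real ({l..r} \<inter> {0..}) x *\<^sub>R a' x + indicat_real ({l..r} \<inter> {..<0}) x *\<^sub>R b' x)"
    unfolding set_integrable_def by (rule Bochner_Integration.integrable_add)
  moreover have "(\<lambda>x. indicat_real ({l..r} \<inter> {0..}) x *\<^sub>R a' x + indicat_real ({l..r} \<inter> {..<0}) x *\<^sub>R b' x)
      = (\<lambda>x. indicat_real {l..r} x *\<^sub>R (if 0 \<le> x then a' x else b' x))"
    by (auto simp: indicator_def)
  ultimately show "(\<lambda>x. if 0 \<le> x then a' x else b' x) absolutely_integrable_on {l..r}"
    by (simp add: set_integrable_def)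
  let ?y = "\<lambda>x. if 0 \<le> x then a x else b x"
  show "((\<lambda>x. if 0 \<le> x then a' x else b' x) has_integral ?y r - ?y l) {l..r}"
  proof (rule fundamental_theorem_of_calculus_interior_strong[of "{0}"])
    have "continuous_on UNIV a" "continuous_on UNIV b"
      using a(1) b(1) by (auto simp: continuous_on_eq_continuous_at intro: has_vector_derivative_continuous)
    then have "continuous_on ({0..} \<union> {..0}) (\<lambda>x. if x \<in> {0..} then a x else b x)"
      using 0 by (intro continuous_on_If) (auto intro: continuous_on_subset)
    moreover have "{0..} \<union> {..0} = (UNIV :: real set)" by auto
    ultimately have "continuous_on UNIV ?y" by simp
    then show "continuous_on {l..r} ?y" by (rule continuous_on_subset) simp
    fix x assume x: "x \<in> {l<..<r} - {0}"
    show "(?y has_vector_derivative (if 0 \<le> x then a' x else b' x)) (at x)"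
    proof (cases "0 < x")
      case True
      show ?thesis
        by (rule has_vector_derivative_transform_within_open[where S = "{0<..}" and f = a]) (use a True in auto)
    next
      case False
      show ?thesis
        by (rule has_vector_derivative_transform_within_open[where S = "{..<0}" and f = b]) (use b False x in auto)
    qed
  qed (use lr in auto)
qed

text \<open>The reflection \<open>x \<mapsto> - x\<close> maps \<open>c\<close> to \<open>c\<close> and \<open>s\<close> to \<open>- s\<close>, which accounts for the signs.\<close>

lemma m_minus_eq:
  assumes q: "continuous_on UNIV q"
  shows "m_minus q z = m_plus (\<lambda>x. q (- x)) z"
    and "weyl_sol (\<lambda>x. q (- x)) z m (- x) = - (sl_s q x z + m * sl_c q x z)"
proof -
  have q': "continuous_on UNIV (\<lambda>x. q (- x))"
    by (rule continuous_on_compose2[OF q]) (auto intro: continuous_intros)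
  have e: "weyl_sol (\<lambda>x. q (- x)) z m (- x) = - (sl_s q x z + m * sl_c q x z)" for m x
  proof -
    have "weyl_sol (\<lambda>x. q (- x)) z m (- x) = sl_sol q z (- m) (- 1) x"
      unfolding weyl_sol_def by (simp add: sl_sol_reflect[OF q])
    also have "sl_sol q z (- m) (- 1) = (\<lambda>x. - 1 * sl_sol q z 0 1 x + - m * sl_sol q z 1 0 x)"
      using sl_sol_unique(1)[OF q sl_solves_lincomb[OF sl_sol(1)[OF q, of z 0 1] sl_sol(1)[OF q, of z 1 0], of "- 1" "- m"]]
      by (simp add: sl_sol(2,3)[OF q])
    finally show ?thesis by (simp add: sl_s_def sl_c_def)
  qed
  show "weyl_sol (\<lambda>x. q (- x)) z m (- x) = - (sl_s q x z + m * sl_c q x z)" by (rule e)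
  have "square_integrable (restrict0 {..<0} (\<lambda>x. sl_s q x z + m * sl_c q x z))
      \<longleftrightarrow> square_integrable (restrict0 {0<..} (\<lambda>x. sl_s (\<lambda>x. q (- x)) x z - m * sl_c (\<lambda>x. q (- x)) x z))" for m
  proof -
    have "continuous_on UNIV (\<lambda>x. sl_s q x z + m * sl_c q x z)"
      unfolding sl_s_def sl_c_def by (intro continuous_intros sl_solves_continuous[OF sl_sol(1)[OF q]])
    from square_integrable_left(1)[OF this]
    have "square_integrable (restrict0 {..<0} (\<lambda>x. sl_s q x z + m * sl_c q x z)) \<longleftrightarrow>
      square_integrable (restrict0 {0<..} (\<lambda>x. sl_s q (- x) z + m * sl_c q (- x) z))" .
    also have "restrict0 {0<..} (\<lambda>x. sl_s q (- x) z + m * sl_c q (- x) z) = (\<lambda>x. - restrict0 {0<..} (weyl_sol (\<lambda>x. q (- x)) z m) x)"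
      using e[of m "- x" for x] by (auto simp: restrict0_def)
    also have "square_integrable \<dots> \<longleftrightarrow> square_integrable (restrict0 {0<..} (weyl_sol (\<lambda>x. q (- x)) z m))"
      using square_integrable_uminus[of "restrict0 {0<..} (weyl_sol (\<lambda>x. q (- x)) z m)"]
        square_integrable_uminus[of "\<lambda>x. - restrict0 {0<..} (weyl_sol (\<lambda>x. q (- x)) z m) x"] by auto
    finally show ?thesis by (simp add: weyl_sol_eq[OF q'])
  qed
  then show "m_minus q z = m_plus (\<lambda>x. q (- x)) z"
    unfolding m_minus_def m_plus_def by simp
qed

lemma norm_cnj_l2:
  assumes "square_integrable f"
  shows "square_integrable (\<lambda>x. cnj (f x))" "norm (l2_of (\<lambda>x. cnj (f x))) = norm (l2_of f)"
proof -
  have [measurable]: "f \<in> borel_measurable lebesgue" using assms by (simp add: square_integrable_def)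
  have "cnj \<in> borel_measurable borel"
    by (intro borel_measurable_continuous_onI continuous_intros)
  then have "(\<lambda>x. cnj (f x)) \<in> borel_measurable lebesgue" by measurable
  then show s: "square_integrable (\<lambda>x. cnj (f x))" using assms by (simp add: square_integrable_def)
  have "(norm (l2_of (\<lambda>x. cnj (f x))))\<^sup>2 = (norm (l2_of f))\<^sup>2"
    by (simp add: norm_l2_of_square s assms)
  then show "norm (l2_of (\<lambda>x. cnj (f x))) = norm (l2_of f)" by (simp add: power2_eq_iff_nonneg)
qed

text \<open>Adding multiples of \<open>u - cnj u\<close> and \<open>v - cnj v\<close> changes the values at \<open>0\<close> but not the derivatives,
  so the hypothesis \<open>glue\<close> is all that is required for a continuously differentiable function on the
  line. On the half-lines \<open>u\<close>, \<open>v\<close> satisfy \<open>A y = z y\<close> and their conjugates \<open>A y = cnj z y\<close>; only the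
  conjugates survive in \<open>(A - z) f\<close>.\<close>

lemma glued_solution_in_sl_A:
  assumes q: "continuous_on UNIV q"
    and u: "sl_solves q z u u'" "square_integrable (restrict0 {0<..} u)"
    and v: "sl_solves q (- z) v v'" "square_integrable (restrict0 {..<0} v)"
    and der: "u' 0 = 1" "v' 0 = 1"
    and glue: "u 0 + \<kappa> * (u 0 - cnj (u 0)) = v 0 + \<mu> * (v 0 - cnj (v 0))"
  defines "P \<equiv> l2_of (restrict0 {0<..} u)" and "P' \<equiv> l2_of (\<lambda>x. cnj (restrict0 {0<..} u x))"
    and "N \<equiv> l2_of (restrict0 {..<0} v)" and "N' \<equiv> l2_of (\<lambda>x. cnj (restrict0 {..<0} v x))"
  obtains f g where "(f, g) \<in> sl_A q"
    "f = (P + scaleC \<kappa> (P - P')) + (N + scaleC \<mu> (N - N'))"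
    "g - scaleC z f = scaleC (z - cnj z) (scaleC \<kappa> P' + scaleC \<mu> N')"
proof -
  define a where "a x = (1 + \<kappa>) * u x + (- \<kappa>) * cnj (u x)" for x
  define a' where "a' x = (1 + \<kappa>) * u' x + (- \<kappa>) * cnj (u' x)" for x
  define a'' where "a'' x = (1 + \<kappa>) * ((of_real (q x) - z) * u x) + (- \<kappa>) * ((of_real (q x) - cnj z) * cnj (u x))" for x
  define b where "b x = (1 + \<mu>) * v x + (- \<mu>) * cnj (v x)" for x
  define b' where "b' x = (1 + \<mu>) * v' x + (- \<mu>) * cnj (v' x)" for x
  define b'' where "b'' x = (1 + \<mu>) * ((of_real (q x) - (- z)) * v x) + (- \<mu>) * ((of_real (q x) - (- cnj z)) * cnj (v x))" for x
  have u2: "sl_solves q (cnj z) (\<lambda>x. cnj (u x)) (\<lambda>x. cnj (u' x))" by (rule sl_solves_cnj[OF u(1)])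
  have v2: "sl_solves q (- cnj z) (\<lambda>x. cnj (v x)) (\<lambda>x. cnj (v' x))" using sl_solves_cnj[OF v(1)] by simp
  have ad: "(a has_vector_derivative a' x) (at x)" "(a' has_vector_derivative a'' x) (at x)"
    "(b has_vector_derivative b' x) (at x)" "(b' has_vector_derivative b'' x) (at x)" for x
    unfolding a_def a'_def a''_def b_def b'_def b''_def
    by (intro has_vector_derivative_add has_vector_derivative_mult_right
        sl_solvesD[OF u(1)] sl_solvesD[OF v(1)] sl_solvesD[OF u2] sl_solvesD[OF v2])+
  note uc = sl_solves_continuous[OF u(1)] and vc = sl_solves_continuous[OF v(1)]
  have ac: "continuous_on UNIV a'" "continuous_on UNIV a''" "continuous_on UNIV b'" "continuous_on UNIV b''"
    unfolding a'_def a''_def b'_def b''_def by (intro continuous_intros uc vc q)+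
  define y where "y x = (if 0 \<le> x then a x else b x)" for x
  define y1 where "y1 x = (if 0 \<le> x then a' x else b' x)" for x
  define y2 where "y2 x = (if 0 \<le> x then a'' x else b'' x)" for x
  define h where "h x = - y2 x + of_real (q x) * y x" for x
  have g0: "a 0 = b 0" "a' 0 = b' 0"
    using glue by (simp_all add: a_def b_def a'_def b'_def der algebra_simps)
  have expr: "sl_expr q UNIV y h"
    unfolding sl_expr_def
    by (rule exI[of _ y1], rule exI[of _ y2])
       (simp add: h_def, unfold y_def[abs_def] y1_def[abs_def] y2_def[abs_def], intro conjI ac_deriv_glue ad ac g0)
  let ?p = "restrict0 {0<..} u" and ?n = "restrict0 {..<0} v"
  let ?p' = "\<lambda>x. cnj (restrict0 {0<..} u x)" and ?n' = "\<lambda>x. cnj (restrict0 {..<0} v x)"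
  have si: "square_integrable ?p" "square_integrable ?n" "square_integrable ?p'" "square_integrable ?n'"
    using u(2) v(2) norm_cnj_l2 by auto
  define Y where "Y x = (?p x + \<kappa> * (?p x - ?p' x)) + (?n x + \<mu> * (?n x - ?n' x))" for x
  define R where "R x = (z - cnj z) * (\<kappa> * ?p' x + \<mu> * ?n' x)" for x
  define H where "H x = of_real (sgn x) * (z * Y x + R x)" for x
  have sY: "square_integrable Y" and sR: "square_integrable R"
    unfolding Y_def R_def by (intro square_integrable_add square_integrable_scale square_integrable_diff si)+
  have sZ: "square_integrable (\<lambda>x. z * Y x + R x)"
    by (intro square_integrable_add square_integrable_scale sY sR)
  have sgnH: "sgn_mult (l2_of (\<lambda>x. z * Y x + R x)) = l2_of H"
    unfolding H_def by (rule l2_of_sgn_mult[OF sZ])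
  have sgn_si: "square_integrable (\<lambda>x. of_real (sgn x) * f x)" if "square_integrable f" for f
    using rel_funD[OF sgn_mult.rsp, of f f] that by (simp add: l2_eq_def)
  have sH: "square_integrable H" unfolding H_def by (rule sgn_si[OF sZ])
  have yY: "y x = Y x" if "x \<noteq> 0" for x
    using that by (auto simp: y_def Y_def a_def b_def restrict0_def algebra_simps)
  have hH: "h x = H x" if "x \<noteq> 0" for x
    using that by (auto simp: h_def H_def y2_def y_def Y_def R_def a_def a''_def b_def b''_def restrict0_def algebra_simps)
  have sq: "square_integrable f \<and> l2_of f = l2_of g"
    if g: "square_integrable g" and eq: "\<And>x. x \<noteq> 0 \<Longrightarrow> f x = g x" for f g :: "real \<Rightarrow> complex"
  proof -
    have ae: "AE x in lebesgue. f x = g x" using AE_nonzero by eventually_elim (use eq in auto)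
    then have m: "f \<in> borel_measurable lebesgue"
      using g by (intro borel_measurable_AE[of g f]) (auto simp: square_integrable_def elim: eventually_mono)
    have "integrable lebesgue (\<lambda>x. (cmod (f x))\<^sup>2)"
      using g ae m by (subst integrable_cong_AE[of _ _ "\<lambda>x. (cmod (g x))\<^sup>2"])
        (auto simp: square_integrable_def intro!: borel_measurable_power borel_measurable_norm elim: eventually_mono)
    then have "square_integrable f" using m by (simp add: square_integrable_def)
    then show ?thesis using l2_of_eq_iff[OF _ g] ae by blast
  qed
  have y: "square_integrable y" "l2_of y = l2_of Y" using sq[OF sY yY] by auto
  have h: "square_integrable h" "l2_of h = l2_of H" using sq[OF sH hH] by auto
  have r: "restrict0 UNIV f = f" for f by (auto simp: restrict0_def)
  have "(l2_of y, l2_of h) \<in> sl_L q"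
    unfolding sl_L_def sl_max_def r using expr y(1) h(1) by blast
  then have mem: "(l2_of Y, sgn_mult (l2_of H)) \<in> sl_A q"
    unfolding sl_A_def y(2) h(2) by blast
  have "sgn_mult (l2_of H) = l2_of (\<lambda>x. of_real (sgn x) * H x)" by (rule l2_of_sgn_mult[OF sH])
  also have "\<dots> = l2_of (\<lambda>x. z * Y x + R x)"
  proof -
    have "of_real (sgn x) * H x = z * Y x + R x" if "x \<noteq> 0" for x
      using that by (auto simp: H_def sgn_if)
    then show ?thesis using sq[OF sZ, of "\<lambda>x. of_real (sgn x) * H x"] by blast
  qed
  also have "\<dots> = scaleC z (l2_of Y) + l2_of R"
    by (simp add: l2_of_scaleC sY l2_of_add square_integrable_scale sR)
  finally have gz: "sgn_mult (l2_of H) - scaleC z (l2_of Y) = l2_of R" by simp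
  show ?thesis
  proof
    show "(l2_of Y, sgn_mult (l2_of H)) \<in> sl_A q" by (rule mem)
    show "l2_of Y = (P + scaleC \<kappa> (P - P')) + (N + scaleC \<mu> (N - N'))"
      unfolding P_def P'_def N_def N'_def Y_def
      by (simp add: l2_of_scaleC l2_of_add l2_of_diff square_integrable_scale square_integrable_add square_integrable_diff si)
    show "sgn_mult (l2_of H) - scaleC z (l2_of Y) = scaleC (z - cnj z) (scaleC \<kappa> P' + scaleC \<mu> N')"
      unfolding gz R_def P'_def N'_def
      by (simp add: l2_of_scaleC l2_of_add square_integrable_scale square_integrable_add si)
  qed
qed

text \<open>Pairing the vector on the left of \<open>bound\<close> with \<open>P\<close> gives \<open>\<parallel>P\<parallel>\<^sup>2\<close> up to an error of at most
  \<open>2 \<bar>\<kappa>\<bar> \<parallel>P\<parallel>\<^sup>2\<close>, which bounds its norm from below by \<open>(1 - 2 \<bar>\<kappa>\<bar>) \<parallel>P\<parallel>\<close>.\<close>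

lemma gluing_coefficient_bound:
  fixes P P' N :: l2
  assumes bound: "\<bar>Im z\<bar> * norm (P + scaleC \<kappa> (P - P') + N) \<le> K * norm (scaleC (z - cnj z) (scaleC \<kappa> P'))"
    and PN: "cinner N P = 0" and n: "norm P' = norm P" "P \<noteq> 0" and z: "Im z \<noteq> 0" and K: "0 \<le> K"
  shows "1 \<le> 2 * (K + 1) * cmod \<kappa>"
proof -
  have zz: "cmod (z - cnj z) = 2 * \<bar>Im z\<bar>"
    by (simp add: complex_diff_cnj norm_mult)
  have "\<bar>Im z\<bar> * norm (P + scaleC \<kappa> (P - P') + N) \<le> \<bar>Im z\<bar> * (2 * K * cmod \<kappa> * norm P)"
    using bound by (simp add: norm_scaleC norm_mult zz n mult_ac)
  then have le: "norm (P + scaleC \<kappa> (P - P') + N) \<le> 2 * K * cmod \<kappa> * norm P"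
    using z by (simp add: mult_le_cancel_left)
  have "cinner (P + scaleC \<kappa> (P - P') + N) P = of_real ((norm P)\<^sup>2) - - \<kappa> * cinner (P - P') P"
    by (simp add: cinner_add_left cinner_scaleC_left PN cinner_self)
  then have "of_real ((norm P)\<^sup>2) = cinner (P + scaleC \<kappa> (P - P') + N) P - \<kappa> * cinner (P - P') P"
    by simp
  then have "(norm P)\<^sup>2 = cmod (cinner (P + scaleC \<kappa> (P - P') + N) P - \<kappa> * cinner (P - P') P)"
    by (metis norm_of_real abs_of_nonneg zero_le_power2)
  also have "\<dots> \<le> norm (P + scaleC \<kappa> (P - P') + N) * norm P + cmod \<kappa> * (norm (P - P') * norm P)"
    by (intro order_trans[OF norm_triangle_ineq4] add_mono cmod_cinner_le)
       (simp add: norm_mult mult_left_mono cmod_cinner_le)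
  also have "\<dots> \<le> (2 * K * cmod \<kappa> * norm P) * norm P + cmod \<kappa> * ((norm P + norm P') * norm P)"
    by (intro add_mono mult_right_mono mult_left_mono le norm_triangle_ineq4) auto
  also have "\<dots> = (2 * (K + 1) * cmod \<kappa>) * (norm P)\<^sup>2"
    by (simp add: n power2_eq_square algebra_simps)
  finally have "1 * (norm P)\<^sup>2 \<le> (2 * (K + 1) * cmod \<kappa>) * (norm P)\<^sup>2" by simp
  then show ?thesis using n(2) by (simp only: mult_le_cancel_right) auto
qed

lemma M_plus_herglotz:
  assumes q: "continuous_on UNIV q" and lp: "limit_point q"
  shows "M_plus q holomorphic_on {z. Im z \<noteq> 0}"
    and "Im z \<noteq> 0 \<Longrightarrow> Im (M_plus q z) = Im z * (norm (weyl_vector q z))\<^sup>2"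
  using nevanlinna_kernel_holomorphic[of "m_plus q" "weyl_vector q", OF m_plus_kernel[OF q lp]]
    nevanlinna_kernel_Im[of "m_plus q" "weyl_vector q", OF m_plus_kernel[OF q lp]]
  by (auto simp: M_plus_def[abs_def])

lemma continuous_reflect: "continuous_on UNIV q \<Longrightarrow> continuous_on UNIV (\<lambda>x. q (- x))"
  for q :: "real \<Rightarrow> 'a::topological_space"
  by (rule continuous_on_compose2[of UNIV q]) (auto intro: continuous_intros)

lemma M_minus_herglotz:
  assumes q: "continuous_on UNIV q" and lp: "limit_point (\<lambda>x. q (- x))"
  shows "M_minus q holomorphic_on {z. Im z \<noteq> 0}"
    and "Im z \<noteq> 0 \<Longrightarrow> Im (M_minus q z) = Im z * (norm (weyl_vector (\<lambda>x. q (- x)) (- z)))\<^sup>2"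
proof -
  let ?q = "\<lambda>x. q (- x)"
  have ker: "M_minus q \<zeta> - cnj (M_minus q z) = (\<zeta> - cnj z) * cinner (weyl_vector ?q (- \<zeta>)) (weyl_vector ?q (- z))"
    if "Im z \<noteq> 0" "Im \<zeta> \<noteq> 0" for z \<zeta>
  proof -
    have "m_plus ?q (- \<zeta>) - cnj (m_plus ?q (- z)) = (- \<zeta> - cnj (- z)) * cinner (weyl_vector ?q (- \<zeta>)) (weyl_vector ?q (- z))"
      by (rule m_plus_kernel[OF continuous_reflect[OF q] lp]) (use that in auto)
    then show ?thesis by (simp add: M_minus_def m_minus_eq[OF q] algebra_simps)
  qed
  show "M_minus q holomorphic_on {z. Im z \<noteq> 0}"
    "Im z \<noteq> 0 \<Longrightarrow> Im (M_minus q z) = Im z * (norm (weyl_vector ?q (- z)))\<^sup>2"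
    using nevanlinna_kernel_holomorphic[of "M_minus q" "\<lambda>z. weyl_vector ?q (- z)", OF ker]
      nevanlinna_kernel_Im[of "M_minus q" "\<lambda>z. weyl_vector ?q (- z)", OF ker] by auto
qed

text \<open>For each of the two bounds the gluing coefficient on one half-line is \<open>0\<close>, and the other is the
  quotient of \<open>M\<^sub>+ - M\<^sub>-\<close> and \<open>\<plusminus> 2 \<i> Im M\<close>. The resolvent bound keeps this coefficient away from \<open>0\<close>.\<close>

lemma weyl_ratio_bounds:
  assumes q: "continuous_on UNIV q" and lp: "limit_point q" "limit_point (\<lambda>x. q (- x))"
    and K: "0 \<le> K" "\<And>f g z. (f, g) \<in> sl_A q \<Longrightarrow> \<bar>Im z\<bar> * norm f \<le> K * norm (g - scaleC z f)"
    and z: "Im z \<noteq> 0"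
  shows "\<bar>Im (M_plus q z)\<bar> \<le> (K + 1) * cmod (M_plus q z - M_minus q z)"
    and "\<bar>Im (M_minus q z)\<bar> \<le> (K + 1) * cmod (M_plus q z - M_minus q z)"
proof -
  let ?q = "\<lambda>x. q (- x)"
  have q': "continuous_on UNIV ?q" by (rule continuous_reflect[OF q])
  have z': "Im (- z) \<noteq> 0" using z by simp
  define F where "F = M_plus q z"
  define G where "G = M_minus q z"
  define u where "u = sl_sol q z (- F) 1"
  define u' where "u' = sl_sol' q z (- F) 1"
  define v where "v = sl_sol q (- z) (- G) 1"
  define v' where "v' = sl_sol' q (- z) (- G) 1"
  have u: "sl_solves q z u u'" "u 0 = - F" "u' 0 = 1" and v: "sl_solves q (- z) v v'" "v 0 = - G" "v' 0 = 1"
    unfolding u_def u'_def v_def v'_def by (simp_all add: sl_sol[OF q])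
  have us: "square_integrable (restrict0 {0<..} u)"
    using m_plus_props(1)[OF q lp(1) z] by (simp add: u_def F_def M_plus_def weyl_sol_def)
  have vr: "restrict0 {0<..} (\<lambda>x. v (- x)) = (\<lambda>x. - restrict0 {0<..} (weyl_sol ?q (- z) (m_plus ?q (- z))) x)"
  proof -
    have "v x = - weyl_sol ?q (- z) (m_plus ?q (- z)) (- x)" for x
    proof -
      have "v = weyl_sol q (- z) G" by (simp add: v_def weyl_sol_def)
      then show ?thesis
        unfolding m_minus_eq(2)[OF q] by (simp add: weyl_sol_eq[OF q] G_def M_minus_def m_minus_eq(1)[OF q])
    qed
    then show ?thesis by (auto simp: restrict0_def)
  qed
  note ws = m_plus_props(1)[OF q' lp(2) z']
  have vc: "continuous_on UNIV v" by (rule sl_solves_continuous[OF v(1)])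
  have vs: "square_integrable (restrict0 {..<0} v)"
    unfolding square_integrable_left(1)[OF vc] vr by (rule square_integrable_uminus[OF ws])
  define P where "P = l2_of (restrict0 {0<..} u)"
  define N where "N = l2_of (restrict0 {..<0} v)"
  define P' where "P' = l2_of (\<lambda>x. cnj (restrict0 {0<..} u x))"
  define N' where "N' = l2_of (\<lambda>x. cnj (restrict0 {..<0} v x))"
  have P: "P = weyl_vector q z"
    by (simp add: P_def weyl_vector_def weyl_sol_def u_def F_def M_plus_def)
  have "(norm N)\<^sup>2 = (norm (weyl_vector ?q (- z)))\<^sup>2"
    unfolding N_def weyl_vector_def norm_l2_of_square[OF vs] norm_l2_of_square[OF ws] square_integrable_left(2)[OF vc] vr
    by simp
  then have nN: "norm N = norm (weyl_vector ?q (- z))" by (simp add: power2_eq_iff_nonneg)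
  have nz: "P \<noteq> 0" "N \<noteq> 0"
    using weyl_vector_nonzero[OF q lp(1) z] weyl_vector_nonzero[OF q' lp(2) z'] nN P by auto
  have n': "norm P' = norm P" "norm N' = norm N"
    unfolding P'_def P_def N'_def N_def by (rule norm_cnj_l2 us vs)+
  have orth: "cinner N P = 0"
  proof -
    have "(\<lambda>x. restrict0 {..<0} v x * cnj (restrict0 {0<..} u x)) = (\<lambda>x. 0)" by (auto simp: restrict0_def)
    then show ?thesis unfolding N_def P_def cinner_l2_of[OF vs us] by simp
  qed
  then have orth': "cinner P N = 0" by (subst cinner_commute) simp
  have im: "Im F \<noteq> 0" "Im G \<noteq> 0"
    using M_plus_herglotz(2)[OF q lp(1) z] M_minus_herglotz(2)[OF q lp(2) z] z nz P nN
    by (auto simp: F_def G_def)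
  have cF: "cnj F - F = - (2 * \<i> * of_real (Im F))" "cnj G - G = - (2 * \<i> * of_real (Im G))"
    by (simp_all add: complex_eq_iff)
  have key: "\<bar>Im z\<bar> * norm ((P + scaleC \<kappa> (P - P')) + (N + scaleC \<mu> (N - N')))
      \<le> K * norm (scaleC (z - cnj z) (scaleC \<kappa> P' + scaleC \<mu> N'))"
    if "- F + \<kappa> * (cnj F - F) = - G + \<mu> * (cnj G - G)" for \<kappa> \<mu>
  proof -
    have glue: "u 0 + \<kappa> * (u 0 - cnj (u 0)) = v 0 + \<mu> * (v 0 - cnj (v 0))"
      using that by (simp add: u v)
    obtain f g where fg: "(f, g) \<in> sl_A q"
      "f = (P + scaleC \<kappa> (P - P')) + (N + scaleC \<mu> (N - N'))"
      "g - scaleC z f = scaleC (z - cnj z) (scaleC \<kappa> P' + scaleC \<mu> N')"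
      unfolding P_def P'_def N_def N'_def
      by (rule glued_solution_in_sl_A[OF q u(1) us v(1) vs u(3) v(3) glue]) blast
    show ?thesis using K(2)[OF fg(1), of z] unfolding fg(3) unfolding fg(2) .
  qed
  have final: "\<bar>Im w\<bar> \<le> (K + 1) * cmod (F - G)"
    if "1 \<le> 2 * (K + 1) * cmod \<kappa>" "\<kappa> * (cnj w - w) = F - G \<or> \<kappa> * (cnj w - w) = G - F" "cnj w - w = - (2 * \<i> * of_real (Im w))" for \<kappa> w
  proof -
    have "cmod \<kappa> * (2 * \<bar>Im w\<bar>) = cmod (\<kappa> * (cnj w - w))" by (simp add: that(3) norm_mult)
    also have "\<dots> = cmod (F - G)" using that(2) norm_minus_commute[of F G] by metis
    finally have e: "cmod \<kappa> * (2 * \<bar>Im w\<bar>) = cmod (F - G)" .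
    have "1 * \<bar>Im w\<bar> \<le> (2 * (K + 1) * cmod \<kappa>) * \<bar>Im w\<bar>"
      using that(1) by (intro mult_right_mono) auto
    also have "\<dots> = (K + 1) * (cmod \<kappa> * (2 * \<bar>Im w\<bar>))" by (simp only: mult_ac)
    finally show ?thesis by (simp add: e)
  qed
  have "\<bar>Im F\<bar> \<le> (K + 1) * cmod (F - G)"
  proof (rule final[of "(F - G) / (cnj F - F)"])
    let ?\<kappa> = "(F - G) / (cnj F - F)"
    have nzF: "cnj F - F \<noteq> 0" using im by (simp add: cF)
    have "\<bar>Im z\<bar> * norm (P + scaleC ?\<kappa> (P - P') + N) \<le> K * norm (scaleC (z - cnj z) (scaleC ?\<kappa> P'))"
      using key[of ?\<kappa> 0] nzF by simp
    then show "1 \<le> 2 * (K + 1) * cmod ?\<kappa>"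
      by (rule gluing_coefficient_bound) (use orth n' nz z K in auto)
    show "?\<kappa> * (cnj F - F) = F - G \<or> ?\<kappa> * (cnj F - F) = G - F" using nzF by simp
  qed (rule cF)
  then show "\<bar>Im (M_plus q z)\<bar> \<le> (K + 1) * cmod (M_plus q z - M_minus q z)" by (simp add: F_def G_def)
  have "\<bar>Im G\<bar> \<le> (K + 1) * cmod (F - G)"
  proof (rule final[of "(G - F) / (cnj G - G)"])
    let ?\<kappa> = "(G - F) / (cnj G - G)"
    have nzG: "cnj G - G \<noteq> 0" using im by (simp add: cF)
    have "\<bar>Im z\<bar> * norm (N + scaleC ?\<kappa> (N - N') + P) \<le> K * norm (scaleC (z - cnj z) (scaleC ?\<kappa> N'))"
      using key[of 0 ?\<kappa>] nzG by (simp add: add.commute)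
    then show "1 \<le> 2 * (K + 1) * cmod ?\<kappa>"
      by (rule gluing_coefficient_bound) (use orth' n' nz z K in auto)
    show "?\<kappa> * (cnj G - G) = F - G \<or> ?\<kappa> * (cnj G - G) = G - F" using nzG by simp
  qed (rule cF)
  then show "\<bar>Im (M_minus q z)\<bar> \<le> (K + 1) * cmod (M_plus q z - M_minus q z)" by (simp add: F_def G_def)
qed

section \<open>Lipschitz functions on the line\<close>

text \<open>Both \<open>G\<close> and \<open>x - G x\<close> are nondecreasing, and their Stieltjes measures add up to Lebesgue measure.
  Hence the measure of \<open>G\<close> is absolutely continuous and has a Radon-Nikodym density.\<close>

lemma lipschitz_monotone_eq_indefinite_integral:
  fixes G :: "real \<Rightarrow> real"
  assumes mono: "\<And>x y. x \<le> y \<Longrightarrow> G x \<le> G y"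
    and lip: "\<And>x y. x \<le> y \<Longrightarrow> G y - G x \<le> y - x"
  obtains f where "\<And>a b. a \<le> b \<Longrightarrow> (f has_integral (G b - G a)) {a..b}"
proof -
  define G' where "G' = (\<lambda>x. x - G x)"
  have mono': "G' x \<le> G' y" if "x \<le> y" for x y
    using lip[OF that] by (simp add: G'_def)
  have cont: "continuous_on UNIV G"
  proof (rule Lipschitz.lipschitz_on_continuous_on[of 1])
    show "1-lipschitz_on UNIV G"
    proof (rule lipschitz_onI)
      fix x y :: real
      show "dist (G x) (G y) \<le> 1 * dist x y"
        using mono[of x y] mono[of y x] lip[of x y] lip[of y x]
        by (cases "x \<le> y") (auto simp: dist_real_def)
    qed simp
  qed
  then have isc: "isCont G x" "isCont G' x" for x
    by (auto simp: G'_def continuous_on_eq_continuous_at intro!: continuous_intros)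
  let ?\<mu> = "interval_measure G" and ?\<nu> = "interval_measure G'"
  have right: "continuous (at_right x) G" "continuous (at_right x) G'" for x
    using isc[of x] by (auto simp: continuous_at_imp_continuous_at_within)
  have Ioo: "emeasure (interval_measure H) {l<..<u} = ennreal (H u - H l)"
    if "l \<le> u" and H: "\<And>x y. x \<le> y \<Longrightarrow> H x \<le> H y" "\<And>x. isCont H x" for H l u
  proof (cases "l = u")
    case False
    have c: "continuous_on UNIV H" using H(2) by (simp add: continuous_on_eq_continuous_at)
    have r: "continuous (at_right x) H" for x
      using H(2)[of x] by (auto simp: continuous_at_imp_continuous_at_within)
    have "{l<..<u} = {l<..u} - {u..u}" using False that(1) by auto
    moreover have "emeasure (interval_measure H) {u..u} = 0"
      by (subst emeasure_interval_measure_Icc) (use H c in \<open>auto intro: continuous_on_subset\<close>)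
    moreover have "emeasure (interval_measure H) {l<..u} = ennreal (H u - H l)"
      by (rule emeasure_interval_measure_Ioc) (use H r that in auto)
    ultimately show ?thesis
      by (metis (no_types, lifting) Diff_cancel emeasure_Diff_null_set null_setsI
          sets_interval_measure atLeastAtMost_borel greaterThanAtMost_borel)
  qed auto
  define S where "S = measure_of UNIV (sets borel) (\<lambda>A. emeasure ?\<mu> A + emeasure ?\<nu> A)"
  have setsS: "sets S = sets borel"
    unfolding S_def by (metis sets.sigma_sets_eq sets_measure_of space_borel subset_UNIV Pow_UNIV)
  have emS: "emeasure S A = emeasure ?\<mu> A + emeasure ?\<nu> A" if "A \<in> sets borel" for A
  proof (rule emeasure_measure_of[OF S_def])
    show "countably_additive (sets S) (\<lambda>A. emeasure ?\<mu> A + emeasure ?\<nu> A)"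
      unfolding countably_additive_def setsS
      by (intro allI impI, subst suminf_add[symmetric])
         (auto simp: suminf_emeasure image_subset_iff)
    show "positive (sets S) (\<lambda>A. emeasure ?\<mu> A + emeasure ?\<nu> A)"
      by (simp add: positive_def)
  qed (use that setsS in auto)
  have lb: "lborel = S"
  proof (rule lborel_eqI)
    fix l u :: real assume "\<And>b. b \<in> Basis \<Longrightarrow> l \<bullet> b \<le> u \<bullet> b"
    then have lu: "l \<le> u" by auto
    have "emeasure S (box l u) = ennreal (G u - G l) + ennreal (G' u - G' l)"
      by (simp add: emS Ioo[OF lu] mono mono' isc box_real)
    also have "\<dots> = ennreal (u - l)"
      using mono[OF lu] mono'[OF lu] by (subst ennreal_plus[symmetric]) (auto simp: G'_def)
    finally show "emeasure S (box l u) = (\<Prod>b\<in>Basis. (u - l) \<bullet> b)" by simp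
  qed (rule setsS)
  have "absolutely_continuous lborel ?\<mu>"
    unfolding absolutely_continuous_def
  proof
    fix A :: "real set" assume A: "A \<in> null_sets lborel"
    then have "A \<in> sets borel" "emeasure S A = 0" using lb by auto
    then show "A \<in> null_sets ?\<mu>" by (auto simp: emS)
  qed
  then obtain h where h[measurable]: "h \<in> borel_measurable lborel" and dens: "density lborel h = ?\<mu>"
    using sigma_finite_measure.Radon_Nikodym[OF sigma_finite_lborel, of ?\<mu>] by auto
  define f where "f x = enn2real (h x)" for x
  have [measurable]: "f \<in> borel_measurable borel" unfolding f_def using h by measurable
  show ?thesis
  proof
    fix a b :: real assume ab: "a \<le> b"
    have e: "(\<integral>\<^sup>+x. h x * indicator {a..b} x \<partial>lborel) = ennreal (G b - G a)"
    proof -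
      have "(\<integral>\<^sup>+x. h x * indicator {a..b} x \<partial>lborel) = emeasure ?\<mu> {a..b}"
        using h by (subst dens[symmetric], subst emeasure_density) auto
      also have "\<dots> = ennreal (G b - G a)"
        by (rule emeasure_interval_measure_Icc) (use ab mono cont in \<open>auto intro: continuous_on_subset\<close>)
      finally show ?thesis .
    qed
    then have "AE x in lborel. h x * indicator {a..b} x \<noteq> \<infinity>"
      by (intro nn_integral_PInf_AE) (use h in auto)
    then have "AE x in lborel. ennreal (f x * indicator {a..b} x) = h x * indicator {a..b} x"
      by eventually_elim (auto simp: f_def indicator_def less_top split: if_splits)
    then have "(\<integral>\<^sup>+x. ennreal (f x * indicator {a..b} x) \<partial>lborel) = ennreal (G b - G a)"
      using e nn_integral_cong_AE by metis
    then have "((\<lambda>x. f x * indicator {a..b} x) has_integral (G b - G a)) UNIV"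
      by (intro nn_integral_has_integral) (auto simp: f_def mono[OF ab])
    moreover have "(\<lambda>x. f x * indicator {a..b} x) = (\<lambda>x. if x \<in> {a..b} then f x else 0)"
      by (auto simp: indicator_def)
    ultimately show "(f has_integral (G b - G a)) {a..b}"
      by (simp only: has_integral_restrict_UNIV)
  qed
qed

lemma indefinite_integral_right_derivative_AE:
  fixes f G :: "real \<Rightarrow> real"
  assumes int: "\<And>a b. a \<le> b \<Longrightarrow> (f has_integral (G b - G a)) {a..b}"
  obtains N where "negligible N"
    "\<And>x. x \<notin> N \<Longrightarrow> ((\<lambda>h. (G (x + h) - G x) / h) \<longlongrightarrow> f x) (at_right 0)"
proof -
  have "f integrable_on cbox a b" for a b
    using int[of a b] by (cases "a \<le> b") (auto simp: integrable_on_def)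
  then obtain N where N: "negligible N"
    "\<And>x e. \<lbrakk>x \<notin> N; 0 < e\<rbrakk> \<Longrightarrow> \<exists>d>0. \<forall>h. 0 < h \<and> h < d \<longrightarrow>
        norm (integral (cbox x (x + h *\<^sub>R One)) f /\<^sub>R h ^ DIM(real) - f x) < e"
    using integrable_ccontinuous_explicit[of f] by metis
  show ?thesis
  proof
    fix x assume x: "x \<notin> N"
    show "((\<lambda>h. (G (x + h) - G x) / h) \<longlongrightarrow> f x) (at_right 0)"
    proof (rule tendstoI)
      fix e :: real assume "e > 0"
      then obtain d where d: "d > 0" "\<And>h. 0 < h \<and> h < d \<Longrightarrow>
          norm (integral (cbox x (x + h *\<^sub>R One)) f /\<^sub>R h ^ DIM(real) - f x) < e"
        using N(2)[OF x] by blast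
      have "dist ((G (x + h) - G x) / h) (f x) < e" if h: "0 < h" "h < d" for h
        using d(2)[of h] h integral_unique[OF int[of x "x + h"]]
        by (simp add: dist_real_def divide_inverse mult.commute)
      then show "\<forall>\<^sub>F h in at_right 0. dist ((G (x + h) - G x) / h) (f x) < e"
        using d(1) by (auto simp: eventually_at_right_field)
    qed
  qed (rule N)
qed

text \<open>Lebesgue's differentiation theorem gives the right derivative almost everywhere; applied to the
  reflected function it gives the left derivative, with the same value.\<close>

lemma lipschitz_monotone_differentiable_AE:
  fixes G :: "real \<Rightarrow> real"
  assumes mono: "\<And>x y. x \<le> y \<Longrightarrow> G x \<le> G y"
    and lip: "\<And>x y. x \<le> y \<Longrightarrow> G y - G x \<le> y - x"
  shows "AE x in lebesgue. \<exists>d. (G has_real_derivative d) (at x)"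
proof -
  obtain f where f: "\<And>a b. a \<le> b \<Longrightarrow> (f has_integral (G b - G a)) {a..b}"
    using lipschitz_monotone_eq_indefinite_integral[of G] assms by metis
  obtain N where N: "negligible N"
    "\<And>x. x \<notin> N \<Longrightarrow> ((\<lambda>h. (G (x + h) - G x) / h) \<longlongrightarrow> f x) (at_right 0)"
    using indefinite_integral_right_derivative_AE[OF f] by blast
  have "((\<lambda>x. f (- x)) has_integral (- G (- b) - - G (- a))) {a..b}" if "a \<le> b" for a b
    using f[of "-b" "-a"] that by (subst has_integral_reflect_real[symmetric]) auto
  from indefinite_integral_right_derivative_AE[OF this] obtain N' where N': "negligible N'"
    "\<And>x. x \<notin> N' \<Longrightarrow> ((\<lambda>h. (- G (- (x + h)) - - G (- x)) / h) \<longlongrightarrow> f (- x)) (at_right 0)"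
    by blast
  have "negligible (uminus ` N')"
    using N'(1)
    by (intro negligible_differentiable_image_negligible)
       (auto intro!: derivative_intros simp: differentiable_on_def)
  then have "negligible (N \<union> uminus ` N')"
    using N(1) by auto
  then have "N \<union> uminus ` N' \<in> null_sets lebesgue"
    by (simp add: negligible_iff_null_sets)
  moreover have "{x \<in> space lebesgue. \<not> (\<exists>d. (G has_real_derivative d) (at x))} \<subseteq> N \<union> uminus ` N'"
  proof (rule ccontr)
    assume "\<not> ?thesis"
    then obtain x where x: "x \<notin> N" "- x \<notin> N'" "\<not> (\<exists>d. (G has_real_derivative d) (at x))"
      by (force simp: image_iff)
    have "((\<lambda>h. (G (x + h) - G x) / h) \<longlongrightarrow> f x) (at_left 0)"
    proof -
      have "(G x - G (x - h)) / h = (G (x - h) - G x) / (- h)" for h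
        by (metis minus_diff_eq minus_divide_divide)
      then show ?thesis
        using N'(2)[OF x(2)] by (simp add: filterlim_at_left_to_right)
    qed
    with N(2)[OF x(1)] have "((\<lambda>h. (G (x + h) - G x) / h) \<longlongrightarrow> f x) (at 0)"
      by (simp add: filterlim_split_at)
    then show False using x(3) by (auto simp: DERIV_def)
  qed
  ultimately show ?thesis by (rule AE_I')
qed

text \<open>For a real function \<open>H\<close> with Lipschitz constant \<open>1\<close>, the function \<open>(H x + x) / 2\<close> is nondecreasing.\<close>

lemma lipschitz_differentiable_AE:
  fixes F :: "real \<Rightarrow> complex"
  assumes lip: "\<And>x y. cmod (F x - F y) \<le> \<bar>x - y\<bar>"
  shows "AE x in lebesgue. \<exists>d. (F has_vector_derivative d) (at x)"
proof -
  have real: "AE x in lebesgue. \<exists>d. (H has_real_derivative d) (at x)"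
    if H: "\<And>x y. \<bar>H x - H y\<bar> \<le> \<bar>x - y\<bar>" for H :: "real \<Rightarrow> real"
  proof -
    define G where "G x = (H x + x) / 2" for x
    have "AE x in lebesgue. \<exists>d. (G has_real_derivative d) (at x)"
    proof (rule lipschitz_monotone_differentiable_AE)
      fix x y :: real assume "x \<le> y"
      then show "G x \<le> G y" "G y - G x \<le> y - x"
        using H[of x y] by (auto simp: G_def field_simps)
    qed
    moreover have "\<exists>d. (H has_real_derivative d) (at x)" if "(G has_real_derivative d) (at x)" for x d
    proof -
      have "((\<lambda>x. 2 * G x - x) has_real_derivative 2 * d - 1) (at x)"
        using that by (auto intro!: derivative_eq_intros)
      then show ?thesis by (auto simp: G_def[abs_def] add_divide_distrib)
    qed
    ultimately show ?thesis by (auto elim!: AE_mp)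
  qed
  have "AE x in lebesgue. \<exists>d. ((\<lambda>x. Re (F x)) has_real_derivative d) (at x)"
    "AE x in lebesgue. \<exists>d. ((\<lambda>x. Im (F x)) has_real_derivative d) (at x)"
    by (rule real, metis lip abs_Re_le_cmod minus_complex.simps(1) order_trans,
        rule real, metis lip abs_Im_le_cmod minus_complex.simps(2) order_trans)
  then show ?thesis
  proof eventually_elim
    case (elim x)
    then obtain c d where "((\<lambda>x. Re (F x)) has_real_derivative c) (at x)"
      "((\<lambda>x. Im (F x)) has_real_derivative d) (at x)" by blast
    then have "(F has_vector_derivative Complex c d) (at x)"
      by (subst has_vector_derivative_complex_iff) (auto simp: has_real_derivative_iff_has_vector_derivative)
    then show ?case by blast
  qed
qed

section \<open>Vertical limits of Herglotz functions\<close>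

text \<open>The maximum principle for \<open>g(z) / (z + \<i> \<epsilon>) exp (\<i> k z / r)\<close> on the half-disc. On the diameter the
  modulus is at most \<open>\<eta>\<close>, as \<open>\<bar>x + \<i> \<epsilon>\<bar> \<ge> \<bar>x\<bar>\<close>. On the arc it is at most \<open>(\<eta> + C s) exp (- k s)\<close>
  with \<open>s = Im z / r\<close>, and \<open>s exp (- k s) \<le> 1 / k\<close>. Dividing by \<open>z + \<i> \<epsilon>\<close> instead of \<open>z\<close> keeps
  the function continuous at the origin.\<close>

lemma half_disc_bound:
  fixes g :: "complex \<Rightarrow> complex"
  assumes hol: "g holomorphic_on {z. 0 < Im z}" and cont: "continuous_on {z. 0 \<le> Im z} g"
    and bound: "\<And>z. 0 \<le> Im z \<Longrightarrow> cmod z \<le> r \<Longrightarrow> cmod (g z) \<le> \<eta> * \<bar>Re z\<bar> + C * Im z"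
    and pos: "0 < \<epsilon>" "0 < k" "0 < r" "0 \<le> C" "0 \<le> \<eta>"
    and z: "0 < Im z" "cmod z < r"
  shows "cmod (g z) \<le> (\<eta> + C / k) * cmod (z + \<i> * of_real \<epsilon>) * exp (k * Im z / r)"
proof -
  let ?S = "{z. 0 < Im z} \<inter> ball 0 r"
  define h where "h z = g z / (z + \<i> * of_real \<epsilon>) * exp (\<i> * of_real (k / r) * z)" for z
  have op: "open ?S" by (intro open_Int open_halfspace_Im_gt open_ball)
  have cl: "closure ?S \<subseteq> {z. 0 \<le> Im z} \<inter> cball 0 r"
    by (rule closure_minimal) (auto intro!: closed_Int closed_halfspace_Im_ge)
  have nz: "z + \<i> * of_real \<epsilon> \<noteq> 0" if "0 \<le> Im z" for z
    using that pos(1) by (auto simp: complex_eq_iff)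
  have nh: "cmod (h z) = cmod (g z) / cmod (z + \<i> * of_real \<epsilon>) * exp (- (k * Im z / r))" for z
    by (simp add: h_def norm_mult norm_divide)
  have "cmod (h z) \<le> \<eta> + C / k"
  proof (rule maximum_modulus_frontier[where S = ?S and f = h and \<xi> = z])
    show "h holomorphic_on interior ?S"
      unfolding h_def interior_open[OF op]
      by (intro holomorphic_intros holomorphic_on_subset[OF hol]) (use nz in force)+
    show "continuous_on (closure ?S) h"
      unfolding h_def
      by (intro continuous_intros continuous_on_subset[OF cont]) (use cl nz in force)+
    show "bounded ?S" by auto
    show "z \<in> ?S" using z by auto
    fix x assume x: "x \<in> frontier ?S"
    then have x1: "0 \<le> Im x" "cmod x \<le> r" using cl by (auto simp: frontier_def)
    have x2: "Im x = 0 \<or> cmod x = r"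
      using x x1 by (auto simp: frontier_def interior_open[OF op] simp del: interior_Int)
    have ge: "cmod x \<le> cmod (x + \<i> * of_real \<epsilon>)"
      using x1 pos(1) by (auto simp: cmod_def intro!: power_mono)
    have gp: "0 < cmod (x + \<i> * of_real \<epsilon>)" using nz[OF x1(1)] by simp
    show "cmod (h x) \<le> \<eta> + C / k"
    proof (cases "Im x = 0")
      case True
      have "cmod (g x) \<le> \<eta> * cmod x"
        using bound[OF x1] True by (simp add: cmod_def)
      also have "\<dots> \<le> \<eta> * cmod (x + \<i> * of_real \<epsilon>)" using ge pos by (intro mult_left_mono) auto
      finally have "cmod (h x) \<le> \<eta>" using True gp by (simp add: nh divide_le_eq)
      also have "\<eta> \<le> \<eta> + C / k" using pos by simp
      finally show ?thesis .
    next
      case False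
      define s where "s = Im x / r"
      have r: "cmod x = r" using False x2 by simp
      have s: "0 \<le> s" using x1 pos by (simp add: s_def)
      have "cmod (g x) \<le> \<eta> * \<bar>Re x\<bar> + C * Im x" using bound[OF x1] .
      also have "\<dots> \<le> \<eta> * r + C * Im x"
        using pos abs_Re_le_cmod[of x] r by (intro add_right_mono mult_left_mono) auto
      also have "\<dots> = (\<eta> + C * s) * r" using pos by (simp add: s_def field_simps)
      also have "\<dots> \<le> (\<eta> + C * s) * cmod (x + \<i> * of_real \<epsilon>)"
        using ge r pos s by (intro mult_left_mono) auto
      finally have "cmod (g x) / cmod (x + \<i> * of_real \<epsilon>) \<le> \<eta> + C * s"
        using gp by (simp add: divide_le_eq)
      then have "cmod (h x) \<le> (\<eta> + C * s) * exp (- (k * s))"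
        unfolding nh using pos s by (intro mult_mono add_nonneg_nonneg mult_nonneg_nonneg) (auto simp: s_def)
      also have "\<dots> = \<eta> * exp (- (k * s)) + C * (s * exp (- (k * s)))" by (simp add: algebra_simps)
      also have "\<dots> \<le> \<eta> * 1 + C * (1 / k)"
      proof (intro add_mono mult_left_mono)
        have "k * s \<le> exp (k * s)" using exp_ge_add_one_self[of "k * s"] by linarith
        then show "s * exp (- (k * s)) \<le> 1 / k"
          using pos by (simp add: exp_minus field_simps)
      qed (use pos s in auto)
      finally show ?thesis by simp
    qed
  qed
  moreover have "cmod (g z) = cmod (h z) * (cmod (z + \<i> * of_real \<epsilon>) * exp (k * Im z / r))"
    using nz[of z] z(1) by (simp add: nh exp_minus)
  ultimately show ?thesis
    by (simp add: mult.assoc mult_right_mono)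
qed

lemma closure_upper_half_plane: "closure {z. 0 < Im z} = {z. 0 \<le> Im z}"
proof -
  have "Complex (Re z) (Im z + e/2) \<in> {z. 0 < Im z} \<and> dist (Complex (Re z) (Im z + e/2)) z < e"
    if "0 \<le> Im z" "0 < e" for z e
    using that by (auto simp: dist_norm cmod_def)
  then have "{z. 0 \<le> Im z} \<subseteq> closure {z. 0 < Im z}"
    unfolding closure_approachable subset_iff mem_Collect_eq by blast
  then show ?thesis
    by (intro antisym closure_minimal closed_halfspace_Im_ge) auto
qed

lemma convex_upper_half_plane: "convex {z. 0 < Im z}"
  by (rule convex_halfspace_Im_gt)

text \<open>A primitive \<open>W\<close> of \<open>w\<close> is Lipschitz continuous up to the real axis, so its boundary function is
  differentiable at almost every \<open>t\<close>. If \<open>d\<close> is the derivative there, \<open>g(z) = W(t + z) - W(t) - d z\<close>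
  is small compared to \<open>\<bar>z\<bar>\<close> on the real axis. By \<open>half_disc_bound\<close> it is equally small near the points
  \<open>\<i> \<epsilon>\<close>, and Cauchy's estimate on the disc of radius \<open>\<epsilon> / 2\<close> shows that \<open>g'(\<i> \<epsilon>) = w(t + \<i> \<epsilon>) - d\<close>
  tends to \<open>0\<close>.\<close>

lemma bounded_holomorphic_boundary_limit_AE:
  assumes hol: "w holomorphic_on {z. 0 < Im z}" and bd: "\<And>z. 0 < Im z \<Longrightarrow> cmod (w z) \<le> 1"
  shows "AE t in lebesgue. \<exists>l. ((\<lambda>\<epsilon>. w (Complex t \<epsilon>)) \<longlongrightarrow> l) (at_right 0)"
proof -
  let ?U = "{z. 0 < Im z}"
  obtain W0 where W0: "\<And>z. z \<in> ?U \<Longrightarrow> (W0 has_field_derivative w z) (at z within ?U)"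
    using holomorphic_convex_primitive'[OF convex_upper_half_plane open_halfspace_Im_gt hol] by blast
  have "1-lipschitz_on ?U W0"
  proof (rule lipschitz_onI)
    fix x y assume "x \<in> ?U" "y \<in> ?U"
    then show "dist (W0 x) (W0 y) \<le> 1 * dist x y"
      unfolding dist_norm
      by (intro field_differentiable_bound[OF convex_upper_half_plane W0]) (use bd in auto)
  qed simp
  then obtain W where W: "1-lipschitz_on {z. 0 \<le> Im z} W" "\<And>z. 0 < Im z \<Longrightarrow> W z = W0 z"
    using lipschitz_extend_closure[of 1 ?U W0] by (auto simp: closure_upper_half_plane)
  have lip: "cmod (W x - W y) \<le> cmod (x - y)" if "0 \<le> Im x" "0 \<le> Im y" for x y
    using lipschitz_onD[OF W(1)] that by (auto simp: dist_norm)
  have der: "(W has_field_derivative w z) (at z)" if "0 < Im z" for z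
  proof -
    have "(W has_field_derivative w z) (at z within ?U)"
      using W0[of z] that W(2) by (auto cong: has_field_derivative_cong_ev elim!: has_field_derivative_transform_within[of _ _ _ _ 1])
    then show ?thesis using at_within_open[OF _ open_halfspace_Im_gt[of 0]] that by auto
  qed
  have "AE t in lebesgue. \<exists>d. ((\<lambda>t. W (of_real t)) has_vector_derivative d) (at t)"
  proof (rule lipschitz_differentiable_AE)
    fix x y :: real
    show "cmod (W (of_real x) - W (of_real y)) \<le> \<bar>x - y\<bar>"
      using lip[of "of_real x" "of_real y"] by (simp flip: of_real_diff)
  qed
  then show ?thesis
  proof eventually_elim
    case (elim t)
    then obtain d where d: "((\<lambda>t. W (of_real t)) has_vector_derivative d) (at t)" by blast
    define C where "C = 1 + cmod d"
    define g where "g z = W (of_real t + z) - W (of_real t) - d * z" for z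
    have C: "C \<ge> 1" by (simp add: C_def)
    have gl: "cmod (g x - g y) \<le> C * cmod (x - y)" if "0 \<le> Im x" "0 \<le> Im y" for x y
    proof -
      have "cmod (g x - g y) = cmod ((W (of_real t + x) - W (of_real t + y)) - d * (x - y))"
        by (simp add: g_def algebra_simps)
      also have "\<dots> \<le> cmod (W (of_real t + x) - W (of_real t + y)) + cmod (d * (x - y))"
        by (rule norm_triangle_ineq4)
      also have "\<dots> \<le> cmod (x - y) + cmod d * cmod (x - y)"
        using lip[of "of_real t + x" "of_real t + y"] that by (simp add: norm_mult)
      finally show ?thesis by (simp add: C_def algebra_simps)
    qed
    have gd: "(g has_field_derivative w (of_real t + z) - d) (at z)" if "0 < Im z" for z
    proof -
      have "((\<lambda>z. W (of_real t + z)) has_field_derivative w (of_real t + z) * 1) (at z)"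
        by (rule DERIV_chain2[where f = W]) (use der[of "of_real t + z"] that in \<open>auto intro!: derivative_eq_intros\<close>)
      then show ?thesis
        unfolding g_def by (auto intro!: derivative_eq_intros)
    qed
    have gh: "g holomorphic_on ?U"
      using gd by (auto simp: holomorphic_on_def field_differentiable_def intro: has_field_derivative_at_within)
    have "C-lipschitz_on {z. 0 \<le> Im z} g"
      using gl C by (intro lipschitz_onI) (auto simp: dist_norm)
    then have gc: "continuous_on {z. 0 \<le> Im z} g"
      by (rule lipschitz_on_continuous_on)
    have "((\<lambda>\<epsilon>. w (Complex t \<epsilon>)) \<longlongrightarrow> d) (at_right 0)"
    proof (rule tendstoI)
      fix e :: real assume e: "0 < e"
      \<comment> \<open>The estimates below give \<open>\<bar>w(t + \<i> \<epsilon>) - d\<bar> \<le> 36 \<eta>\<close>. The choice of \<open>k\<close> makes \<open>C / k\<close> equal to \<open>\<eta>\<close>.\<close>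
      define \<eta> where "\<eta> = e / 72"
      define k where "k = C / \<eta>"
      have pos: "0 < \<eta>" "0 < k" using e C by (auto simp: \<eta>_def k_def)
      have Ck: "C / k = \<eta>" using pos C by (simp add: k_def)
      obtain \<delta> where \<delta>: "0 < \<delta>" "\<And>y. \<bar>y - t\<bar> < \<delta> \<Longrightarrow>
          cmod (W (of_real y) - W (of_real t) - (y - t) *\<^sub>R d) \<le> \<eta> * \<bar>y - t\<bar>"
        using d pos(1) unfolding has_vector_derivative_def has_derivative_at_alt by force
      define r where "r = \<delta> / 2"
      have r: "0 < r" "r < \<delta>" using \<delta> by (auto simp: r_def)
      have bound: "cmod (g z) \<le> \<eta> * \<bar>Re z\<bar> + C * Im z" if "0 \<le> Im z" "cmod z \<le> r" for z
      proof -
        have "\<bar>Re z\<bar> < \<delta>" using that r abs_Re_le_cmod[of z] by linarith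
        then have "cmod (g (of_real (Re z))) \<le> \<eta> * \<bar>Re z\<bar>"
          using \<delta>(2)[of "t + Re z"] by (simp add: g_def scaleR_conv_of_real mult.commute)
        moreover have "cmod (g z - g (of_real (Re z))) \<le> C * Im z"
        proof -
          have "z - of_real (Re z) = \<i> * of_real (Im z)" by (simp add: complex_eq_iff)
          then show ?thesis
            using gl[of z "of_real (Re z)"] that by (simp add: norm_mult)
        qed
        moreover have "cmod (g z) \<le> cmod (g (of_real (Re z))) + cmod (g z - g (of_real (Re z)))"
          using norm_triangle_ineq[of "g (of_real (Re z))" "g z - g (of_real (Re z))"] by simp
        ultimately show ?thesis by linarith
      qed
      have main: "dist (w (Complex t \<epsilon>)) d < e" if \<epsilon>: "0 < \<epsilon>" "\<epsilon> < r / 2" "\<epsilon> < r / (2 * k)" for \<epsilon>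
      proof -
        let ?c = "\<i> * of_real \<epsilon>"
        have near: "0 < Im z \<and> Im z \<le> 2 * \<epsilon> \<and> cmod z < r \<and> cmod (z + ?c) \<le> 3 * \<epsilon>" if z: "dist ?c z \<le> \<epsilon> / 2" for z
        proof -
          have d: "cmod (z - ?c) \<le> \<epsilon> / 2" using z by (simp add: dist_norm norm_minus_commute)
          have "\<bar>Im z - \<epsilon>\<bar> \<le> \<epsilon> / 2" using abs_Im_le_cmod[of "z - ?c"] d by simp
          moreover have "cmod z \<le> cmod (z - ?c) + cmod ?c" using norm_triangle_ineq[of "z - ?c" ?c] by simp
          moreover have "cmod (z + ?c) \<le> cmod (z - ?c) + cmod (2 * ?c)"
            using norm_triangle_ineq[of "z - ?c" "2 * ?c"] by (simp add: algebra_simps)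
          ultimately show ?thesis using d \<epsilon> by (auto simp: norm_mult abs_if split: if_splits)
        qed
        have gb: "cmod (g z) \<le> 18 * \<eta> * \<epsilon>" if z: "dist ?c z \<le> \<epsilon> / 2" for z
        proof -
          note n = near[OF z]
          have "cmod (g z) \<le> (\<eta> + C / k) * cmod (z + ?c) * exp (k * Im z / r)"
            by (rule half_disc_bound[OF gh gc bound]) (use n \<epsilon> pos r C in auto)
          also have "\<dots> \<le> (2 * \<eta>) * (3 * \<epsilon>) * 3"
          proof (intro mult_mono)
            have "k * Im z / r \<le> k * (2 * \<epsilon>) / r"
              using n pos r by (intro divide_right_mono mult_left_mono) auto
            also have "\<dots> \<le> 1" using \<epsilon> pos r by (simp add: field_simps)
            finally have "exp (k * Im z / r) \<le> exp 1" by simp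
            then show "exp (k * Im z / r) \<le> 3" using exp_le by linarith
          qed (use n pos Ck \<epsilon> in auto)
          finally show ?thesis by simp
        qed
        have "norm ((deriv ^^ 1) g ?c) \<le> fact 1 * (18 * \<eta> * \<epsilon>) / (\<epsilon> / 2) ^ 1"
        proof (rule Cauchy_inequality)
          show "g holomorphic_on ball ?c (\<epsilon> / 2)"
            by (rule holomorphic_on_subset[OF gh]) (use near in \<open>auto simp: subset_iff\<close>)
          show "continuous_on (cball ?c (\<epsilon> / 2)) g"
            by (rule continuous_on_subset[OF gc]) (use near in \<open>force simp: subset_iff\<close>)
          show "\<And>x. cmod (?c - x) = \<epsilon> / 2 \<Longrightarrow> cmod (g x) \<le> 18 * \<eta> * \<epsilon>"
            using gb by (simp add: dist_norm)
        qed (use \<epsilon> in auto)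
        moreover have "deriv g ?c = w (of_real t + ?c) - d"
          by (rule DERIV_imp_deriv[OF gd]) (use \<epsilon> in auto)
        ultimately have "cmod (w (of_real t + ?c) - d) \<le> 36 * \<eta>"
          using \<epsilon> by simp
        then show ?thesis using e by (simp add: dist_norm \<eta>_def Complex_eq)
      qed
      have "0 < min (r / 2) (r / (2 * k))" using r pos by simp
      then show "\<forall>\<^sub>F \<epsilon> in at_right 0. dist (w (Complex t \<epsilon>)) d < e"
        using main by (auto simp: eventually_at_right_field intro!: exI[of _ "min (r / 2) (r / (2 * k))"])
    qed
    then show ?case by blast
  qed
qed

lemma vertical_derivative:
  assumes "(f has_field_derivative f') (at (Complex x y))"
  shows "((\<lambda>y. f (Complex x y)) has_vector_derivative (\<i> * f')) (at y)"
proof -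
  have "((\<lambda>y. Complex x y) has_vector_derivative \<i>) (at y)"
    unfolding Complex_eq by (auto intro!: derivative_eq_intros)
  from field_vector_diff_chain_at[OF this assms] show ?thesis by (simp add: o_def)
qed

lemma horizontal_derivative:
  assumes "(f has_field_derivative f') (at (Complex x y))"
  shows "((\<lambda>x. f (Complex x y)) has_vector_derivative f') (at x)"
proof -
  have "((\<lambda>x. Complex x y) has_vector_derivative 1) (at x)"
    unfolding Complex_eq by (auto intro!: derivative_eq_intros)
  from field_vector_diff_chain_at[OF this assms] show ?thesis by (simp add: o_def)
qed

text \<open>The imaginary part of \<open>N = Ln (M + \<i>)\<close> lies between \<open>0\<close> and \<open>\<pi>\<close>, so that \<open>exp (\<i> N)\<close> has modulus between
  \<open>exp (- \<pi>)\<close> and \<open>1\<close>. Cauchy's estimate for \<open>exp (\<i> N)\<close> on the disc of radius \<open>Im z / 2\<close> bounds \<open>N'\<close>.\<close>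

lemma log_herglotz_derivative_bound:
  assumes hol: "M holomorphic_on {z. 0 < Im z}" and pos: "\<And>z. 0 < Im z \<Longrightarrow> 0 < Im (M z)"
    and z: "0 < Im z"
  shows "cmod (deriv (\<lambda>z. Ln (M z + \<i>)) z) \<le> 2 * exp pi / Im z"
proof -
  let ?N = "\<lambda>z. Ln (M z + \<i>)"
  define E where "E z = exp (\<i> * ?N z)" for z
  have Nh: "?N holomorphic_on {z. 0 < Im z}"
    by (intro holomorphic_intros hol) (use pos in \<open>force simp: complex_nonpos_Reals_iff\<close>)
  have nz: "M z + \<i> \<noteq> 0" if "0 < Im z" for z using pos[OF that] by (auto simp: complex_eq_iff)
  have ImN: "0 \<le> Im (?N z)" "Im (?N z) \<le> pi" if "0 < Im z" for z
    using nz[OF that] pos[OF that] Im_Ln_pos_le[of "M z + \<i>"] Im_Ln_le_pi[of "M z + \<i>"] by auto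
  have nE: "cmod (E z) = exp (- Im (?N z))" for z by (simp add: E_def)
  have Eh: "E holomorphic_on {z. 0 < Im z}" unfolding E_def by (intro holomorphic_intros Nh)
  have sub: "cball z (Im z / 2) \<subseteq> {z. 0 < Im z}"
  proof
    fix x assume "x \<in> cball z (Im z / 2)"
    then have "\<bar>Im (z - x)\<bar> \<le> Im z / 2" using abs_Im_le_cmod[of "z - x"] by (auto simp: dist_norm)
    then show "x \<in> {z. 0 < Im z}" using z by (auto simp: abs_if split: if_splits)
  qed
  have "norm ((deriv ^^ 1) E z) \<le> fact 1 * 1 / (Im z / 2) ^ 1"
  proof (rule Cauchy_inequality)
    show "E holomorphic_on ball z (Im z / 2)"
      by (rule holomorphic_on_subset[OF Eh]) (use sub ball_subset_cball in blast)
    show "continuous_on (cball z (Im z / 2)) E"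
      by (rule holomorphic_on_imp_continuous_on[OF holomorphic_on_subset[OF Eh sub]])
    fix x assume "cmod (z - x) = Im z / 2"
    then have "x \<in> cball z (Im z / 2)" by (simp add: dist_norm)
    then have "0 < Im x" using sub by auto
    then show "cmod (E x) \<le> 1" unfolding nE using ImN[of x] by simp
  qed (use z in auto)
  then have d: "cmod (deriv E z) \<le> 2 / Im z" by simp
  have "(?N has_field_derivative deriv ?N z) (at z)"
    by (rule holomorphic_derivI[OF Nh open_halfspace_Im_gt]) (use z in auto)
  then have "(E has_field_derivative (\<i> * deriv ?N z) * E z) (at z)"
    unfolding E_def using DERIV_chain2[OF DERIV_exp DERIV_cmult[where c = \<i>]] by (force simp: mult.commute)
  then have "deriv E z = \<i> * deriv ?N z * E z" by (rule DERIV_imp_deriv)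
  then have "cmod (deriv ?N z) * exp (- Im (?N z)) \<le> 2 / Im z"
    using d by (simp add: norm_mult nE)
  then have "cmod (deriv ?N z) \<le> 2 / Im z * exp (Im (?N z))"
    by (simp add: exp_minus field_simps)
  also have "\<dots> \<le> 2 / Im z * exp pi"
    using z ImN[OF z] by (intro mult_left_mono) auto
  finally show ?thesis by simp
qed

lemma vertical_growth:
  assumes der: "\<And>y. 0 < y \<Longrightarrow> y < 1 \<Longrightarrow> (f has_field_derivative f' y) (at (Complex x y))"
    and cont: "\<And>y. 0 < y \<Longrightarrow> isCont f (Complex x y)"
    and phi: "\<And>y. 0 < y \<Longrightarrow> (\<phi> has_real_derivative \<phi>' y) (at y)"
    and le: "\<And>y. 0 < y \<Longrightarrow> y < 1 \<Longrightarrow> cmod (f' y) \<le> \<phi>' y"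
    and d: "0 < \<delta>" "\<delta> < 1"
  shows "cmod (f (Complex x 1) - f (Complex x \<delta>)) \<le> \<phi> 1 - \<phi> \<delta>"
proof (rule differentiable_bound_general[OF d(2)])
  have c: "isCont (Complex x) y" for y
    unfolding Complex_eq by (intro continuous_intros)
  show "continuous_on {\<delta>..1} (\<lambda>y. f (Complex x y))"
    using cont d(1) by (intro continuous_at_imp_continuous_on ballI isCont_o2[OF c]) auto
  show "continuous_on {\<delta>..1} \<phi>"
    using phi d(1) by (intro continuous_at_imp_continuous_on ballI) (metis DERIV_isCont atLeastAtMost_iff less_le_trans)
  fix y assume y: "\<delta> < y" "y < 1"
  show "((\<lambda>y. f (Complex x y)) has_vector_derivative \<i> * f' y) (at y)"
    by (rule vertical_derivative[OF der]) (use y d in auto)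
  show "(\<phi> has_vector_derivative \<phi>' y) (at y)"
    using phi[of y] y d by (simp add: has_real_derivative_iff_has_vector_derivative)
  show "norm (\<i> * f' y) \<le> \<phi>' y" using le[of y] y d by (simp add: norm_mult)
qed

text \<open>The function \<open>N = Ln (M + \<i>)\<close> has nonnegative real part \<open>ln \<bar>M + \<i>\<bar>\<close>. Since \<open>N'\<close> is at most of order
  \<open>1 / Im z\<close>, \<open>N\<close> grows at most logarithmically near the real axis and a primitive of \<open>N\<close> stays bounded.
  Thus the integrals of \<open>Re N\<close> along horizontal segments stay bounded as the segments approach the
  real axis, and by Fatou's lemma the lower limit of \<open>Re N\<close> is finite almost everywhere. The heights
  \<open>1 / (n + 2)\<close> lie strictly between \<open>0\<close> and \<open>1\<close>.\<close>

lemma herglotz_finite_boundary_AE: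
  assumes hol: "M holomorphic_on {z. 0 < Im z}" and pos: "\<And>z. 0 < Im z \<Longrightarrow> 0 < Im (M z)"
  shows "AE t in lebesgue. \<not> filterlim (\<lambda>n. ln (cmod (M (Complex t (1 / real (n + 2))) + \<i>))) at_top sequentially"
proof -
  let ?U = "{z. 0 < Im z}"
  define N where "N z = Ln (M z + \<i>)" for z
  have Nh: "N holomorphic_on ?U"
    unfolding N_def by (intro holomorphic_intros hol) (use pos in \<open>force simp: complex_nonpos_Reals_iff\<close>)
  have ge1: "1 \<le> cmod (M z + \<i>)" if "0 < Im z" for z
    using pos[OF that] abs_Im_le_cmod[of "M z + \<i>"] by simp
  have ReN: "Re (N z) = ln (cmod (M z + \<i>))" if "0 < Im z" for z
    using ge1[OF that] unfolding N_def by (subst Re_Ln) auto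
  have ReN0: "0 \<le> Re (N z)" if "0 < Im z" for z
    using ge1[OF that] by (simp add: ReN[OF that])
  obtain P where P0: "\<And>z. z \<in> ?U \<Longrightarrow> (P has_field_derivative N z) (at z within ?U)"
    using holomorphic_convex_primitive'[OF convex_upper_half_plane open_halfspace_Im_gt Nh] by blast
  have P: "(P has_field_derivative N z) (at z)" if "0 < Im z" for z
    using P0[of z] at_within_open[OF _ open_halfspace_Im_gt[of 0], of z] that by auto
  define c where "c = 2 * exp pi"
  have c: "0 < c" by (simp add: c_def)
  have Nb: "cmod (N (Complex x \<delta>)) \<le> cmod (N (Complex x 1)) - c * ln \<delta>" if d: "0 < \<delta>" "\<delta> < 1" for x \<delta>
  proof -
    have "cmod (N (Complex x 1) - N (Complex x \<delta>)) \<le> c * ln 1 - c * ln \<delta>"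
    proof (rule vertical_growth[OF _ _ _ _ d, where \<phi>' = "\<lambda>y. c / y"])
      fix y :: real assume y: "0 < y"
      show "(N has_field_derivative deriv N (Complex x y)) (at (Complex x y))"
        by (rule holomorphic_derivI[OF Nh open_halfspace_Im_gt]) (use y in auto)
      then show "isCont N (Complex x y)" by (rule DERIV_isCont)
      show "((\<lambda>y. c * ln y) has_real_derivative c / y) (at y)"
        using y by (auto intro!: derivative_eq_intros)
      show "cmod (deriv N (Complex x y)) \<le> c / y"
        using log_herglotz_derivative_bound[OF hol pos, of "Complex x y"] y
        by (simp add: N_def[abs_def] c_def)
    qed
    then show ?thesis
      using norm_triangle_ineq2[of "N (Complex x \<delta>)" "N (Complex x 1)"] by (simp add: norm_minus_commute)
  qed
  have Pb: "cmod (P (Complex x \<delta>)) \<le> cmod (P (Complex x 1)) + cmod (N (Complex x 1)) + c"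
    if d: "0 < \<delta>" "\<delta> < 1" for x \<delta>
  proof -
    let ?n = "cmod (N (Complex x 1))"
    \<comment> \<open>A primitive of the bound \<open>Nb\<close>; it stays bounded as \<open>y\<close> tends to \<open>0\<close>.\<close>
    let ?\<phi> = "\<lambda>y. ?n * y - c * (y * ln y - y)"
    have "cmod (P (Complex x 1) - P (Complex x \<delta>)) \<le> ?\<phi> 1 - ?\<phi> \<delta>"
    proof (rule vertical_growth[OF P _ _ _ d, where \<phi>' = "\<lambda>y. ?n - c * ln y"])
      fix y :: real assume y: "0 < y"
      show "isCont P (Complex x y)" using P[of "Complex x y"] y by (auto intro: DERIV_isCont)
      show "(?\<phi> has_real_derivative ?n - c * ln y) (at y)"
        using y by (auto intro!: derivative_eq_intros)
      show "cmod (N (Complex x y)) \<le> ?n - c * ln y" if "y < 1" using Nb[OF y that] .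
    qed auto
    also have "?\<phi> 1 - ?\<phi> \<delta> \<le> ?n + c"
    proof -
      have "ln \<delta> < 0" using d by simp
      then have "\<delta> * (ln \<delta> - 1) \<le> 0" using d(1) by (intro mult_nonneg_nonpos) linarith+
      then have "c * (\<delta> * ln \<delta> - \<delta>) \<le> 0" using c by (intro mult_nonneg_nonpos) (auto simp: algebra_simps)
      moreover have "0 \<le> ?n * \<delta>" using d by simp
      ultimately show ?thesis by simp
    qed
    finally show ?thesis
      using norm_triangle_ineq2[of "P (Complex x \<delta>)" "P (Complex x 1)"] by (simp add: norm_minus_commute)
  qed
  have main: "AE t in lborel. t \<in> {a..b} \<longrightarrow>
      \<not> filterlim (\<lambda>n. ln (cmod (M (Complex t (1 / real (n + 2))) + \<i>))) at_top sequentially"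
    if ab: "a \<le> b" for a b
  proof -
    define K where "K = (cmod (P (Complex a 1)) + cmod (N (Complex a 1)) + c) +
      (cmod (P (Complex b 1)) + cmod (N (Complex b 1)) + c)"
    define \<delta> where "\<delta> n = 1 / real (n + 2)" for n
    have \<delta>: "0 < \<delta> n" "\<delta> n < 1" for n by (auto simp: \<delta>_def field_simps)
    define u where "u n t = Re (N (Complex t (\<delta> n)))" for n t
    have int: "(u n has_integral (Re (P (Complex b (\<delta> n))) - Re (P (Complex a (\<delta> n))))) {a..b}" for n
      unfolding u_def
    proof (rule fundamental_theorem_of_calculus[OF ab])
      fix x assume "x \<in> {a..b}"
      have "((\<lambda>x. P (Complex x (\<delta> n))) has_vector_derivative N (Complex x (\<delta> n))) (at x)"
        by (rule horizontal_derivative[OF P]) (use \<delta> in auto)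
      then have "((\<lambda>x. Re (P (Complex x (\<delta> n)))) has_vector_derivative Re (N (Complex x (\<delta> n)))) (at x)"
        by (rule bounded_linear.has_vector_derivative[OF bounded_linear_Re])
      then show "((\<lambda>x. Re (P (Complex x (\<delta> n)))) has_vector_derivative Re (N (Complex x (\<delta> n)))) (at x within {a..b})"
        by (rule has_vector_derivative_at_within)
    qed
    have "(\<integral>\<^sup>+t. ennreal (u n t) * indicator {a..b} t \<partial>lborel) \<le> ennreal K" for n
    proof -
      have "(\<integral>\<^sup>+t. ennreal (u n t) * indicator {a..b} t \<partial>lborel)
          = ennreal (Re (P (Complex b (\<delta> n))) - Re (P (Complex a (\<delta> n))))"
        by (rule nn_integral_has_integral_lebesgue'[OF _ int]) (use ReN0 \<delta> in \<open>auto simp: u_def\<close>)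
      also have "\<dots> \<le> ennreal K"
        using Pb[OF \<delta>, of b n] Pb[OF \<delta>, of a n] abs_Re_le_cmod[of "P (Complex b (\<delta> n))"]
          abs_Re_le_cmod[of "P (Complex a (\<delta> n))"]
        by (intro ennreal_leI) (auto simp: K_def)
      finally show ?thesis .
    qed
    moreover have meas: "(\<lambda>t. ennreal (u n t) * indicator {a..b} t) \<in> borel_measurable lborel" for n
    proof -
      have "continuous_on UNIV (\<lambda>t. N (Complex t (\<delta> n)))"
        by (rule continuous_on_compose2[OF holomorphic_on_imp_continuous_on[OF Nh]])
           (use \<delta> in \<open>auto simp: Complex_eq intro!: continuous_intros\<close>)
      then have "u n \<in> borel_measurable borel"
        unfolding u_def by (intro borel_measurable_continuous_onI continuous_intros)
      then show ?thesis by measurable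
    qed
    ultimately have "(\<integral>\<^sup>+t. liminf (\<lambda>n. ennreal (u n t) * indicator {a..b} t) \<partial>lborel) \<le> ennreal K"
      by (intro order_trans[OF nn_integral_liminf]) (auto intro!: Liminf_le)
    then have "AE t in lborel. liminf (\<lambda>n. ennreal (u n t) * indicator {a..b} t) \<noteq> \<infinity>"
      using meas by (intro nn_integral_PInf_AE) (auto simp: top_unique)
    then show ?thesis
    proof (eventually_elim, intro impI notI)
      fix t assume t: "liminf (\<lambda>n. ennreal (u n t) * indicator {a..b} t) \<noteq> \<infinity>" "t \<in> {a..b}"
        and f: "filterlim (\<lambda>n. ln (cmod (M (Complex t (1 / real (n + 2))) + \<i>))) at_top sequentially"
      have f: "filterlim (\<lambda>n. u n t) at_top sequentially"
        using f \<delta> by (simp add: u_def ReN \<delta>_def)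
      obtain r where r: "liminf (\<lambda>n. ennreal (u n t) * indicator {a..b} t) = ennreal r" "0 \<le> r"
        using t(1) by (cases "liminf (\<lambda>n. ennreal (u n t) * indicator {a..b} t)") auto
      have "\<forall>\<^sub>F n in sequentially. r + 1 \<le> u n t" using f by (simp add: filterlim_at_top)
      then have "ennreal (r + 1) \<le> liminf (\<lambda>n. ennreal (u n t) * indicator {a..b} t)"
        using t(2) by (intro Liminf_bounded) (auto elim!: eventually_mono simp: indicator_def intro!: ennreal_leI)
      then show False using r by simp
    qed
  qed
  have "AE t in lborel. \<forall>k::nat. t \<in> {- real k..real k} \<longrightarrow>
      \<not> filterlim (\<lambda>n. ln (cmod (M (Complex t (1 / real (n + 2))) + \<i>))) at_top sequentially"
    unfolding AE_all_countable by (intro allI main) auto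
  then have "AE t in lborel. \<not> filterlim (\<lambda>n. ln (cmod (M (Complex t (1 / real (n + 2))) + \<i>))) at_top sequentially"
  proof eventually_elim
    case (elim t)
    obtain k :: nat where "\<bar>t\<bar> \<le> real k" using real_arch_simple by blast
    then show ?case using elim by (auto simp: abs_le_iff)
  qed
  then show ?thesis by (rule AE_completion)
qed

text \<open>The function \<open>1 / (M + \<i>)\<close> is bounded by \<open>1\<close> and therefore has vertical limits almost everywhere. A limit
  \<open>0\<close> would mean that \<open>M\<close> tends to infinity, which happens only on a null set.\<close>

theorem herglotz_boundary_limit_AE:
  assumes hol: "M holomorphic_on {z. 0 < Im z}" and pos: "\<And>z. 0 < Im z \<Longrightarrow> 0 < Im (M z)"
  shows "AE t in lebesgue. \<exists>l. ((\<lambda>\<epsilon>. M (Complex t \<epsilon>)) \<longlongrightarrow> l) (at_right 0)"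
proof -
  define w where "w z = 1 / (M z + \<i>)" for z
  have ge1: "1 \<le> cmod (M z + \<i>)" if "0 < Im z" for z
    using pos[OF that] abs_Im_le_cmod[of "M z + \<i>"] by simp
  have nz: "M z + \<i> \<noteq> 0" if "0 < Im z" for z using ge1[OF that] by auto
  have "w holomorphic_on {z. 0 < Im z}"
    unfolding w_def by (intro holomorphic_intros hol) (use nz in auto)
  moreover have "cmod (w z) \<le> 1" if "0 < Im z" for z
    using ge1[OF that] le_imp_inverse_le[of 1 "cmod (M z + \<i>)"]
    by (simp add: w_def norm_divide inverse_eq_divide)
  ultimately have "AE t in lebesgue. \<exists>l. ((\<lambda>\<epsilon>. w (Complex t \<epsilon>)) \<longlongrightarrow> l) (at_right 0)"
    by (rule bounded_holomorphic_boundary_limit_AE)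
  moreover have "AE t in lebesgue. \<not> filterlim (\<lambda>n. ln (cmod (M (Complex t (1 / real (n + 2))) + \<i>))) at_top sequentially"
    by (rule herglotz_finite_boundary_AE[OF hol]) (rule pos)
  ultimately show ?thesis
  proof eventually_elim
    case (elim t)
    then obtain l where l: "((\<lambda>\<epsilon>. w (Complex t \<epsilon>)) \<longlongrightarrow> l) (at_right 0)" by blast
    show ?case
    proof (cases "l = 0")
      case False
      then have "((\<lambda>\<epsilon>. 1 / w (Complex t \<epsilon>) - \<i>) \<longlongrightarrow> 1 / l - \<i>) (at_right 0)"
        by (intro tendsto_intros l)
      moreover have "\<forall>\<^sub>F \<epsilon> in at_right 0. 1 / w (Complex t \<epsilon>) - \<i> = M (Complex t \<epsilon>)"
        by (auto simp: w_def eventually_at_right_field intro!: exI[of _ 1])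
      ultimately show ?thesis by (intro exI) (rule Lim_transform_eventually)
    next
      case True
      have "filterlim (\<lambda>n. 1 / real (n + 2)) (at_right 0) sequentially"
        using LIMSEQ_ignore_initial_segment[OF lim_1_over_n[where 'a = real], of 2]
        by (auto simp: filterlim_at)
      from filterlim_compose[OF l this] have "(\<lambda>n. w (Complex t (1 / real (n + 2)))) \<longlonglongrightarrow> 0"
        using True by simp
      then have "(\<lambda>n. cmod (w (Complex t (1 / real (n + 2))))) \<longlonglongrightarrow> 0"
        by (simp add: tendsto_norm_zero_iff)
      moreover have "cmod (w (Complex t (1 / real (n + 2)))) > 0" for n
        using nz[of "Complex t (1 / real (n + 2))"] by (simp add: w_def)
      ultimately have "filterlim (\<lambda>n. cmod (w (Complex t (1 / real (n + 2))))) (at_right 0) sequentially"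
        by (auto simp: filterlim_at)
      then have "filterlim (\<lambda>n. ln (inverse (cmod (w (Complex t (1 / real (n + 2))))))) at_top sequentially"
        by (intro filterlim_compose[OF ln_at_top] filterlim_compose[OF filterlim_inverse_at_top_right])
      then show ?thesis using elim(2) by (simp add: w_def norm_divide)
    qed
  qed
qed

lemma boundary_value_eq: "((\<lambda>\<epsilon>. M (Complex t \<epsilon>)) \<longlongrightarrow> l) (at_right 0) \<Longrightarrow> boundary_value M t = l"
  unfolding boundary_value_def by (rule tendsto_Lim[rotated]) simp_all

text \<open>Almost everywhere the boundary value is the limit along the heights \<open>1 / n\<close>, and a function that agrees almost
  everywhere with a Lebesgue measurable one is Lebesgue measurable.\<close>

lemma boundary_value_measurable:
  assumes cont: "continuous_on {z. 0 < Im z} M"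
    and lim: "AE t in lebesgue. \<exists>l. ((\<lambda>\<epsilon>. M (Complex t \<epsilon>)) \<longlongrightarrow> l) (at_right 0)"
  shows "boundary_value M \<in> borel_measurable lebesgue"
proof (rule borel_measurable_AE)
  define f where "f n t = M (Complex t (1 / real (Suc n)))" for n t
  have "continuous_on UNIV (f n)" for n
    unfolding f_def
    by (rule continuous_on_compose2[OF cont]) (auto simp: Complex_eq intro!: continuous_intros)
  then have "f n \<in> borel_measurable lebesgue" for n
    by (intro measurable_completion) (simp add: borel_measurable_continuous_onI)
  then show "(\<lambda>t. lim (\<lambda>n. f n t)) \<in> borel_measurable lebesgue"
    by (rule borel_measurable_lim_metric)
  have seq: "filterlim (\<lambda>n. 1 / real (Suc n)) (at_right 0) sequentially"
    using LIMSEQ_inverse_real_of_nat by (auto simp: filterlim_at inverse_eq_divide)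
  show "AE t in lebesgue. lim (\<lambda>n. f n t) = boundary_value M t"
    using lim
  proof eventually_elim
    case (elim t)
    then obtain l where l: "((\<lambda>\<epsilon>. M (Complex t \<epsilon>)) \<longlongrightarrow> l) (at_right 0)" by blast
    have "(\<lambda>n. f n t) \<longlonglongrightarrow> l" unfolding f_def by (rule filterlim_compose[OF l seq])
    then show ?case using boundary_value_eq[OF l] by (simp add: limI)
  qed
qed

text \<open>The inequality passes to the limit wherever all three limits exist.\<close>

lemma boundary_ratio_Linfty:
  assumes F: "F holomorphic_on {z. 0 < Im z}" "\<And>z. 0 < Im z \<Longrightarrow> 0 < Im (F z)"
    and G: "G holomorphic_on {z. 0 < Im z}" "\<And>z. 0 < Im z \<Longrightarrow> 0 < Im (G z)"
    and H: "H holomorphic_on {z. 0 < Im z}" "\<And>z. 0 < Im z \<Longrightarrow> 0 < Im (H z)"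
    and le: "\<And>z. 0 < Im z \<Longrightarrow> \<bar>Im (H z)\<bar> \<le> C * cmod (F z - G z)"
  shows "(\<lambda>t. of_real (Im (boundary_value H t)) / (boundary_value F t - boundary_value G t)) \<in> Linfty"
proof -
  have lims: "AE t in lebesgue. \<exists>l. ((\<lambda>\<epsilon>. F (Complex t \<epsilon>)) \<longlongrightarrow> l) (at_right 0)"
    "AE t in lebesgue. \<exists>l. ((\<lambda>\<epsilon>. G (Complex t \<epsilon>)) \<longlongrightarrow> l) (at_right 0)"
    "AE t in lebesgue. \<exists>l. ((\<lambda>\<epsilon>. H (Complex t \<epsilon>)) \<longlongrightarrow> l) (at_right 0)"
    by (rule herglotz_boundary_limit_AE, fact, erule F G H)+
  have [measurable]: "boundary_value F \<in> borel_measurable lebesgue"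
    "boundary_value G \<in> borel_measurable lebesgue" "boundary_value H \<in> borel_measurable lebesgue"
    using F(1) G(1) H(1) lims
    by (auto intro!: boundary_value_measurable holomorphic_on_imp_continuous_on)
  have "(\<lambda>t. complex_of_real (Im (boundary_value H t)) / (boundary_value F t - boundary_value G t)) \<in> borel_measurable lebesgue"
  proof -
    have "(\<lambda>t. complex_of_real (Im (boundary_value H t))) \<in> borel_measurable lebesgue"
      by (rule measurable_compose[of "boundary_value H" lebesgue borel])
         (auto intro!: borel_measurable_continuous_onI continuous_intros)
    then show ?thesis by measurable
  qed
  moreover have "AE t in lebesgue. cmod (of_real (Im (boundary_value H t)) / (boundary_value F t - boundary_value G t)) \<le> \<bar>C\<bar>"
    using lims
  proof eventually_elim
    case (elim t)
    then obtain f g h where f: "((\<lambda>\<epsilon>. F (Complex t \<epsilon>)) \<longlongrightarrow> f) (at_right 0)"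
      and g: "((\<lambda>\<epsilon>. G (Complex t \<epsilon>)) \<longlongrightarrow> g) (at_right 0)" and h: "((\<lambda>\<epsilon>. H (Complex t \<epsilon>)) \<longlongrightarrow> h) (at_right 0)"
      by blast
    have "\<bar>Im h\<bar> \<le> C * cmod (f - g)"
    proof (rule tendsto_le)
      show "((\<lambda>\<epsilon>. \<bar>Im (H (Complex t \<epsilon>))\<bar>) \<longlongrightarrow> \<bar>Im h\<bar>) (at_right 0)" by (intro tendsto_intros h)
      show "((\<lambda>\<epsilon>. C * cmod (F (Complex t \<epsilon>) - G (Complex t \<epsilon>))) \<longlongrightarrow> C * cmod (f - g)) (at_right 0)"
        by (intro tendsto_intros f g)
      show "\<forall>\<^sub>F \<epsilon> in at_right 0. \<bar>Im (H (Complex t \<epsilon>))\<bar> \<le> C * cmod (F (Complex t \<epsilon>) - G (Complex t \<epsilon>))"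
        using le by (auto simp: eventually_at_right_field intro!: exI[of _ 1])
    qed simp
    also have "\<dots> \<le> \<bar>C\<bar> * cmod (f - g)" by (intro mult_right_mono) auto
    finally have "\<bar>Im h\<bar> / cmod (f - g) \<le> \<bar>C\<bar>"
      by (cases "f = g") (simp_all add: divide_le_eq)
    then show ?case
      by (simp add: boundary_value_eq[OF f] boundary_value_eq[OF g] boundary_value_eq[OF h] norm_divide)
  qed
  ultimately show ?thesis unfolding Linfty_def by blast
qed

section \<open>Similarity to a selfadjoint operator\<close>

theorem corollary5p3:
  fixes q :: "real \<Rightarrow> real"
  assumes "continuous_on UNIV q"
    and "deficiency_index (L2_on {0<..}) (sl_min q {0<..}) \<i> = 1"
    and "deficiency_index (L2_on {0<..}) (sl_min q {0<..}) (-\<i>) = 1"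
    and "deficiency_index (L2_on {..<0}) (sl_min q {..<0}) \<i> = 1"
    and "deficiency_index (L2_on {..<0}) (sl_min q {..<0}) (-\<i>) = 1"
    and "\<exists>T. selfadjoint T \<and> similar (sl_A q) T"
  shows "(\<lambda>t. of_real (Im (boundary_value (M_plus q) t)) /
              (boundary_value (M_plus q) t - boundary_value (M_minus q) t)) \<in> Linfty \<and>
         (\<lambda>t. of_real (Im (boundary_value (M_minus q) t)) /
              (boundary_value (M_plus q) t - boundary_value (M_minus q) t)) \<in> Linfty"
proof -
  note q = assms(1)
  have q': "continuous_on UNIV (\<lambda>x. q (- x))" by (rule continuous_reflect[OF q])
  have lp: "limit_point q" "limit_point (\<lambda>x. q (- x))"
    using limit_point_right[OF q assms(2)] limit_point_left[OF q assms(4)] by auto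
  obtain T where T: "selfadjoint T" "similar (sl_A q) T" using assms(6) by blast
  obtain K where K: "0 \<le> K" "\<And>f g z. (f, g) \<in> sl_A q \<Longrightarrow> \<bar>Im z\<bar> * norm f \<le> K * norm (g - scaleC z f)"
    using similar_selfadjoint_resolvent_bound[OF T] by blast
  have hol: "M_plus q holomorphic_on {z. 0 < Im z}" "M_minus q holomorphic_on {z. 0 < Im z}"
    by (rule holomorphic_on_subset[OF M_plus_herglotz(1)[OF q lp(1)]], force,
        rule holomorphic_on_subset[OF M_minus_herglotz(1)[OF q lp(2)]], force)
  have pos: "0 < Im (M_plus q z)" "0 < Im (M_minus q z)" if "0 < Im z" for z
    using M_plus_herglotz(2)[OF q lp(1), of z] M_minus_herglotz(2)[OF q lp(2), of z] that
      weyl_vector_nonzero[OF q lp(1), of z] weyl_vector_nonzero[OF q' lp(2), of "- z"] by auto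
  have le: "\<bar>Im (M_plus q z)\<bar> \<le> (K + 1) * cmod (M_plus q z - M_minus q z)"
    "\<bar>Im (M_minus q z)\<bar> \<le> (K + 1) * cmod (M_plus q z - M_minus q z)" if "0 < Im z" for z
    using weyl_ratio_bounds[OF q lp K, of z] that by auto
  show ?thesis
    by (intro conjI boundary_ratio_Linfty[where C = "K + 1"] hol pos le)
qed

end
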